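(* Let $\mathbf X\in\mathbb R^{n\times d_x}$, $\mathbf Y\in\mathbb R^{n\times d_y}$ and $\delta\in(0,1)$. Set $q_i=\tilde\Theta\big(\log(md_x/p_i)/\varepsilon\big)$ with constant $\varepsilon>0$ and $p_i=\delta/(2i^2)$ for $i=1,2,\dots$. Then, with probability at least $1-\delta$, the outputs $\mathbf A$ and $\mathbf B$ of the Sparse Co-Occurring Directions algorithm (SCOD) run on $\mathbf X,\mathbf Y$ with sketch size $m$ and sequence $(q_i)$ satisfy $$\|\mathbf X^\top\mathbf Y-\mathbf A^\top\mathbf B\|_2\le\left(\frac{2+\varepsilon}{m-k}+\frac{(1+\varepsilon)k}{(m-k)^2}\right)\Big(\|\mathbf X\|_F\|\mathbf Y\|_F-\|\mathbf X^\top\mathbf Y\|_k\Big)$$ for all $k<m$.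
   Context: $\tilde\Theta(\cdot)$ denotes order of magnitude up to logarithmic factors. For a real matrix $\mathbf M$, $\sigma_1(\mathbf M)\ge\sigma_2(\mathbf M)\ge\cdots$ are its singular values (zero beyond the rank), $\|\mathbf M\|_2=\sigma_1(\mathbf M)$ is the spectral norm, $\|\mathbf M\|_F$ the Frobenius norm, $\|\mathbf M\|_k=\sum_{i=1}^k\sigma_i(\mathbf M)$ the Ky Fan $k$-norm (zero for $k=0$), and $\operatorname{nnz}(\mathbf M)$ the number of nonzero entries; $k$ ranges over nonnegative integers. $[\mathbf P;\mathbf Q]$ denotes vertical stacking. The sketch size $m$ is assumed much smaller than $n$, $d_x$ and $d_y$. Subspace power method $\mathrm{SPM}(\mathbf M,m,q)$ for $\mathbf M\in\mathbb R^{d_1\times d_2}$, target rank $m$ and integer $q>0$: draw $\mathbf G\in\mathbb R^{d_2\times m}$ with i.i.d. $\mathcal N(0,1)$ entries, form $\mathbf K=(\mathbf M\mathbf M^\top)^q\mathbf M\mathbf G\in\mathbb R^{d_1\times m}$, and return a matrix $\mathbf Z$ whose columns form an orthonormal basis of the column space of $\mathbf K$. SCOD algorithm. Input: $\mathbf X,\mathbf Y$ with $t$-th rows $(\mathbf x^{(t)})^\top,(\mathbf y^{(t)})^\top$, sketch size $m$, failure probability $\delta$, sequence $(q_i)_{i\ge1}$. Initialize $\mathbf A=\mathbf 0_{m\times d_x}$, $\mathbf B=\mathbf 0_{m\times d_y}$, and empty buffers $\mathbf X',\mathbf Y'$. For $t=1,\dots,n$: append $(\mathbf x^{(t)})^\top$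 to $\mathbf X'$ and $(\mathbf y^{(t)})^\top$ to $\mathbf Y'$ as new last rows. If $\operatorname{nnz}(\mathbf X')+\operatorname{nnz}(\mathbf Y')>m(d_x+d_y)$, or $t=n$, or the buffers have $d_x+d_y$ rows, then, this being the $i$-th time the condition is met: (1) Compression: $\mathbf Z=\mathrm{SPM}(\mathbf X'^\top\mathbf Y',m,q_i)$; compute a singular value decomposition $\mathbf Z^\top\mathbf X'^\top\mathbf Y'=\widetilde{\mathbf U}\widetilde{\mathbf\Sigma}\widetilde{\mathbf V}^\top$; set $\widetilde{\mathbf X}=\widetilde{\mathbf\Sigma}^{1/2}\widetilde{\mathbf U}^\top\mathbf Z^\top\in\mathbb R^{m\times d_x}$ and $\widetilde{\mathbf Y}=\widetilde{\mathbf\Sigma}^{1/2}\widetilde{\mathbf V}^\top\in\mathbb R^{m\times d_y}$ (padded by zero rows if $\mathbf Z$ has fewer than $m$ columns). (2) Merging: replace $\mathbf A$ by $[\mathbf A;\widetilde{\mathbf X}]$ and $\mathbf B$ by $[\mathbf B;\widetilde{\mathbf Y}]$ ($2m$ rows each); compute reduced QR factorizations $\mathbf A^\top=\mathbf Q_x\mathbf R_x$, $\mathbf B^\top=\mathbf Q_y\mathbf R_y$ ($\mathbf Q_x,\mathbf Q_y$ with $2m$ orthonormal columns, $\mathbf R_x,\mathbf R_y\in\mathbb R^{2m\times 2m}$) and a singular value decomposition of $\mathbf R_x\mathbf R_y^\top$; let $\mathbf U,\mathbf V\in\mathbb R^{2m\times m}$ contain the left and right singular vectors for the $m$ largest singular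 values and $\mathbf\Sigma\in\mathbb R^{m\times m}$ the diagonal matrix of these singular values; let $\gamma=\sigma_m(\mathbf R_x\mathbf R_y^\top)$, $\widehat{\mathbf\Sigma}=\max(\mathbf\Sigma-\gamma\mathbf I_m,\mathbf 0)$ (entrywise), and replace $\mathbf A$ by $\widehat{\mathbf\Sigma}^{1/2}\mathbf U^\top\mathbf Q_x^\top$ and $\mathbf B$ by $\widehat{\mathbf\Sigma}^{1/2}\mathbf V^\top\mathbf Q_y^\top$ ($m$ rows each). (3) Empty the buffers $\mathbf X',\mathbf Y'$. Output: the final $\mathbf A,\mathbf B$. Probability is over the Gaussian matrices drawn in the calls of SPM, which are independent. *)

theory Defs
  imports
    "HOL-Probability.Probability"
    "Jordan_Normal_Form.Char_Poly"
    "Jordan_Normal_Form.VS_Connect"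
begin

text \<open>
  Sizes vary inside the statement, so matrices are those of \<^theory>\<open>Jordan_Normal_Form.Matrix\<close>
  (0-based indices). Singular values are numbered from 1.
\<close>

section \<open>Singular values and norms\<close>

text \<open>For a matrix with \<open>d\<close> columns the list has length \<open>d\<close>; it may end in zeros.\<close>

definition singular_values :: "real mat \<Rightarrow> real list" where
  "singular_values M =
     rev (sorted_list_of_multiset (image_mset sqrt (proots (char_poly (M\<^sup>T * M)))))"

definition sigma :: "nat \<Rightarrow> real mat \<Rightarrow> real" where
  "sigma i M =
     (if 1 \<le> i \<and> i \<le> length (singular_values M) then singular_values M ! (i - 1) else 0)"

definition spectral_norm :: "real mat \<Rightarrow> real" where
  "spectral_norm M = sigma 1 M"

definition ky_fan_norm :: "nat \<Rightarrow> real mat \<Rightarrow> real" where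
  "ky_fan_norm k M = (\<Sum>i = 1..k. sigma i M)"

definition frobenius_norm :: "real mat \<Rightarrow> real" where
  "frobenius_norm M = sqrt (\<Sum>i<dim_row M. \<Sum>j<dim_col M. (M $$ (i, j))\<^sup>2)"

definition nnz :: "real mat \<Rightarrow> nat" where
  "nnz M = card {(i, j). i < dim_row M \<and> j < dim_col M \<and> M $$ (i, j) \<noteq> 0}"

section \<open>Matrix factorizations\<close>

text \<open>
  Factorizations are not unique, so they are relations between the input and any admissible
  result; every procedure below is accordingly a relation that allows all such choices.
\<close>

definition orthonormal_cols :: "real mat \<Rightarrow> bool" where
  "orthonormal_cols Q \<longleftrightarrow> Q\<^sup>T * Q = 1\<^sub>m (dim_col Q)"

definition thin_svd :: "real mat \<Rightarrow> real mat \<Rightarrow> real mat \<Rightarrow> real mat \<Rightarrow> bool" where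
  "thin_svd M U S V \<longleftrightarrow>
     (let p = min (dim_row M) (dim_col M) in
        U \<in> carrier_mat (dim_row M) p \<and> S \<in> carrier_mat p p \<and> V \<in> carrier_mat (dim_col M) p \<and>
        orthonormal_cols U \<and> orthonormal_cols V \<and> diagonal_mat S \<and>
        (\<forall>i<p. 0 \<le> S $$ (i, i)) \<and>
        (\<forall>i j. i \<le> j \<longrightarrow> j < p \<longrightarrow> S $$ (j, j) \<le> S $$ (i, i)) \<and>
        M = U * S * V\<^sup>T)"

definition reduced_qr :: "real mat \<Rightarrow> real mat \<Rightarrow> real mat \<Rightarrow> bool" where
  "reduced_qr M Q R \<longleftrightarrow>
     Q \<in> carrier_mat (dim_row M) (dim_col M) \<and> R \<in> carrier_mat (dim_col M) (dim_col M) \<and>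
     orthonormal_cols Q \<and> upper_triangular R \<and> M = Q * R"

section \<open>Subspace power method\<close>

definition spm :: "real mat \<Rightarrow> nat \<Rightarrow> real mat \<Rightarrow> real mat \<Rightarrow> bool" where
  "spm M q G Z \<longleftrightarrow>
     (let K = (M * M\<^sup>T) ^\<^sub>m q * M * G in
        dim_row Z = dim_row M \<and> orthonormal_cols Z \<and>
        vec_space.col_space (dim_row M) Z = vec_space.col_space (dim_row M) K)"

section \<open>Sparse Co-Occurring Directions\<close>

text \<open>Square roots are entrywise; they are only taken of nonnegative diagonal matrices.\<close>

definition scod_compress ::
  "nat \<Rightarrow> nat \<Rightarrow> real mat \<Rightarrow> real mat \<Rightarrow> real mat \<Rightarrow> real mat \<Rightarrow> real mat \<Rightarrow> bool" where
  "scod_compress m q G X' Y' Xt Yt \<longleftrightarrow>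
     (\<exists>Z U S V. spm (X'\<^sup>T * Y') q G Z \<and> thin_svd (Z\<^sup>T * X'\<^sup>T * Y') U S V \<and>
        Xt = (map_mat sqrt S * U\<^sup>T * Z\<^sup>T) @\<^sub>r 0\<^sub>m (m - dim_col Z) (dim_col X') \<and>
        Yt = (map_mat sqrt S * V\<^sup>T) @\<^sub>r 0\<^sub>m (m - dim_col Z) (dim_col Y'))"

definition scod_merge ::
  "nat \<Rightarrow> real mat \<Rightarrow> real mat \<Rightarrow> real mat \<Rightarrow> real mat \<Rightarrow> real mat \<Rightarrow> real mat \<Rightarrow> bool" where
  "scod_merge m A B Xt Yt A' B' \<longleftrightarrow>
     (\<exists>Qx Rx Qy Ry U S V.
        reduced_qr ((A @\<^sub>r Xt)\<^sup>T) Qx Rx \<and> reduced_qr ((B @\<^sub>r Yt)\<^sup>T) Qy Ry \<and>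
        thin_svd (Rx * Ry\<^sup>T) U S V \<and>
        (let Um = Matrix.mat (2 * m) m (\<lambda>(i, j). U $$ (i, j));
             Vm = Matrix.mat (2 * m) m (\<lambda>(i, j). V $$ (i, j));
             Sm = Matrix.mat m m (\<lambda>(i, j). S $$ (i, j));
             \<gamma> = sigma m (Rx * Ry\<^sup>T);
             Sh = map_mat (\<lambda>x. max x 0) (Sm - \<gamma> \<cdot>\<^sub>m 1\<^sub>m m)
         in A' = map_mat sqrt Sh * Um\<^sup>T * Qx\<^sup>T \<and>
            B' = map_mat sqrt Sh * Vm\<^sup>T * Qy\<^sup>T))"

definition scod_full :: "nat \<Rightarrow> nat \<Rightarrow> nat \<Rightarrow> real mat \<Rightarrow> real mat \<Rightarrow> bool" where
  "scod_full m n t X' Y' \<longleftrightarrow>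
     nnz X' + nnz Y' > m * (dim_col X' + dim_col Y') \<or> t = n \<or>
     dim_row X' = dim_col X' + dim_col Y'"

text \<open>
  \<open>scod_state X Y m q G t A B X' Y' i\<close>: after \<open>t\<close> rows have been processed, with \<open>i\<close> compressions
  performed so far, the sketches can be \<open>A\<close>, \<open>B\<close> and the buffers \<open>X'\<close>, \<open>Y'\<close>.
  The \<open>i\<close>-th compression uses \<open>q i\<close> and \<open>G i\<close>, for \<open>i \<ge> 1\<close>.
\<close>

inductive scod_state ::
  "real mat \<Rightarrow> real mat \<Rightarrow> nat \<Rightarrow> (nat \<Rightarrow> nat) \<Rightarrow> (nat \<Rightarrow> real mat) \<Rightarrow>
   nat \<Rightarrow> real mat \<Rightarrow> real mat \<Rightarrow> real mat \<Rightarrow> real mat \<Rightarrow> nat \<Rightarrow> bool"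
  for X Y :: "real mat" and m :: nat and q :: "nat \<Rightarrow> nat" and G :: "nat \<Rightarrow> real mat"
where
  init: "scod_state X Y m q G 0 (0\<^sub>m m (dim_col X)) (0\<^sub>m m (dim_col Y))
           (0\<^sub>m 0 (dim_col X)) (0\<^sub>m 0 (dim_col Y)) 0"
| buffer: "scod_state X Y m q G (Suc t) A B X'' Y'' i"
  if "scod_state X Y m q G t A B X' Y' i" and "t < dim_row X"
    and "X'' = X' @\<^sub>r mat_of_row (Matrix.row X t)" and "Y'' = Y' @\<^sub>r mat_of_row (Matrix.row Y t)"
    and "\<not> scod_full m (dim_row X) (Suc t) X'' Y''"
| compress: "scod_state X Y m q G (Suc t) A' B' (0\<^sub>m 0 (dim_col X)) (0\<^sub>m 0 (dim_col Y)) (Suc i)"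
  if "scod_state X Y m q G t A B X' Y' i" and "t < dim_row X"
    and "X'' = X' @\<^sub>r mat_of_row (Matrix.row X t)" and "Y'' = Y' @\<^sub>r mat_of_row (Matrix.row Y t)"
    and "scod_full m (dim_row X) (Suc t) X'' Y''"
    and "scod_compress m (q (Suc i)) (G (Suc i)) X'' Y'' Xt Yt"
    and "scod_merge m A B Xt Yt A' B'"

definition scod_output ::
  "real mat \<Rightarrow> real mat \<Rightarrow> nat \<Rightarrow> (nat \<Rightarrow> nat) \<Rightarrow> (nat \<Rightarrow> real mat) \<Rightarrow> real mat \<Rightarrow> real mat \<Rightarrow> bool"
where
  "scod_output X Y m q G A B \<longleftrightarrow> (\<exists>X' Y' i. scod_state X Y m q G (dim_row X) A B X' Y' i)"

section \<open>Probability\<close>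

definition gaussian_entries :: "nat \<Rightarrow> nat \<Rightarrow> (nat \<times> nat \<Rightarrow> real) measure" where
  "gaussian_entries d m =
     (\<Pi>\<^sub>M ij\<in>{..<d} \<times> {..<m}. density lborel (\<lambda>x. ennreal (std_normal_density x)))"

text \<open>Independent Gaussian matrices for the compressions \<open>i = 1, 2, \<dots>\<close>\<close>

definition gaussian_draws :: "nat \<Rightarrow> nat \<Rightarrow> (nat \<Rightarrow> nat \<times> nat \<Rightarrow> real) measure" where
  "gaussian_draws d m = (\<Pi>\<^sub>M i\<in>{1..}. gaussian_entries d m)"

text \<open>
  \<open>P\<close> contains an event of probability at least \<open>p\<close>. If \<open>P\<close> is itself an event this says that its
  probability is at least \<open>p\<close>; otherwise it is the same for its inner probability. Measurability
  of \<open>P\<close> is not presupposed because it quantifies over all factorizations a run may use.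
\<close>

definition with_prob_at_least :: "'w measure \<Rightarrow> real \<Rightarrow> ('w \<Rightarrow> bool) \<Rightarrow> bool" where
  "with_prob_at_least W p P \<longleftrightarrow>
     (\<exists>E\<in>sets W. p \<le> measure W E \<and> (\<forall>\<omega>\<in>E. P \<omega>))"

section \<open>Iteration counts\<close>

text \<open>
  \<open>q\<close> has order \<open>f\<close> up to logarithmic factors: \<open>c\<close> and \<open>C\<close> are the hidden constants, \<open>N\<close> is the
  quantity whose logarithm is suppressed and \<open>a\<close> is the exponent of the logarithmic factor.
\<close>

definition order_up_to_logs :: "real \<Rightarrow> real \<Rightarrow> nat \<Rightarrow> real \<Rightarrow> real \<Rightarrow> real \<Rightarrow> bool" where
  "order_up_to_logs c C a N f q \<longleftrightarrow> c * f \<le> q \<and> q \<le> C * f * ln N ^ a"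

definition fail_prob :: "real \<Rightarrow> nat \<Rightarrow> real" where
  "fail_prob \<delta> i = \<delta> / (2 * (real i)\<^sup>2)"

end

theory Submission
  imports Defs "Jordan_Normal_Form.Schur_Decomposition"
begin

text \<open>
  Ky Fan norms are maxima of \<open>\<Sum>i<k. p\<^sub>i \<bullet> M q\<^sub>i\<close> over families satisfying Bessel's inequality, which
  gives their triangle inequality and \<open>\<parallel>A\<^sup>T B\<parallel>\<^sub>k \<le> \<parallel>A\<parallel>\<^sub>F \<parallel>B\<parallel>\<^sub>F\<close>.

  Let \<open>M\<^sub>i\<close> be the product of the buffers at the \<open>i\<close>-th compression and \<open>\<gamma>\<^sub>i\<close> the shrinkage of the \<open>i\<close>-th
  merge. If every compression errs by at most \<open>(1 + \<epsilon>) \<sigma>\<^sub>m\<^sub>+\<^sub>1(M\<^sub>i)\<close>, the total error is at most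
  \<open>\<Gamma> + (1 + \<epsilon>) e\<close> with \<open>\<Gamma> = \<Sum>\<gamma>\<^sub>i\<close> and \<open>e = \<Sum>\<sigma>\<^sub>m\<^sub>+\<^sub>1(M\<^sub>i)\<close>. As \<open>(m - k) \<sigma>\<^sub>m\<^sub>+\<^sub>1(M\<^sub>i) + \<parallel>M\<^sub>i\<parallel>\<^sub>k \<le> \<parallel>M\<^sub>i\<parallel>\<^sub>m\<close>,
  summation gives \<open>(m - k) e \<le> T = \<parallel>X\<parallel>\<^sub>F \<parallel>Y\<parallel>\<^sub>F - \<parallel>X\<^sup>T Y\<parallel>\<^sub>k\<close>. Stacking raises
  the potential \<open>\<parallel>A\<parallel>\<^sub>F\<^sup>2\<close> by at most the product of the Frobenius norms of the two buffers, and the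
  \<open>i\<close>-th merge lowers it by at least \<open>m \<gamma>\<^sub>i\<close>, so \<open>m \<Gamma> + \<parallel>A\<^sup>T B\<parallel>\<^sub>k \<le> \<parallel>X\<parallel>\<^sub>F \<parallel>Y\<parallel>\<^sub>F\<close>; since \<open>\<parallel>A\<^sup>T B\<parallel>\<^sub>k\<close> differs from \<open>\<parallel>X\<^sup>T Y\<parallel>\<^sub>k\<close>
  by at most \<open>k\<close> times the error, \<open>(m - k) \<Gamma> \<le> T + k (1 + \<epsilon>) e\<close>.

  The buffers do not depend on the Gaussian draws, so each \<open>M\<^sub>i\<close> is fixed. Write the draw in the right
  singular basis of \<open>M\<^sub>i\<close> and split it into its first \<open>m\<close> rows \<open>\<Omega>\<^sub>1\<close> and the remaining rows \<open>\<Omega>\<^sub>2\<close> with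
  nonzero singular value. A power mean inequality bounds the compression error by
  \<open>(1 + F)\<close> to the power \<open>1 / (2 (2 q + 1))\<close> times \<open>\<sigma>\<^sub>m\<^sub>+\<^sub>1\<close>, with \<open>F = \<parallel>\<Omega>\<^sub>2\<parallel>\<^sub>F\<^sup>2 \<parallel>\<Omega>\<^sub>1\<^sup>-\<^sup>1\<parallel>\<^sub>F\<^sup>2\<close>. Markov's inequality
  bounds \<open>\<Omega>\<^sub>2\<close>. Column \<open>c\<close> of \<open>\<Omega>\<^sub>1\<close> has a one-dimensional Gaussian component along its cofactor vector,
  which depends only on the other columns; this bounds \<open>\<Omega>\<^sub>1\<^sup>-\<^sup>1\<close>. Hence \<open>1 + F\<close> is polynomial in
  \<open>m d\<^sub>x / p\<^sub>i\<close>, and its logarithm is absorbed by \<open>q\<^sub>i\<close>.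
\<close>

section \<open>Spectral theorem and singular vectors\<close>

lemma index_mult_mat_sum:
  assumes "A \<in> carrier_mat a b" "B \<in> carrier_mat b c" "i < a" "j < c"
  shows "(A * B) $$ (i, j) = (\<Sum>k<b. A $$ (i, k) * B $$ (k, j))"
  using assms by (simp add: scalar_prod_def atLeast0LessThan)

text \<open>Gram-Schmidt on a basis completion of \<open>v\<close> keeps \<open>v\<close> as its
  first vector; dividing each vector by its length makes the family orthonormal. Having
  \<open>v\<close> in column 0 is what lets \<open>symmetric_mat_diagonalizable\<close> split off an
  eigenvector.\<close>

lemma real_orthonormal_basis_from:
  fixes v :: "real vec"
  assumes v: "v \<in> carrier_vec n" and v0: "v \<noteq> 0\<^sub>v n"
  obtains W where "W \<in> carrier_mat n n" "W\<^sup>T * W = 1\<^sub>m n"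
    "col W 0 = (1 / sqrt (v \<bullet> v)) \<cdot>\<^sub>v v"
proof -
  have n: "n \<noteq> 0" using v v0 by (cases n) auto
  interpret cof_vec_space n "TYPE(real)" .
  define b where "b = basis_completion v"
  define ws where "ws = gram_schmidt n b"
  from basis_completion[OF v v0, folded b_def]
  have dist_b: "distinct b" and indep: "\<not> lin_dep (set b)" and b: "set b \<subseteq> carrier_vec n"
    and hdb: "hd b = v" and len_b: "length b = n" by auto
  from hdb len_b n obtain vs where bv: "b = v # vs" by (cases b) auto
  from gram_schmidt_result[OF b dist_b indep refl, folded ws_def]
  have ws: "set ws \<subseteq> carrier_vec n" "corthogonal ws" "length ws = n" by (auto simp: len_b)
  have hdws: "hd ws = v" using gram_schmidt_hd[OF v, of vs, folded bv] unfolding ws_def .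
  have ws0: "ws ! 0 = v" using hdws ws(3) n by (metis hd_conv_nth list.size(3))
  have wsc: "ws ! i \<in> carrier_vec n" if "i < n" for i using ws that by auto
  have orth: "(ws ! i \<bullet> ws ! j = 0) = (i \<noteq> j)" if "i < n" "j < n" for i j
    using corthogonalD[OF ws(2), of i j] that ws(3) by simp
  have pos: "ws ! i \<bullet> ws ! i > 0" if "i < n" for i
    using orth[OF that that] sum_nonneg[of "{0..<dim_vec (ws ! i)}" "\<lambda>k. ws ! i $ k * ws ! i $ k"]
    by (simp add: scalar_prod_def order_less_le)
  define c where "c i = 1 / sqrt (ws ! i \<bullet> ws ! i)" for i
  define W where "W = mat_of_cols n (map (\<lambda>i. c i \<cdot>\<^sub>v ws ! i) [0..<n])"
  have W: "W \<in> carrier_mat n n" unfolding W_def by (auto simp: mat_of_cols_def)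
  have colW: "col W i = c i \<cdot>\<^sub>v ws ! i" if "i < n" for i
    unfolding W_def using that wsc[OF that] by (subst col_mat_of_cols) auto
  have "W\<^sup>T * W = 1\<^sub>m n"
  proof (rule eq_matI)
    fix i j assume "i < dim_row (1\<^sub>m n :: real mat)" "j < dim_col (1\<^sub>m n :: real mat)"
    then have ij: "i < n" "j < n" by auto
    have "(W\<^sup>T * W) $$ (i, j) = col W i \<bullet> col W j" using W ij by auto
    also have "\<dots> = c i * c j * (ws ! i \<bullet> ws ! j)"
      using wsc[OF ij(1)] wsc[OF ij(2)] by (simp add: colW ij)
    also have "\<dots> = 1\<^sub>m n $$ (i, j)"
    proof (cases "i = j")
      case True
      with pos[OF ij(1)] ij show ?thesis by (simp add: c_def field_simps)
    next
      case False
      with orth[OF ij] ij show ?thesis by simp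
    qed
    finally show "(W\<^sup>T * W) $$ (i, j) = 1\<^sub>m n $$ (i, j)" .
  qed (use W in auto)
  moreover have "col W 0 = (1 / sqrt (v \<bullet> v)) \<cdot>\<^sub>v v"
    using colW[of 0] n by (simp add: c_def ws0)
  ultimately show ?thesis using that W by blast
qed

text \<open>Deflation: rotating an eigenvector for the head \<open>e\<close> into the first
  coordinate makes the matrix block diagonal, and the remaining block is symmetric with the
  characteristic polynomial of the tail. The order of \<open>es\<close> survives on the diagonal, so
  sorted eigenvalues yield sorted singular values.\<close>

lemma symmetric_mat_diagonalizable:
  fixes A :: "real mat"
  assumes "A \<in> carrier_mat n n" "A\<^sup>T = A" "char_poly A = (\<Prod>e\<leftarrow>es. [:- e, 1:])"
  shows "\<exists>V\<in>carrier_mat n n. V\<^sup>T * V = 1\<^sub>m n \<and>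
    V\<^sup>T * A * V = Matrix.mat n n (\<lambda>(i, j). if i = j then es ! i else 0)"
  using assms
proof (induct es arbitrary: n A)
  case Nil
  with degree_monic_char_poly[of A n] have "n = 0" by auto
  with Nil show ?case by (intro bexI[of _ "1\<^sub>m 0"]) auto
next
  case (Cons e es n A)
  let ?n1 = "n - 1"
  note A = Cons(2) and sym = Cons(3)
  from Cons(4) have cp: "char_poly A = [: -e, 1 :] * (\<Prod>e \<leftarrow> es. [:- e, 1:])" by auto
  have mon: "monic (\<Prod>e\<leftarrow> es. [:- e, 1:])" by (rule monic_prod_list, auto)
  have deg: "degree (char_poly A) = Suc (degree (\<Prod>e\<leftarrow> es. [:- e, 1:]))" unfolding cp
    by (subst degree_mult_eq, insert mon, auto)
  with degree_monic_char_poly[OF A] have n: "n \<noteq> 0" by auto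
  have "eigenvalue A e" unfolding eigenvalue_root_char_poly[OF A] cp by simp
  then obtain v where "eigenvector A v e" unfolding eigenvalue_def by blast
  then have v: "v \<in> carrier_vec n" and v0: "v \<noteq> 0\<^sub>v n" and ev: "A *\<^sub>v v = e \<cdot>\<^sub>v v"
    using A unfolding eigenvector_def by auto
  obtain W where W: "W \<in> carrier_mat n n" and WW: "W\<^sup>T * W = 1\<^sub>m n"
    and col0: "col W 0 = (1 / sqrt (v \<bullet> v)) \<cdot>\<^sub>v v"
    using real_orthonormal_basis_from[OF v v0] .
  have WT: "W\<^sup>T \<in> carrier_mat n n" using W by simp
  have WW': "W * W\<^sup>T = 1\<^sub>m n" using mat_mult_left_right_inverse[OF WT W WW] .
  define A' where "A' = W\<^sup>T * A * W"
  have A': "A' \<in> carrier_mat n n" using W A unfolding A'_def by auto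
  have symA': "A'\<^sup>T = A'"
  proof -
    have "A'\<^sup>T = W\<^sup>T * (W\<^sup>T * A)\<^sup>T" unfolding A'_def using W A by (intro transpose_mult) auto
    also have "(W\<^sup>T * A)\<^sup>T = A\<^sup>T * W\<^sup>T\<^sup>T" using W A by (intro transpose_mult) auto
    finally show ?thesis using W A sym unfolding A'_def
      by (simp add: assoc_mult_mat[of _ n n _ n _ n])
  qed
  \<comment> \<open>Column 0 of \<open>W\<close> is an eigenvector and the columns are orthonormal,
    so only the diagonal entry survives; symmetry of \<open>A'\<close> then clears row 0 as
    well.\<close>
  have A'0: "A' $$ (i, 0) = (if i = 0 then e else 0)" if i: "i < n" for i
  proof -
    have "A' $$ (i, 0) = (W\<^sup>T * (A * W)) $$ (i, 0)" unfolding A'_def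
      using W A by (simp add: assoc_mult_mat[of _ n n _ n _ n])
    also have "\<dots> = col W i \<bullet> (A *\<^sub>v col W 0)"
      using W A i n by (auto simp: col_mult2 mult_mat_vec_def)
    also have "A *\<^sub>v col W 0 = e \<cdot>\<^sub>v col W 0"
      unfolding col0 using A v ev by (simp add: mult_mat_vec smult_smult_assoc mult.commute)
    also have "col W i \<bullet> (e \<cdot>\<^sub>v col W 0) = e * (col W i \<bullet> col W 0)" using W i n by simp
    also have "col W i \<bullet> col W 0 = (W\<^sup>T * W) $$ (i, 0)" using W i n by auto
    finally show ?thesis unfolding WW using i n by auto
  qed
  have A'0': "A' $$ (0, i) = (if i = 0 then e else 0)" if i: "i < n" for i
    using A'0[OF i] symA' A' i n by (metis carrier_matD index_transpose_mat(1) gr0I)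
  define A3 where "A3 = Matrix.mat ?n1 ?n1 (\<lambda>(i, j). A' $$ (Suc i, Suc j))"
  define A1 where "A1 = Matrix.mat 1 1 (\<lambda>_. e)"
  have A3: "A3 \<in> carrier_mat ?n1 ?n1" and A1: "A1 \<in> carrier_mat 1 1"
    unfolding A3_def A1_def by auto
  have blk: "A' = four_block_mat A1 (0\<^sub>m 1 ?n1) (0\<^sub>m ?n1 1) A3"
  proof (rule eq_matI)
    fix i j assume "i < dim_row (four_block_mat A1 (0\<^sub>m 1 ?n1) (0\<^sub>m ?n1 1) A3)"
      "j < dim_col (four_block_mat A1 (0\<^sub>m 1 ?n1) (0\<^sub>m ?n1 1) A3)"
    then have ij: "i < n" "j < n" using A1 A3 n by auto
    show "A' $$ (i, j) = four_block_mat A1 (0\<^sub>m 1 ?n1) (0\<^sub>m ?n1 1) A3 $$ (i, j)"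
      using ij n A'0[OF ij(1)] A'0'[OF ij(2)] A1 A3
      by (cases i; cases j) (auto simp: A1_def A3_def)
  qed (use A' A1 A3 n in auto)
  have symA3: "A3\<^sup>T = A3"
  proof (rule eq_matI)
    fix i j assume "i < dim_row A3" "j < dim_col A3"
    then have ij: "i < ?n1" "j < ?n1" using A3 by auto
    have "A' $$ (Suc j, Suc i) = A'\<^sup>T $$ (Suc i, Suc j)" using A' ij by auto
    then show "A3\<^sup>T $$ (i, j) = A3 $$ (i, j)" using ij symA' by (simp add: A3_def)
  qed (use A3 in auto)
  have "similar_mat_wit A' A (W\<^sup>T) W"
    by (rule similar_mat_witI[of _ _ n]) (use W WT A A' WW WW' in \<open>auto simp: A'_def\<close>)
  then have "similar_mat A' A" unfolding similar_mat_def by blast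
  with cp char_poly_similar have cp': "char_poly A' = [: -e,1 :] * (\<Prod> e \<leftarrow> es. [:- e, 1:])"
    by metis
  also have "char_poly A' = char_poly A1 * char_poly A3"
    unfolding blk by (rule char_poly_four_block_zeros_col[OF A1 _ A3]) simp
  also have "char_poly A1 = [: -e,1 :]"
    by (simp add: A1_def char_poly_defs det_def sign_def)
  finally have cp3: "char_poly A3 = (\<Prod> e \<leftarrow> es. [:- e, 1:])"
    by (metis mult_cancel_left pCons_eq_0_iff zero_neq_one)
  from Cons(1)[OF A3 symA3 cp3] obtain V3 where V3: "V3 \<in> carrier_mat ?n1 ?n1"
    and VV3: "V3\<^sup>T * V3 = 1\<^sub>m ?n1"
    and AV3: "V3\<^sup>T * A3 * V3 = Matrix.mat ?n1 ?n1 (\<lambda>(i, j). if i = j then es ! i else 0)" by auto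
  define P where "P = four_block_mat (1\<^sub>m 1) (0\<^sub>m 1 ?n1) (0\<^sub>m ?n1 1) V3"
  have P: "P \<in> carrier_mat n n" unfolding P_def using V3 n
    by (metis One_nat_def Suc_pred' four_block_carrier_mat gr0I one_carrier_mat plus_1_eq_Suc)
  have PT: "P\<^sup>T = four_block_mat (1\<^sub>m 1) (0\<^sub>m 1 ?n1) (0\<^sub>m ?n1 1) (V3\<^sup>T)"
    unfolding P_def using V3 by (subst transpose_four_block_mat) auto
  have PP: "P\<^sup>T * P = 1\<^sub>m n"
    unfolding PT unfolding P_def using V3 n
    by (subst mult_four_block_mat[where ?nr1.0 = 1 and ?n1.0 = 1 and ?n2.0 = ?n1 and ?nr2.0 = ?n1
          and ?nc1.0 = 1 and ?nc2.0 = ?n1]) (auto simp: VV3)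
  have PAP: "P\<^sup>T * A' * P = four_block_mat A1 (0\<^sub>m 1 ?n1) (0\<^sub>m ?n1 1) (V3\<^sup>T * A3 * V3)"
    unfolding PT blk unfolding P_def using V3 A1 A3
    by (subst mult_four_block_mat[where ?nr1.0 = 1 and ?n1.0 = 1 and ?n2.0 = ?n1 and ?nr2.0 = ?n1
          and ?nc1.0 = 1 and ?nc2.0 = ?n1], auto)
      (subst mult_four_block_mat[where ?nr1.0 = 1 and ?n1.0 = 1 and ?n2.0 = ?n1 and ?nr2.0 = ?n1
          and ?nc1.0 = 1 and ?nc2.0 = ?n1], auto)
  have diag: "P\<^sup>T * A' * P = Matrix.mat n n (\<lambda>(i, j). if i = j then (e # es) ! i else 0)"
    unfolding PAP AV3 using A1 n
    by (intro eq_matI) (auto simp: A1_def nth_Cons')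
  have PT': "P\<^sup>T \<in> carrier_mat n n" using P by simp
  have t: "(W * P)\<^sup>T = P\<^sup>T * W\<^sup>T" using W P by (rule transpose_mult)
  have "(W * P)\<^sup>T * (W * P) = P\<^sup>T * (W\<^sup>T * W) * P"
    unfolding t using W P PT' WT by (simp add: assoc_mult_mat[of _ n n _ n _ n])
  then have 1: "(W * P)\<^sup>T * (W * P) = 1\<^sub>m n" using WW PP P PT' by simp
  have 2: "(W * P)\<^sup>T * A * (W * P) = P\<^sup>T * A' * P"
    unfolding t A'_def using W P PT' WT A by (simp add: assoc_mult_mat[of _ n n _ n _ n])
  show ?case using W P 1 2 diag by (intro bexI[of _ "W * P"]) auto
qed


text \<open>The polynomial splits over the complex numbers. For an eigenvector \<open>w\<close> with
  eigenvalue \<open>z\<close>, the Hermitian form at \<open>w\<close> is the squared length of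
  \<open>w\<close> times \<open>z\<close> and also times the conjugate of \<open>z\<close>, so every
  root is real.\<close>

lemma symmetric_char_poly_splits:
  fixes A :: "real mat"
  assumes A: "A \<in> carrier_mat n n" and sym: "A\<^sup>T = A"
  obtains es where "char_poly A = (\<Prod>e\<leftarrow>es. [:- e, 1:])" "length es = n"
proof -
  have h: "comm_ring_hom complex_of_real" by unfold_locales auto
  interpret hp: map_poly_comm_ring_hom complex_of_real by unfold_locales auto
  define C where "C = map_mat complex_of_real A"
  have C: "C \<in> carrier_mat n n" unfolding C_def using A by auto
  from char_poly_factorized[OF C] obtain zs where
    zs: "char_poly C = (\<Prod>z\<leftarrow>zs. [:- z, 1:])" and len: "length zs = n" by blast
  have real: "of_real (Re z) = z" if "z \<in> set zs" for z
  proof -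
    have "poly (char_poly C) z = 0" unfolding zs using that
      by (induct zs) auto
    then have "eigenvalue C z" unfolding eigenvalue_root_char_poly[OF C] .
    then obtain w where w: "w \<in> carrier_vec n" and w0: "w \<noteq> 0\<^sub>v n" and ev: "C *\<^sub>v w = z \<cdot>\<^sub>v w"
      using C unfolding eigenvalue_def eigenvector_def by auto
    have symC: "cnj (C $$ (j, i)) = C $$ (i, j)" if "i < n" "j < n" for i j
      using arg_cong[OF sym, of "\<lambda>B. B $$ (j, i)"] that A by (simp add: C_def)
    have row: "(\<Sum>j<n. C $$ (i, j) * w $ j) = z * w $ i" if "i < n" for i
      using arg_cong[OF ev, of "\<lambda>x. x $ i"] that w C
      by (simp add: scalar_prod_def atLeast0LessThan)
    define S where "S = (\<Sum>i<n. w $ i * cnj (w $ i))"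
    have "z * S = (\<Sum>i<n. \<Sum>j<n. C $$ (i, j) * w $ j * cnj (w $ i))"
      unfolding S_def sum_distrib_left
      by (intro sum.cong refl) (simp add: row[symmetric] sum_distrib_right flip: mult.assoc)
    also have "\<dots> = (\<Sum>j<n. \<Sum>i<n. C $$ (i, j) * w $ j * cnj (w $ i))" by (rule sum.swap)
    also have "\<dots> = (\<Sum>j<n. w $ j * cnj (\<Sum>i<n. C $$ (j, i) * w $ i))"
      by (intro sum.cong refl) (use symC in \<open>auto simp: sum_distrib_left intro!: sum.cong\<close>)
    also have "\<dots> = cnj z * S" unfolding S_def sum_distrib_left
      by (intro sum.cong refl) (simp add: row)
    finally have *: "z * S = cnj z * S" .
    have S: "S = of_real (\<Sum>i<n. (cmod (w $ i))\<^sup>2)"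
      unfolding S_def of_real_sum by (intro sum.cong refl) (metis complex_norm_square)
    have "S \<noteq> 0"
    proof
      assume "S = 0"
      then have "(\<Sum>i<n. (cmod (w $ i))\<^sup>2) = 0" unfolding S using of_real_eq_0_iff by blast
      then have "\<forall>i<n. w $ i = 0" by (subst (asm) sum_nonneg_eq_0_iff) auto
      then have "w = 0\<^sub>v n" using w by (intro eq_vecI) auto
      with w0 show False by simp
    qed
    with * have "z = cnj z" by simp
    then show ?thesis by (metis complex_is_Real_iff Reals_cnj_iff of_real_Re)
  qed
  have "map_poly complex_of_real (char_poly A) = (\<Prod>z\<leftarrow>zs. [:- z, 1:])"
    using comm_ring_hom.char_poly_hom[OF h A] zs unfolding C_def by simp
  also have "\<dots> = (\<Prod>z\<leftarrow>zs. map_poly complex_of_real [:- Re z, 1:])"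
    using real by (intro arg_cong[where f = prod_list] map_cong refl) (simp add: map_poly_pCons)
  also have "\<dots> = map_poly complex_of_real (\<Prod>z\<leftarrow>zs. [:- Re z, 1:])"
    by (simp add: hp.hom_prod_list o_def)
  finally have "char_poly A = (\<Prod>z\<leftarrow>zs. [:- Re z, 1:])"
    by (auto simp: poly_eq_iff coeff_map_poly)
  then have "char_poly A = (\<Prod>e\<leftarrow>map Re zs. [:- e, 1:])" by (simp add: o_def)
  with len show ?thesis using that[of "map Re zs"] by simp
qed

section \<open>Singular values and a singular value decomposition\<close>

lemma proots_prod_linear:
  "proots (\<Prod>e\<leftarrow>es. [:- e, 1:]) = mset (es :: real list)"
proof (induct es)
  case (Cons e es)
  have "(\<Prod>e\<leftarrow>es. [:- e, 1:]) \<noteq> 0" by (auto simp: prod_list_zero_iff)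
  then have "proots ([:- e, 1:] * (\<Prod>e\<leftarrow>es. [:- e, 1:])) = proots [:- e, 1:] + mset es"
    by (subst proots_mult) (simp_all add: Cons)
  then show ?case unfolding list.map prod_list.Cons proots_linear_factor by simp
qed simp

lemma singular_values_eqI:
  assumes "char_poly (M\<^sup>T * M) = (\<Prod>e\<leftarrow>es. [:- e, 1:])" "sorted (rev es)"
  shows "singular_values M = map sqrt es"
proof -
  have s: "sorted (rev (map sqrt es))"
    using assms(2) by (simp add: rev_map sorted_map sorted_wrt_mono_rel[of _ "(\<le>)"])
  have "sorted_list_of_multiset (mset (map sqrt es)) = rev (map sqrt es)"
    using s by (metis mset_rev sorted_list_of_multiset_mset sorted_sort_id)
  then show ?thesis unfolding singular_values_def assms(1) proots_prod_linear by simp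
qed

text \<open>Vectors are functions of which only the values below \<open>d\<close> count, so families
  of vectors and their sums need no carrier conditions.\<close>

definition ip :: "nat \<Rightarrow> (nat \<Rightarrow> real) \<Rightarrow> (nat \<Rightarrow> real) \<Rightarrow> real" where
  "ip d x y = (\<Sum>i<d. x i * y i)"

definition mv :: "real mat \<Rightarrow> (nat \<Rightarrow> real) \<Rightarrow> nat \<Rightarrow> real" where
  "mv M x i = (\<Sum>j<dim_col M. M $$ (i, j) * x j)"

text \<open>The eigenvalues of \<open>M\<^sup>T * M\<close> are the squared lengths of the columns
  of \<open>M * V\<close>, hence nonnegative, so squaring the singular values recovers them.\<close>

lemma singular_values_props:
  assumes M: "M \<in> carrier_mat d1 d2"
  shows "length (singular_values M) = d2" "sorted (rev (singular_values M))"
    "\<And>s. s \<in> set (singular_values M) \<Longrightarrow> 0 \<le> s"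
    "\<exists>V\<in>carrier_mat d2 d2. V\<^sup>T * V = 1\<^sub>m d2 \<and> V\<^sup>T * (M\<^sup>T * M) * V =
       Matrix.mat d2 d2 (\<lambda>(i, j). if i = j then (singular_values M ! i)\<^sup>2 else 0)"
proof -
  have MM: "M\<^sup>T * M \<in> carrier_mat d2 d2" using M by simp
  have sym: "(M\<^sup>T * M)\<^sup>T = M\<^sup>T * M" using M by (subst transpose_mult) auto
  obtain es' where es': "char_poly (M\<^sup>T * M) = (\<Prod>e\<leftarrow>es'. [:- e, 1:])" "length es' = d2"
    using symmetric_char_poly_splits[OF MM sym] .
  define es where "es = rev (sort es')"
  have len: "length es = d2" and srt: "sorted (rev es)" unfolding es_def using es' by auto
  have cp: "char_poly (M\<^sup>T * M) = (\<Prod>e\<leftarrow>es. [:- e, 1:])"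
    unfolding es'(1) es_def
    by (simp flip: prod_mset_prod_list)
  obtain V where V: "V \<in> carrier_mat d2 d2" and VV: "V\<^sup>T * V = 1\<^sub>m d2" and
    VAV: "V\<^sup>T * (M\<^sup>T * M) * V = Matrix.mat d2 d2 (\<lambda>(i, j). if i = j then es ! i else 0)"
    using symmetric_mat_diagonalizable[OF MM sym cp] by blast
  have sv: "singular_values M = map sqrt es" by (rule singular_values_eqI[OF cp srt])
  have nonneg: "0 \<le> es ! i" if i: "i < d2" for i
  proof -
    have "V\<^sup>T * (M\<^sup>T * M) * V = (M * V)\<^sup>T * (M * V)"
      using M V by (simp add: transpose_mult[of M d1 d2] assoc_mult_mat[of _ d2 d2 _ d1 _ d2]
          assoc_mult_mat[of _ d2 d2 _ d2 _ d2] assoc_mult_mat[of _ d2 d1 _ d2 _ d2])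
    then have "es ! i = ((M * V)\<^sup>T * (M * V)) $$ (i, i)"
      using arg_cong[OF VAV, of "\<lambda>B. B $$ (i, i)"] i by simp
    also have "\<dots> = col (M * V) i \<bullet> col (M * V) i" using M V i by auto
    also have "\<dots> \<ge> 0" by (auto simp: scalar_prod_def intro: sum_nonneg)
    finally show ?thesis .
  qed
  show "length (singular_values M) = d2" using sv len by simp
  show "sorted (rev (singular_values M))"
    unfolding sv using srt by (simp add: rev_map sorted_map sorted_wrt_mono_rel[of _ "(\<le>)"])
  show "\<And>s. s \<in> set (singular_values M) \<Longrightarrow> 0 \<le> s"
    unfolding sv using nonneg len by (auto simp: in_set_conv_nth)
  have "Matrix.mat d2 d2 (\<lambda>(i, j). if i = j then es ! i else 0) =
     Matrix.mat d2 d2 (\<lambda>(i, j). if i = j then (singular_values M ! i)\<^sup>2 else 0)"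
    unfolding sv using nonneg len by (intro eq_matI) auto
  then show "\<exists>V\<in>carrier_mat d2 d2. V\<^sup>T * V = 1\<^sub>m d2 \<and> V\<^sup>T * (M\<^sup>T * M) * V =
       Matrix.mat d2 d2 (\<lambda>(i, j). if i = j then (singular_values M ! i)\<^sup>2 else 0)"
    using V VV VAV by metis
qed

lemma sigma_Suc:
  assumes "M \<in> carrier_mat d1 d2"
  shows "sigma (Suc j) M = (if j < d2 then singular_values M ! j else 0)"
  using singular_values_props(1)[OF assms] by (simp add: sigma_def)

lemma sigma_nonneg:
  assumes M: "M \<in> carrier_mat d1 d2"
  shows "0 \<le> sigma j M"
  using singular_values_props(1,3)[OF M] by (auto simp: sigma_def)

lemma sigma_antimono:
  assumes M: "M \<in> carrier_mat d1 d2" and "i \<le> j"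
  shows "sigma (Suc j) M \<le> sigma (Suc i) M"
proof (cases "j < d2")
  case True
  then show ?thesis using singular_values_props(1,2)[OF M] assms(2)
    by (simp add: sigma_Suc[OF M] sorted_rev_nth_mono)
next
  case False
  then show ?thesis using sigma_nonneg[OF M, of "Suc i"] by (simp add: sigma_Suc[OF M, of j])
qed

text \<open>Left vectors belonging to the singular value \<open>0\<close> are zero, so the system exists without any
  relation between \<open>d1\<close> and \<open>d2\<close>.\<close>

definition svd_system ::
  "nat \<Rightarrow> nat \<Rightarrow> real mat \<Rightarrow> (nat \<Rightarrow> nat \<Rightarrow> real) \<Rightarrow> (nat \<Rightarrow> nat \<Rightarrow> real) \<Rightarrow> bool" where
  "svd_system d1 d2 M u v \<longleftrightarrow>
    (\<forall>i<d2. \<forall>j<d2. ip d2 (v i) (v j) = (if i = j then 1 else 0)) \<and>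
    (\<forall>k<d2. \<forall>l<d2. (\<Sum>j<d2. v j k * v j l) = (if k = l then 1 else 0)) \<and>
    (\<forall>i<d2. \<forall>j<d2. ip d1 (u i) (u j) = (if i = j \<and> sigma (Suc i) M \<noteq> 0 then 1 else 0)) \<and>
    (\<forall>i<d1. \<forall>l<d2. M $$ (i, l) = (\<Sum>j<d2. sigma (Suc j) M * u j i * v j l))"

lemma svd_systemD:
  assumes "svd_system d1 d2 M u v"
  shows "i < d2 \<Longrightarrow> j < d2 \<Longrightarrow> ip d2 (v i) (v j) = (if i = j then 1 else 0)"
    "k < d2 \<Longrightarrow> l < d2 \<Longrightarrow> (\<Sum>j<d2. v j k * v j l) = (if k = l then 1 else 0)"
    "i < d2 \<Longrightarrow> j < d2 \<Longrightarrow>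
      ip d1 (u i) (u j) = (if i = j \<and> sigma (Suc i) M \<noteq> 0 then 1 else 0)"
    "r < d1 \<Longrightarrow> l < d2 \<Longrightarrow> M $$ (r, l) = (\<Sum>j<d2. sigma (Suc j) M * u j r * v j l)"
  using assms unfolding svd_system_def by blast+

text \<open>The right vectors are eigenvectors of \<open>M\<^sup>T * M\<close>. The columns of
  \<open>M * V\<close> are then orthogonal with the singular values as lengths; normalizing the
  nonzero ones gives the left vectors, and \<open>M = M * V * V\<^sup>T\<close> gives the
  dyads.\<close>

lemma svd_exists:
  assumes M: "M \<in> carrier_mat d1 d2"
  obtains u v where "svd_system d1 d2 M u v"
proof -
  obtain V where V: "V \<in> carrier_mat d2 d2" and VV: "V\<^sup>T * V = 1\<^sub>m d2" and
    VAV: "V\<^sup>T * (M\<^sup>T * M) * V = Matrix.mat d2 d2 (\<lambda>(i, j). if i = j then (singular_values M ! i)\<^sup>2 else 0)"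
    using singular_values_props(4)[OF M] by blast
  have VV': "V * V\<^sup>T = 1\<^sub>m d2" using mat_mult_left_right_inverse[OF _ V VV] V by simp
  define s where "s j = sigma (Suc j) M" for j
  define w where "w j i = (M * V) $$ (i, j)" for j i
  define u where "u j i = (if s j = 0 then 0 else w j i / s j)" for j i
  define v where "v j l = V $$ (l, j)" for j l
  have v1: "ip d2 (v i) (v j) = (if i = j then 1 else 0)" if "i < d2" "j < d2" for i j
    using arg_cong[OF VV, of "\<lambda>B. B $$ (i, j)"] that V
    by (simp add: ip_def v_def scalar_prod_def atLeast0LessThan)
  have v2: "(\<Sum>j<d2. v j k * v j l) = (if k = l then 1 else 0)" if "k < d2" "l < d2" for k l
    using arg_cong[OF VV', of "\<lambda>B. B $$ (k, l)"] that V
    by (simp add: v_def scalar_prod_def atLeast0LessThan)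
  have MV: "V\<^sup>T * (M\<^sup>T * M) * V = (M * V)\<^sup>T * (M * V)"
    using M V by (simp add: transpose_mult[of M d1 d2] assoc_mult_mat[of _ d2 d2 _ d1 _ d2]
        assoc_mult_mat[of _ d2 d2 _ d2 _ d2] assoc_mult_mat[of _ d2 d1 _ d2 _ d2])
  have ww: "ip d1 (w i) (w j) = (if i = j then (s i)\<^sup>2 else 0)" if ij: "i < d2" "j < d2" for i j
  proof -
    have "ip d1 (w i) (w j) = ((M * V)\<^sup>T * (M * V)) $$ (i, j)"
      using M V ij by (simp add: ip_def w_def scalar_prod_def atLeast0LessThan)
    then show ?thesis using ij unfolding MV[symmetric] VAV by (simp add: s_def sigma_Suc[OF M])
  qed
  \<comment> \<open>A column of \<open>M * V\<close> belonging to the value 0 has length 0, which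
    agrees with the zero vector chosen for \<open>u j\<close>.\<close>
  have w0: "w j i = s j * u j i" if "j < d2" "i < d1" for i j
  proof (cases "s j = 0")
    case True
    with ww[OF that(1) that(1)] have "(\<Sum>i<d1. w j i * w j i) = 0" by (simp add: ip_def)
    then have "w j i = 0" using that(2) by (subst (asm) sum_nonneg_eq_0_iff) auto
    with True show ?thesis by simp
  qed (simp add: u_def)
  have u: "ip d1 (u i) (u j) = (if i = j \<and> s i \<noteq> 0 then 1 else 0)" if ij: "i < d2" "j < d2" for i j
  proof (cases "s i = 0 \<or> s j = 0")
    case True
    then show ?thesis by (auto simp: ip_def u_def)
  next
    case False
    then have "ip d1 (u i) (u j) = ip d1 (w i) (w j) / (s i * s j)"
      by (simp add: ip_def u_def sum_divide_distrib)
    with False show ?thesis using ww[OF ij] by (simp add: power2_eq_square)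
  qed
  have "M $$ (i, l) = (\<Sum>j<d2. s j * u j i * v j l)" if il: "i < d1" "l < d2" for i l
  proof -
    have "M = M * V * V\<^sup>T" using M V VV' by (simp add: assoc_mult_mat[of _ d1 d2 _ d2 _ d2])
    then have "M $$ (i, l) = (M * V * V\<^sup>T) $$ (i, l)" by simp
    also have "\<dots> = (\<Sum>j<d2. w j i * v j l)"
      using M V il by (subst index_mult_mat_sum[of _ d1 d2 _ d2]) (auto simp: w_def v_def)
    also have "\<dots> = (\<Sum>j<d2. s j * u j i * v j l)"
      by (intro sum.cong refl) (simp add: w0 il)
    finally show ?thesis .
  qed
  with v1 v2 u show ?thesis using that[of u v] unfolding s_def svd_system_def by blast
qed

section \<open>Ky Fan norms\<close>

lemma ip_commute: "ip d x y = ip d y x"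
  by (simp add: ip_def mult.commute)

lemma ip_diff_left: "ip d (\<lambda>i. x i - y i) z = ip d x z - ip d y z"
  by (simp add: ip_def algebra_simps sum_subtractf)

lemma ip_scale_left: "ip d (\<lambda>i. c * x i) z = c * ip d x z"
  by (simp add: ip_def algebra_simps sum_distrib_left)

lemma ip_sum_left: "ip d (\<lambda>i. \<Sum>j\<in>J. x j i) z = (\<Sum>j\<in>J. ip d (x j) z)"
  unfolding ip_def sum_distrib_right by (rule sum.swap)

lemma ip_nonneg: "0 \<le> ip d x x"
  by (simp add: ip_def sum_nonneg)

lemma ip_self: "ip d x x = (\<Sum>i<d. (x i)\<^sup>2)"
  by (simp add: ip_def power2_eq_square)

lemma ip_le_mean: "ip d x y \<le> (ip d x x + ip d y y) / 2"
proof -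
  have "0 \<le> ip d (\<lambda>i. x i - y i) (\<lambda>i. x i - y i)" by (rule ip_nonneg)
  also have "\<dots> = ip d x x + ip d y y - 2 * ip d x y"
    by (simp add: ip_def algebra_simps sum_subtractf sum.distrib sum_distrib_left)
  finally show ?thesis by simp
qed

text \<open>Unlike orthonormality, this allows zero vectors and hence \<open>k > d\<close>.\<close>

definition bessel :: "nat \<Rightarrow> nat \<Rightarrow> (nat \<Rightarrow> nat \<Rightarrow> real) \<Rightarrow> bool" where
  "bessel d k p \<longleftrightarrow> (\<forall>x. (\<Sum>i<k. (ip d x (p i))\<^sup>2) \<le> ip d x x)"

lemma besselD: "bessel d k p \<Longrightarrow> (\<Sum>i<k. (ip d x (p i))\<^sup>2) \<le> ip d x x"
  by (simp add: bessel_def)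

text \<open>For the combination \<open>y\<close> of the \<open>p i\<close> with coefficients
  \<open>c i\<close>, the product with \<open>x\<close> is the sum of the squared coefficients, and
  the squared length of \<open>y\<close> is at most that sum; \<open>ip_le_mean\<close> concludes.
  The flag \<open>b\<close> marks the vectors of length 1 among zero vectors.\<close>

lemma bessel_orthogonal:
  assumes "\<And>i j. i < k \<Longrightarrow> j < k \<Longrightarrow> ip d (p i) (p j) = (if i = j \<and> b i then 1 else 0)"
  shows "bessel d k p"
  unfolding bessel_def
proof
  fix x
  define c where "c i = ip d x (p i)" for i
  define y where "y l = (\<Sum>i<k. c i * p i l)" for l
  have y: "ip d y z = (\<Sum>i<k. c i * ip d (p i) z)" for z
    unfolding y_def ip_sum_left by (simp add: ip_scale_left)
  have xy: "ip d x y = (\<Sum>i<k. (c i)\<^sup>2)"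
    by (subst ip_commute) (simp add: y c_def ip_commute[of d x] power2_eq_square)
  have "c i * ip d (p i) y \<le> (c i)\<^sup>2" if i: "i < k" for i
  proof -
    have "ip d (p i) y = (\<Sum>j<k. c j * ip d (p j) (p i))" by (subst ip_commute) (rule y)
    also have "\<dots> = (\<Sum>j<k. if j = i then (if b i then c i else 0) else 0)"
      by (intro sum.cong refl) (use assms i in auto)
    finally show ?thesis using i by (simp add: power2_eq_square)
  qed
  then have "ip d y y \<le> (\<Sum>i<k. (c i)\<^sup>2)" unfolding y by (intro sum_mono) blast
  with ip_le_mean[of d x y] xy have "(\<Sum>i<k. (c i)\<^sup>2) \<le> ip d x x" by simp
  then show "(\<Sum>i<k. (ip d x (p i))\<^sup>2) \<le> ip d x x" by (simp add: c_def)
qed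

text \<open>Taking \<open>x = p i\<close> and keeping one summand gives t^2 \<le> t for the squared
  length t.\<close>

lemma bessel_norm_le_1:
  assumes "bessel d k p" "i < k"
  shows "ip d (p i) (p i) \<le> 1"
proof -
  have "(ip d (p i) (p i))\<^sup>2 \<le> (\<Sum>j<k. (ip d (p i) (p j))\<^sup>2)"
    using assms(2) by (intro member_le_sum[where f = "\<lambda>j. (ip d (p i) (p j))\<^sup>2"]) auto
  also have "\<dots> \<le> ip d (p i) (p i)" by (rule besselD[OF assms(1)])
  finally show ?thesis
    using power_strict_increasing[of 1 2 "ip d (p i) (p i)"] by (cases "1 < ip d (p i) (p i)") auto
qed

text \<open>Stated for an arbitrary sum of dyads, so that it serves singular value decompositions,
  products \<open>A\<^sup>T * B\<close> and the residual of a merge alike.\<close>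

lemma bilinear_svd:
  assumes M: "M \<in> carrier_mat d1 d2"
    and e: "\<And>i l. i < d1 \<Longrightarrow> l < d2 \<Longrightarrow> M $$ (i, l) = (\<Sum>j<n. s j * u j i * v j l)"
  shows "ip d1 p (mv M q) = (\<Sum>j<n. s j * ip d1 p (u j) * ip d2 q (v j))"
proof -
  have "mv M q i = (\<Sum>j<n. s j * ip d2 q (v j) * u j i)" if "i < d1" for i
  proof -
    have "mv M q i = (\<Sum>l<d2. \<Sum>j<n. s j * u j i * v j l * q l)"
      using M that by (simp add: mv_def e sum_distrib_right)
    also have "\<dots> = (\<Sum>j<n. \<Sum>l<d2. s j * u j i * v j l * q l)" by (rule sum.swap)
    also have "\<dots> = (\<Sum>j<n. s j * ip d2 q (v j) * u j i)"
      by (intro sum.cong refl) (simp add: ip_def sum_distrib_left sum_distrib_right mult_ac)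
    finally show ?thesis .
  qed
  then have "ip d1 p (mv M q) = (\<Sum>i<d1. \<Sum>j<n. s j * ip d2 q (v j) * u j i * p i)"
    by (simp add: ip_def sum_distrib_left mult_ac)
  also have "\<dots> = (\<Sum>j<n. \<Sum>i<d1. s j * ip d2 q (v j) * u j i * p i)" by (rule sum.swap)
  also have "\<dots> = (\<Sum>j<n. s j * ip d1 p (u j) * ip d2 q (v j))"
    by (intro sum.cong refl) (simp add: ip_def[of d1] sum_distrib_left sum_distrib_right mult_ac)
  finally show ?thesis .
qed

text \<open>Weights between 0 and 1 of total at most \<open>k\<close> do best on the
  \<open>k\<close> largest values. With \<open>s k\<close> as threshold, each term before
  \<open>k\<close> loses at least \<open>s k\<close> times its missing weight, and each later term
  contributes at most \<open>s k\<close> times its weight.\<close>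

lemma weighted_sum_le_top:
  fixes s b :: "nat \<Rightarrow> real"
  assumes s: "\<And>i j. i \<le> j \<Longrightarrow> s j \<le> s i" "\<And>j. 0 \<le> s j"
    and b: "\<And>j. j < n \<Longrightarrow> 0 \<le> b j" "\<And>j. j < n \<Longrightarrow> b j \<le> 1" "(\<Sum>j<n. b j) \<le> real k"
  shows "(\<Sum>j<n. s j * b j) \<le> (\<Sum>j<k. s j)"
proof (cases "n \<le> k")
  case True
  have "(\<Sum>j<n. s j * b j) \<le> (\<Sum>j<n. s j)"
    by (intro sum_mono) (use s b in \<open>auto intro: mult_left_le\<close>)
  also have "\<dots> \<le> (\<Sum>j<k. s j)" using True s by (intro sum_mono2) auto
  finally show ?thesis .
next
  case False
  have split: "(\<Sum>j<n. f j) = (\<Sum>j<k. f j) + (\<Sum>j=k..<n. f j)" for f :: "nat \<Rightarrow> real"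
    using sum.atLeastLessThan_concat[of 0 k n f] False by (simp add: atLeast0LessThan)
  have "(\<Sum>j<k. s j * b j) \<le> (\<Sum>j<k. s j + s k * (b j - 1))"
  proof (intro sum_mono)
    fix j assume "j \<in> {..<k}"
    with False s b have "(s j - s k) * (b j - 1) \<le> 0" by (intro mult_nonneg_nonpos) auto
    then show "s j * b j \<le> s j + s k * (b j - 1)" by (simp add: algebra_simps)
  qed
  moreover have "(\<Sum>j=k..<n. s j * b j) \<le> (\<Sum>j=k..<n. s k * b j)"
    by (intro sum_mono mult_right_mono) (use s b in auto)
  ultimately have "(\<Sum>j<n. s j * b j) \<le> (\<Sum>j<k. s j) + s k * ((\<Sum>j<n. b j) - k)"
    by (simp add: split sum.distrib sum_distrib_left sum_subtractf algebra_simps)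
  moreover have "s k * ((\<Sum>j<n. b j) - k) \<le> 0"
    using s b by (intro mult_nonneg_nonpos) auto
  ultimately show ?thesis by simp
qed

lemma ky_fan_norm_lessThan: "ky_fan_norm k M = (\<Sum>j<k. sigma (Suc j) M)"
  unfolding ky_fan_norm_def by (simp add: sum.atLeast1_atMost_eq atLeast0LessThan)

text \<open>Expand in singular vectors and replace each product of coefficients by the mean of their
  squares. Bessel's inequality for \<open>p\<close> and \<open>q\<close> bounds each weight
  \<open>b j\<close> by 1, that for \<open>u\<close> and \<open>v\<close> bounds their total by
  \<open>k\<close>, and \<open>weighted_sum_le_top\<close> applies.\<close>

lemma ky_fan_ge:
  assumes M: "M \<in> carrier_mat d1 d2" and p: "bessel d1 k p" and q: "bessel d2 k q"
  shows "(\<Sum>i<k. ip d1 (p i) (mv M (q i))) \<le> ky_fan_norm k M"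
proof -
  obtain u v where svd: "svd_system d1 d2 M u v" using svd_exists[OF M] .
  note v = svd_systemD(1)[OF svd] and u = svd_systemD(3)[OF svd] and e = svd_systemD(4)[OF svd]
  have bu: "bessel d1 d2 u" by (rule bessel_orthogonal) (rule u)
  have bv: "bessel d2 d2 v" by (rule bessel_orthogonal[where b = "\<lambda>_. True"]) (simp add: v)
  define s where "s j = sigma (Suc j) M" for j
  define b where "b j = (\<Sum>i<k. ((ip d1 (p i) (u j))\<^sup>2 + (ip d2 (q i) (v j))\<^sup>2) / 2)" for j
  have s: "\<And>i j. i \<le> j \<Longrightarrow> s j \<le> s i" "\<And>j. 0 \<le> s j"
    unfolding s_def using sigma_antimono[OF M] sigma_nonneg[OF M] by auto
  have b0: "0 \<le> b j" for j unfolding b_def by (intro sum_nonneg) simp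
  have b1: "b j \<le> 1" if j: "j < d2" for j
  proof -
    have "(\<Sum>i<k. (ip d1 (p i) (u j))\<^sup>2) \<le> 1"
      using besselD[OF p, of "u j"] bessel_norm_le_1[OF bu j] by (simp add: ip_commute)
    moreover have "(\<Sum>i<k. (ip d2 (q i) (v j))\<^sup>2) \<le> 1"
      using besselD[OF q, of "v j"] bessel_norm_le_1[OF bv j] by (simp add: ip_commute)
    ultimately show ?thesis unfolding b_def by (simp add: sum.distrib flip: sum_divide_distrib)
  qed
  have bk: "(\<Sum>j<d2. b j) \<le> real k"
  proof -
    have "(\<Sum>j<d2. b j) = (\<Sum>i<k. \<Sum>j<d2. ((ip d1 (p i) (u j))\<^sup>2 + (ip d2 (q i) (v j))\<^sup>2) / 2)"
      unfolding b_def by (rule sum.swap)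
    also have "\<dots> \<le> (\<Sum>i<k. 1)"
    proof (intro sum_mono)
      fix i assume "i \<in> {..<k}"
      then have "(\<Sum>j<d2. (ip d1 (p i) (u j))\<^sup>2) \<le> 1" "(\<Sum>j<d2. (ip d2 (q i) (v j))\<^sup>2) \<le> 1"
        using besselD[OF bu, of "p i"] bessel_norm_le_1[OF p, of i]
          besselD[OF bv, of "q i"] bessel_norm_le_1[OF q, of i] by auto
      then show "(\<Sum>j<d2. ((ip d1 (p i) (u j))\<^sup>2 + (ip d2 (q i) (v j))\<^sup>2) / 2) \<le> 1"
        by (simp add: sum.distrib flip: sum_divide_distrib)
    qed
    finally show ?thesis by simp
  qed
  have "(\<Sum>i<k. ip d1 (p i) (mv M (q i))) =
      (\<Sum>i<k. \<Sum>j<d2. s j * ip d1 (p i) (u j) * ip d2 (q i) (v j))"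
    unfolding s_def by (intro sum.cong refl bilinear_svd[OF M]) (rule e)
  also have "\<dots> = (\<Sum>j<d2. s j * (\<Sum>i<k. ip d1 (p i) (u j) * ip d2 (q i) (v j)))"
    unfolding sum_distrib_left mult.assoc by (rule sum.swap)
  also have "\<dots> \<le> (\<Sum>j<d2. s j * b j)"
    unfolding b_def
  proof (intro sum_mono mult_left_mono s(2))
    fix j i
    have "0 \<le> (ip d1 (p i) (u j) - ip d2 (q i) (v j))\<^sup>2" by simp
    then show "ip d1 (p i) (u j) * ip d2 (q i) (v j)
      \<le> ((ip d1 (p i) (u j))\<^sup>2 + (ip d2 (q i) (v j))\<^sup>2) / 2"
      by (simp add: power2_diff)
  qed
  also have "\<dots> \<le> (\<Sum>j<k. s j)" by (rule weighted_sum_le_top[OF s b0 b1 bk])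
  finally show ?thesis by (simp add: ky_fan_norm_lessThan s_def)
qed

lemma ky_fan_attained:
  assumes M: "M \<in> carrier_mat d1 d2"
  obtains p q where "bessel d1 k p" "bessel d2 k q"
    "ky_fan_norm k M = (\<Sum>i<k. ip d1 (p i) (mv M (q i)))"
proof -
  obtain u v where svd: "svd_system d1 d2 M u v" using svd_exists[OF M] .
  note v = svd_systemD(1)[OF svd] and u = svd_systemD(3)[OF svd] and e = svd_systemD(4)[OF svd]
  \<comment> \<open>Zero vectors fill the family when \<open>k\<close> exceeds \<open>d2\<close>;
    they match the value 0 of \<open>sigma\<close> beyond the end of the list.\<close>
  define p where "p i = (if i < d2 then u i else (\<lambda>_. 0))" for i
  define q where "q i = (if i < d2 then v i else (\<lambda>_. 0))" for i
  have z: "ip d (\<lambda>_. 0) x = 0" "ip d x (\<lambda>_. 0) = 0" for d x by (simp_all add: ip_def)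
  have p: "bessel d1 k p"
    by (rule bessel_orthogonal[where b = "\<lambda>i. i < d2 \<and> sigma (Suc i) M \<noteq> 0"])
      (auto simp: p_def u z)
  have q: "bessel d2 k q"
    by (rule bessel_orthogonal[where b = "\<lambda>i. i < d2"]) (auto simp: q_def v z)
  have "ip d1 (p i) (mv M (q i)) = sigma (Suc i) M" for i
  proof -
    have "ip d1 (p i) (mv M (q i)) =
        (\<Sum>j<d2. sigma (Suc j) M * ip d1 (p i) (u j) * ip d2 (q i) (v j))"
      by (rule bilinear_svd[OF M]) (rule e)
    also have "\<dots> = (\<Sum>j<d2. if j = i then sigma (Suc i) M else 0)"
      by (intro sum.cong refl) (auto simp: p_def q_def u v z)
    also have "\<dots> = sigma (Suc i) M" by (simp add: sigma_Suc[OF M])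
    finally show ?thesis .
  qed
  then have "ky_fan_norm k M = (\<Sum>i<k. ip d1 (p i) (mv M (q i)))"
    by (simp add: ky_fan_norm_lessThan)
  with p q show ?thesis using that by blast
qed

lemma mv_add:
  assumes "M \<in> carrier_mat d1 d2" "N \<in> carrier_mat d1 d2" "i < d1"
  shows "mv (M + N) x i = mv M x i + mv N x i"
  using assms by (simp add: mv_def algebra_simps sum.distrib)

lemma ip_mv_add:
  assumes "M \<in> carrier_mat d1 d2" "N \<in> carrier_mat d1 d2"
  shows "ip d1 p (mv (M + N) x) = ip d1 p (mv M x) + ip d1 p (mv N x)"
  unfolding ip_def by (simp add: mv_add[OF assms] algebra_simps sum.distrib)

lemma ky_fan_triangle:
  assumes M: "M \<in> carrier_mat d1 d2" and N: "N \<in> carrier_mat d1 d2"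
  shows "ky_fan_norm k (M + N) \<le> ky_fan_norm k M + ky_fan_norm k N"
proof -
  have MN: "M + N \<in> carrier_mat d1 d2" using M N by simp
  obtain p q where pq: "bessel d1 k p" "bessel d2 k q"
    and e: "ky_fan_norm k (M + N) = (\<Sum>i<k. ip d1 (p i) (mv (M + N) (q i)))"
    using ky_fan_attained[OF MN] .
  show ?thesis unfolding e
    using ky_fan_ge[OF M pq] ky_fan_ge[OF N pq] by (simp add: ip_mv_add[OF M N] sum.distrib)
qed

lemma spectral_norm_eq_ky_fan: "spectral_norm M = ky_fan_norm 1 M"
  by (simp add: spectral_norm_def ky_fan_norm_def)

lemma spectral_norm_triangle:
  assumes "M \<in> carrier_mat d1 d2" "N \<in> carrier_mat d1 d2"
  shows "spectral_norm (M + N) \<le> spectral_norm M + spectral_norm N"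
  unfolding spectral_norm_eq_ky_fan by (rule ky_fan_triangle[OF assms])

lemma ky_fan_le_spectral:
  assumes M: "M \<in> carrier_mat d1 d2"
  shows "ky_fan_norm k M \<le> real k * spectral_norm M"
proof -
  have "ky_fan_norm k M \<le> (\<Sum>j<k. spectral_norm M)"
    unfolding ky_fan_norm_lessThan spectral_norm_def
    by (intro sum_mono) (use sigma_antimono[OF M, of 0] in auto)
  then show ?thesis by simp
qed

lemma spectral_norm_le:
  assumes M: "M \<in> carrier_mat d1 d2"
    and *: "\<And>p q. ip d1 p p \<le> 1 \<Longrightarrow> ip d2 q q \<le> 1 \<Longrightarrow> ip d1 p (mv M q) \<le> c"
  shows "spectral_norm M \<le> c"
proof -
  obtain p q where pq: "bessel d1 1 p" "bessel d2 1 q"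
    and e: "ky_fan_norm 1 M = (\<Sum>i<1. ip d1 (p i) (mv M (q i)))"
    using ky_fan_attained[OF M] .
  show ?thesis unfolding spectral_norm_eq_ky_fan e
    using *[OF bessel_norm_le_1[OF pq(1)] bessel_norm_le_1[OF pq(2)]] by simp
qed

section \<open>Frobenius norm and products of matrices\<close>

lemma frobenius_norm_sq:
  "(frobenius_norm M)\<^sup>2 = (\<Sum>i<dim_row M. \<Sum>j<dim_col M. (M $$ (i, j))\<^sup>2)"
  by (simp add: frobenius_norm_def sum_nonneg)

lemma frobenius_norm_nonneg: "0 \<le> frobenius_norm M"
  by (simp add: frobenius_norm_def sum_nonneg)

text \<open>Bessel's inequality for each row of \<open>A\<close>, after exchanging the sums.\<close>

lemma bessel_frobenius:
  assumes A: "A \<in> carrier_mat r d" and p: "bessel d k p"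
  shows "(\<Sum>i<k. ip r (mv A (p i)) (mv A (p i))) \<le> (frobenius_norm A)\<^sup>2"
proof -
  have "(\<Sum>i<k. ip r (mv A (p i)) (mv A (p i))) = (\<Sum>l<r. \<Sum>i<k. (ip d (\<lambda>j. A $$ (l, j)) (p i))\<^sup>2)"
    unfolding ip_self using A by (subst sum.swap) (simp add: mv_def ip_def)
  also have "\<dots> \<le> (\<Sum>l<r. \<Sum>j<d. (A $$ (l, j))\<^sup>2)"
    by (intro sum_mono) (use besselD[OF p] in \<open>simp add: ip_self\<close>)
  finally show ?thesis using A by (simp add: frobenius_norm_sq)
qed

text \<open>Cauchy-Schwarz over all pairs of a family index and a row index, followed by
  \<open>bessel_frobenius\<close> for each factor.\<close>

lemma bessel_trace_le:
  assumes A: "A \<in> carrier_mat r d1" and B: "B \<in> carrier_mat r d2"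
    and p: "bessel d1 k p" and q: "bessel d2 k q"
  shows "(\<Sum>i<k. ip r (mv A (p i)) (mv B (q i))) \<le> frobenius_norm A * frobenius_norm B"
proof -
  have "(\<Sum>i<k. ip r (mv A (p i)) (mv B (q i))) =
      (\<Sum>z\<in>{..<k} \<times> {..<r}. mv A (p (fst z)) (snd z) * mv B (q (fst z)) (snd z))"
    by (simp add: ip_def sum.cartesian_product split_beta)
  also have "\<dots> \<le> sqrt (\<Sum>z\<in>{..<k} \<times> {..<r}. (mv A (p (fst z)) (snd z))\<^sup>2) *
      sqrt (\<Sum>z\<in>{..<k} \<times> {..<r}. (mv B (q (fst z)) (snd z))\<^sup>2)"
    using L2_set_mult_ineq[of "\<lambda>z. mv A (p (fst z)) (snd z)" "\<lambda>z. mv B (q (fst z)) (snd z)" "{..<k} \<times> {..<r}"]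
    unfolding L2_set_def
    by (rule order_trans[rotated]) (intro sum_mono, simp flip: abs_mult)
  also have "(\<Sum>z\<in>{..<k} \<times> {..<r}. (mv A (p (fst z)) (snd z))\<^sup>2) = (\<Sum>i<k. ip r (mv A (p i)) (mv A (p i)))"
    by (simp add: ip_self sum.cartesian_product split_beta)
  also have "(\<Sum>z\<in>{..<k} \<times> {..<r}. (mv B (q (fst z)) (snd z))\<^sup>2) = (\<Sum>i<k. ip r (mv B (q i)) (mv B (q i)))"
    by (simp add: ip_self sum.cartesian_product split_beta)
  also have "sqrt (\<Sum>i<k. ip r (mv A (p i)) (mv A (p i))) * sqrt (\<Sum>i<k. ip r (mv B (q i)) (mv B (q i)))
      \<le> frobenius_norm A * frobenius_norm B"
    using bessel_frobenius[OF A p] bessel_frobenius[OF B q]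
    by (intro mult_mono real_le_lsqrt) (auto simp: frobenius_norm_nonneg sum_nonneg ip_nonneg)
  finally show ?thesis .
qed

lemma ip_mv_transpose_mult:
  assumes A: "A \<in> carrier_mat r d1" and B: "B \<in> carrier_mat r d2"
  shows "ip d1 p (mv (A\<^sup>T * B) q) = ip r (mv A p) (mv B q)"
proof -
  have e: "(A\<^sup>T * B) $$ (i, l) = (\<Sum>j<r. 1 * A $$ (j, i) * B $$ (j, l))" if "i < d1" "l < d2" for i l
    using A B that by (subst index_mult_mat_sum[of _ d1 r _ d2]) auto
  have "ip d1 p (mv (A\<^sup>T * B) q) =
      (\<Sum>j<r. 1 * ip d1 p (\<lambda>i. A $$ (j, i)) * ip d2 q (\<lambda>l. B $$ (j, l)))"
    by (rule bilinear_svd[OF _ e]) (use A B in auto)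
  then show ?thesis using A B by (simp add: ip_def mv_def mult.commute)
qed

lemma ky_fan_le_frobenius:
  assumes A: "A \<in> carrier_mat r d1" and B: "B \<in> carrier_mat r d2"
  shows "ky_fan_norm k (A\<^sup>T * B) \<le> frobenius_norm A * frobenius_norm B"
proof -
  have AB: "A\<^sup>T * B \<in> carrier_mat d1 d2" using A B by simp
  obtain p q where pq: "bessel d1 k p" "bessel d2 k q"
    and e: "ky_fan_norm k (A\<^sup>T * B) = (\<Sum>i<k. ip d1 (p i) (mv (A\<^sup>T * B) (q i)))"
    using ky_fan_attained[OF AB] .
  show ?thesis unfolding e ip_mv_transpose_mult[OF A B]
    by (rule bessel_trace_le[OF A B pq])
qed

section \<open>Subspace power method\<close>

text \<open>The middle families have a diagonal Gram matrix with entries \<open>g j\<close> that may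
  be 0, because left singular vectors for the value 0 vanish.\<close>

lemma product_of_dyads:
  fixes n :: nat
  assumes A: "A \<in> carrier_mat d1 d" and B: "B \<in> carrier_mat d d2"
    and a: "\<And>i l. i < d1 \<Longrightarrow> l < d \<Longrightarrow> A $$ (i, l) = (\<Sum>j<n. a j * x j i * y j l)"
    and b: "\<And>l r. l < d \<Longrightarrow> r < d2 \<Longrightarrow> B $$ (l, r) = (\<Sum>j<n. b j * z j l * w j r)"
    and yz: "\<And>j k. j < n \<Longrightarrow> k < n \<Longrightarrow> ip d (y j) (z k) = (if j = k then g j else 0)"
    and i: "i < d1" and r: "r < d2"
  shows "(A * B) $$ (i, r) = (\<Sum>j<n. a j * b j * g j * x j i * w j r)"
proof -
  have "(A * B) $$ (i, r) = (\<Sum>l<d. (\<Sum>j<n. a j * x j i * y j l) * (\<Sum>k<n. b k * z k l * w k r))"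
    using i r by (subst index_mult_mat_sum[OF A B]) (auto simp: a b)
  also have "\<dots> = (\<Sum>l<d. \<Sum>j<n. \<Sum>k<n. (a j * x j i * b k * w k r) * (y j l * z k l))"
    unfolding sum_product by (intro sum.cong refl) (simp add: mult_ac)
  also have "\<dots> = (\<Sum>j<n. \<Sum>l<d. \<Sum>k<n. (a j * x j i * b k * w k r) * (y j l * z k l))"
    by (rule sum.swap)
  also have "\<dots> = (\<Sum>j<n. \<Sum>k<n. (a j * x j i * b k * w k r) * ip d (y j) (z k))"
    by (rule sum.cong[OF refl], subst sum.swap) (simp add: ip_def sum_distrib_left)
  also have "\<dots> = (\<Sum>j<n. \<Sum>k<n. if k = j then a j * b j * g j * x j i * w j r else 0)"
    by (intro sum.cong refl) (auto simp: yz)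
  also have "\<dots> = (\<Sum>j<n. a j * b j * g j * x j i * w j r)"
    by (intro sum.cong refl, subst sum.delta) auto
  finally show ?thesis .
qed

text \<open>Each factor \<open>M * M\<^sup>T\<close> multiplies the coefficient of the
  \<open>j\<close>-th dyad by the square of its singular value. \<open>N\<close> is general in the
  induction since one factor at a time is absorbed into it.\<close>

lemma power_method_dyads:
  assumes M: "M \<in> carrier_mat d1 d2" and svd: "svd_system d1 d2 M u v"
    and N: "N \<in> carrier_mat d1 d2"
    and c: "\<And>i l. i < d1 \<Longrightarrow> l < d2 \<Longrightarrow> N $$ (i, l) = (\<Sum>j<d2. c j * u j i * v j l)"
    and il: "i < d1" "l < d2"
  shows "((M * M\<^sup>T) ^\<^sub>m q * N) $$ (i, l) =
    (\<Sum>j<d2. (sigma (Suc j) M) ^ (2 * q) * c j * u j i * v j l)"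
  using N c
proof (induct q arbitrary: N c)
  case 0
  then show ?case using M il by simp
next
  case (Suc q)
  note N = Suc(2) and c = Suc(3)
  let ?s = "\<lambda>j. sigma (Suc j) M"
  let ?N = "M * (M\<^sup>T * N)"
  have MT: "M\<^sup>T \<in> carrier_mat d2 d1" using M by simp
  have MTN: "M\<^sup>T * N \<in> carrier_mat d2 d2" using M N by simp
  have mt: "M\<^sup>T $$ (k, r) = (\<Sum>j<d2. ?s j * v j k * u j r)" if "k < d2" "r < d1" for k r
    using svd_systemD(4)[OF svd that(2,1)] M that by (simp add: mult_ac)
  \<comment> \<open>The test for 0 is the squared length of \<open>u j\<close>; it disappears in
    fact \<open>2\<close> because the factor \<open>?s j\<close> vanishes in the same case.\<close>
  have 1: "(M\<^sup>T * N) $$ (k, r) =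
      (\<Sum>j<d2. ?s j * c j * (if ?s j = 0 then 0 else 1) * v j k * v j r)" if "k < d2" "r < d2" for k r
    by (rule product_of_dyads[OF MT N mt c _ that]) (auto simp: svd_systemD(3)[OF svd])
  have "?N $$ (k, r) = (\<Sum>j<d2. ?s j * (?s j * c j * (if ?s j = 0 then 0 else 1)) * 1 * u j k * v j r)"
    if "k < d1" "r < d2" for k r
    by (rule product_of_dyads[OF M MTN svd_systemD(4)[OF svd] 1 _ that])
      (simp_all add: svd_systemD(1)[OF svd])
  then have 2: "?N $$ (k, r) = (\<Sum>j<d2. ((?s j)\<^sup>2 * c j) * u j k * v j r)"
    if "k < d1" "r < d2" for k r
    using that by (auto intro!: sum.cong simp: power2_eq_square)
  have "(M * M\<^sup>T) ^\<^sub>m Suc q * N = (M * M\<^sup>T) ^\<^sub>m q * ?N"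
    using M N MT MTN by (simp add: assoc_mult_mat[of _ d1 d1 _ d1 _ d2] assoc_mult_mat[of _ d1 d2 _ d1 _ d2])
  then have "((M * M\<^sup>T) ^\<^sub>m Suc q * N) $$ (i, l) =
      (\<Sum>j<d2. (?s j) ^ (2 * q) * ((?s j)\<^sup>2 * c j) * u j i * v j l)"
    using Suc(1)[of ?N "\<lambda>j. (?s j)\<^sup>2 * c j", OF _ 2] M N by simp
  then show ?case by (simp add: power2_eq_square mult_ac)
qed

text \<open>Jensen's inequality for \<open>x ^ n\<close>. Weights of total below 1 are completed by
  a weight on the value 0, whose power is 0 as \<open>0 < n\<close>.\<close>

lemma power_mean_le:
  fixes w t :: "nat \<Rightarrow> real"
  assumes w: "\<And>j. j < k \<Longrightarrow> 0 \<le> w j" "(\<Sum>j<k. w j) \<le> 1" and t: "\<And>j. j < k \<Longrightarrow> 0 \<le> t j"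
    and n: "0 < n"
  shows "(\<Sum>j<k. w j * t j) ^ n \<le> (\<Sum>j<k. w j * t j ^ n)"
proof -
  define W where "W j = (if j < k then w j else 1 - (\<Sum>j<k. w j))" for j
  define T where "T j = (if j < k then t j else 0)" for j
  have cvx: "convex_on {0::real..} (\<lambda>x. x ^ n)"
    using convex_power_even[of n] convex_power_odd[of n]
    by (cases "even n") (auto intro: convex_on_subset)
  have "(\<Sum>j\<in>{..<Suc k}. W j) = 1" by (simp add: W_def)
  then have "(\<Sum>j\<in>{..<Suc k}. W j *\<^sub>R T j) ^ n \<le> (\<Sum>j\<in>{..<Suc k}. W j * T j ^ n)"
    by (intro convex_on_sum[OF _ _ cvx]) (use w t in \<open>auto simp: W_def T_def\<close>)
  then show ?thesis using n by (simp add: W_def T_def zero_power)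
qed

lemma orthonormal_cols_ip:
  assumes "orthonormal_cols Z" "Z \<in> carrier_mat d r" "a < r" "b < r"
  shows "ip d (\<lambda>i. Z $$ (i, a)) (\<lambda>i. Z $$ (i, b)) = (if a = b then 1 else 0)"
proof -
  have "(Z\<^sup>T * Z) $$ (a, b) = (\<Sum>k<d. Z $$ (k, a) * Z $$ (k, b))"
    using assms by (subst index_mult_mat_sum[of _ r d _ r]) auto
  moreover have "(Z\<^sup>T * Z) $$ (a, b) = (if a = b then 1 else 0)"
    using assms by (simp add: orthonormal_cols_def)
  ultimately show ?thesis by (simp add: ip_def)
qed

text \<open>Padding by zeros to square matrices of size \<open>r\<close> keeps the product, so the
  product in the other order would be the identity too, although row \<open>m\<close> of
  \<open>B'\<close> is zero.\<close>

lemma left_inverse_imp_le: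
  fixes A B :: "real mat"
  assumes A: "A \<in> carrier_mat r m" and B: "B \<in> carrier_mat m r" and AB: "A * B = 1\<^sub>m r"
  shows "r \<le> m"
proof (rule ccontr)
  assume "\<not> r \<le> m"
  then have mr: "m < r" by simp
  define A' where "A' = Matrix.mat r r (\<lambda>(i, j). if j < m then A $$ (i, j) else 0)"
  define B' where "B' = Matrix.mat r r (\<lambda>(i, j). if i < m then B $$ (i, j) else 0)"
  have A': "A' \<in> carrier_mat r r" and B': "B' \<in> carrier_mat r r" unfolding A'_def B'_def by auto
  have "A' * B' = A * B"
  proof (rule eq_matI)
    fix i j assume "i < dim_row (A * B)" "j < dim_col (A * B)"
    then have ij: "i < r" "j < r" using A B by auto
    have "(A' * B') $$ (i, j) = (\<Sum>k<r. A' $$ (i, k) * B' $$ (k, j))"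
      by (rule index_mult_mat_sum[OF A' B' ij])
    also have "\<dots> = (\<Sum>k<m. A' $$ (i, k) * B' $$ (k, j))"
      using mr ij by (intro sum.mono_neutral_right) (auto simp: A'_def)
    also have "\<dots> = (\<Sum>k<m. A $$ (i, k) * B $$ (k, j))"
      using mr ij by (intro sum.cong refl) (auto simp: A'_def B'_def)
    also have "\<dots> = (A * B) $$ (i, j)" by (rule index_mult_mat_sum[OF A B ij, symmetric])
    finally show "(A' * B') $$ (i, j) = (A * B) $$ (i, j)" .
  qed (use A B A' B' in auto)
  then have "B' * A' = 1\<^sub>m r" using mat_mult_left_right_inverse[OF A' B'] AB by simp
  then have "(B' * A') $$ (m, m) = 1" using mr by simp
  moreover have "(B' * A') $$ (m, m) = 0"
    using mr by (subst index_mult_mat_sum[OF B' A']) (auto simp: B'_def)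
  ultimately show False by simp
qed

lemma vec_space_col_space:
  fixes A :: "real mat"
  assumes "A \<in> carrier_mat d r"
  shows "vec_space.col_space d A = {y \<in> carrier_vec d. \<exists>x\<in>carrier_vec r. A *\<^sub>v x = y}"
proof -
  interpret vec_space "TYPE(real)" d .
  show ?thesis using col_space_eq[of A] assms by auto
qed

lemma col_space_factor:
  fixes A B :: "real mat"
  assumes A: "A \<in> carrier_mat d r" and B: "B \<in> carrier_mat d s"
    and sub: "vec_space.col_space d A \<subseteq> vec_space.col_space d B"
  obtains W where "W \<in> carrier_mat s r" "A = B * W"
proof -
  have "\<exists>w. w \<in> carrier_vec s \<and> B *\<^sub>v w = col A j" if j: "j < r" for j
  proof -
    have "col A j = A *\<^sub>v unit_vec r j"
      using A j by (intro eq_vecI) (auto simp: scalar_prod_right_unit)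
    then have "col A j \<in> vec_space.col_space d A"
      using A j unfolding vec_space_col_space[OF A] by (auto intro!: bexI[of _ "unit_vec r j"])
    then show ?thesis using sub unfolding vec_space_col_space[OF B] by auto
  qed
  then obtain w where w: "\<And>j. j < r \<Longrightarrow> w j \<in> carrier_vec s" "\<And>j. j < r \<Longrightarrow> B *\<^sub>v w j = col A j"
    by metis
  define W where "W = Matrix.mat s r (\<lambda>(i, j). w j $ i)"
  have W: "W \<in> carrier_mat s r" unfolding W_def by simp
  have colW: "col W j = w j" if "j < r" for j
    using w(1)[OF that] that by (intro eq_vecI) (auto simp: W_def)
  have "A = B * W"
  proof (rule mat_col_eqI)
    fix j assume "j < dim_col (B * W)"
    then have "j < r" using W by simp
    then show "col A j = col (B * W) j"
      by (simp only: col_mult2[OF B W] colW w(2))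
  qed (use A B W in auto)
  with W show ?thesis using that by blast
qed

text \<open>Writing \<open>Z = K * W\<close> exhibits the identity of size \<open>r\<close> as a
  product through dimension \<open>m\<close>. Hence \<open>m - dim_col Z\<close>, the number of
  padding rows in \<open>scod_compress\<close>, is a true difference.\<close>

lemma spm_dim_col_le:
  assumes spm: "spm M q G Z" and M: "M \<in> carrier_mat d1 d2" and G: "G \<in> carrier_mat d2 m"
  shows "dim_col Z \<le> m"
proof -
  define K where "K = (M * M\<^sup>T) ^\<^sub>m q * M * G"
  have MM: "(M * M\<^sup>T) ^\<^sub>m q \<in> carrier_mat d1 d1" using M by (intro pow_carrier_mat) simp
  have K: "K \<in> carrier_mat d1 m" unfolding K_def using M G MM by auto
  obtain r where r: "dim_col Z = r" by blast
  have Z: "Z \<in> carrier_mat d1 r" and o: "Z\<^sup>T * Z = 1\<^sub>m r"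
    and sp: "vec_space.col_space d1 Z \<subseteq> vec_space.col_space d1 K"
    using spm M r unfolding spm_def orthonormal_cols_def Let_def K_def by auto
  obtain W where W: "W \<in> carrier_mat m r" and e: "Z = K * W"
    using col_space_factor[OF Z K sp] .
  have ZT: "Z\<^sup>T \<in> carrier_mat r d1" using Z by simp
  have "(Z\<^sup>T * K) * W = Z\<^sup>T * (K * W)" by (rule assoc_mult_mat[OF ZT K W])
  then have "(Z\<^sup>T * K) * W = 1\<^sub>m r" by (simp only: e[symmetric] o)
  with left_inverse_imp_le[OF mult_carrier_mat[OF ZT K] W] show ?thesis unfolding r .
qed

text \<open>Entry \<open>(j, c)\<close> of the draw written in the basis \<open>v\<close>. For right
  singular vectors the rows \<open>j < m\<close> form \<open>\<Omega>\<^sub>1\<close>, the later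
  ones with nonzero singular value \<open>\<Omega>\<^sub>2\<close>.\<close>

definition sketch_coord ::
  "nat \<Rightarrow> (nat \<Rightarrow> nat \<Rightarrow> real) \<Rightarrow> (nat \<times> nat \<Rightarrow> real) \<Rightarrow> nat \<Rightarrow> nat \<Rightarrow> real" where
  "sketch_coord d v g j c = (\<Sum>l<d. v j l * g (l, c))"

text \<open>The residual is governed by vectors \<open>x\<close> of length at most 1 orthogonal to
  the columns of \<open>Z\<close>. For such \<open>x\<close> the coordinates \<open>a\<close> of
  \<open>T\<^sup>T\<close> applied to \<open>x\<close> annihilate the sketch, so \<open>cond\<close>
  bounds their head by their tail. The tail is controlled by powers of
  \<open>sigma (Suc m) M\<close>, and the power mean inequality takes the root of order
  \<open>2 * q + 1\<close>.\<close>

lemma power_method_error: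
  fixes \<epsilon> F :: real
  assumes M: "M \<in> carrier_mat d1 d2" and svd: "svd_system d1 d2 M u v" and m: "m \<le> d2"
    and spm: "spm M q (Matrix.mat d2 m g) Z"
    and cond: "\<And>a. (\<And>c. c < m \<Longrightarrow> (\<Sum>j<d2. a j * sketch_coord d2 v g j c) = 0) \<Longrightarrow>
      (\<And>j. sigma (Suc j) M = 0 \<Longrightarrow> a j = 0) \<Longrightarrow>
      (\<Sum>j<m. (a j)\<^sup>2) \<le> F * (\<Sum>j=m..<d2. (a j)\<^sup>2)"
    and F: "0 \<le> F" "1 + F \<le> (1 + \<epsilon>) ^ (2 * (2 * q + 1))" and \<epsilon>: "0 \<le> \<epsilon>"
  shows "spectral_norm (M - Z * Z\<^sup>T * M) \<le> (1 + \<epsilon>) * sigma (Suc m) M"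
proof -
  let ?n = "2 * q + 1"
  define G where "G = Matrix.mat d2 m g"
  define T where "T = (M * M\<^sup>T) ^\<^sub>m q * M"
  define K where "K = T * G"
  define s where "s j = sigma (Suc j) M" for j
  define r where "r = dim_col Z"
  define z where "z b i = Z $$ (i, b)" for b i
  have G: "G \<in> carrier_mat d2 m" unfolding G_def by simp
  have MM: "(M * M\<^sup>T) ^\<^sub>m q \<in> carrier_mat d1 d1" using M by (intro pow_carrier_mat) simp
  have T: "T \<in> carrier_mat d1 d2" unfolding T_def using M MM by auto
  have K: "K \<in> carrier_mat d1 m" unfolding K_def using T G by auto
  have Z: "Z \<in> carrier_mat d1 r" and o: "orthonormal_cols Z"
    and sp: "vec_space.col_space d1 K \<subseteq> vec_space.col_space d1 Z"
    using spm M unfolding spm_def Let_def K_def T_def r_def G_def by auto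
  obtain W where W: "W \<in> carrier_mat r m" and KZ: "K = Z * W"
    using col_space_factor[OF K Z sp] .
  have zz: "ip d1 (z a) (z b) = (if a = b then 1 else 0)" if "a < r" "b < r" for a b
    unfolding z_def by (rule orthonormal_cols_ip[OF o Z that])
  have bu: "bessel d1 d2 u" by (rule bessel_orthogonal) (rule svd_systemD(3)[OF svd])
  have bv: "bessel d2 d2 v"
    by (rule bessel_orthogonal[where b = "\<lambda>_. True"]) (simp add: svd_systemD(1)[OF svd])
  have s0: "0 \<le> s j" for j unfolding s_def by (rule sigma_nonneg[OF M])
  have sm: "s j \<le> s m" if "m \<le> j" for j unfolding s_def by (rule sigma_antimono[OF M that])
  have T_entry: "T $$ (i, l) = (\<Sum>j<d2. s j ^ ?n * u j i * v j l)" if "i < d1" "l < d2" for i l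
    using power_method_dyads[OF M svd M svd_systemD(4)[OF svd] that, of q]
    unfolding T_def s_def by (simp add: mult_ac)
  have K_entry: "K $$ (i, c) = (\<Sum>j<d2. s j ^ ?n * u j i * sketch_coord d2 v g j c)"
    if "i < d1" "c < m" for i c
  proof -
    have "K $$ (i, c) = (\<Sum>l<d2. \<Sum>j<d2. s j ^ ?n * u j i * (v j l * g (l, c)))"
      unfolding K_def using that
      by (subst index_mult_mat_sum[OF T G])
        (auto simp: T_entry G_def sum_distrib_left sum_distrib_right mult_ac)
    also have "\<dots> = (\<Sum>j<d2. \<Sum>l<d2. s j ^ ?n * u j i * (v j l * g (l, c)))" by (rule sum.swap)
    finally show ?thesis by (simp add: sketch_coord_def sum_distrib_left)
  qed
  \<comment> \<open>The left side is the squared length of \<open>M\<^sup>T\<close> applied to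
    \<open>x\<close>.\<close>
  have perp: "(\<Sum>j<d2. (s j * ip d1 x (u j))\<^sup>2) \<le> ((1 + \<epsilon>) * s m)\<^sup>2"
    if x: "ip d1 x x \<le> 1" "\<And>b. b < r \<Longrightarrow> ip d1 x (z b) = 0" for x
  proof -
    define a where "a j = s j ^ ?n * ip d1 x (u j)" for j
    have "(\<Sum>j<d2. a j * sketch_coord d2 v g j c) = 0" if c: "c < m" for c
    proof -
      have "(\<Sum>j<d2. a j * sketch_coord d2 v g j c) =
          (\<Sum>j<d2. \<Sum>i<d1. x i * (s j ^ ?n * u j i * sketch_coord d2 v g j c))"
        by (intro sum.cong refl) (simp add: a_def ip_def sum_distrib_left sum_distrib_right mult_ac)
      also have "\<dots> = (\<Sum>i<d1. \<Sum>j<d2. x i * (s j ^ ?n * u j i * sketch_coord d2 v g j c))"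
        by (rule sum.swap)
      also have "\<dots> = (\<Sum>i<d1. x i * K $$ (i, c))"
        using c by (simp add: K_entry sum_distrib_left)
      also have "\<dots> = (\<Sum>i<d1. \<Sum>b<r. W $$ (b, c) * (x i * z b i))"
        unfolding KZ using c
        by (intro sum.cong refl, subst index_mult_mat_sum[OF Z W])
          (auto simp: sum_distrib_left z_def mult_ac)
      also have "\<dots> = (\<Sum>b<r. \<Sum>i<d1. W $$ (b, c) * (x i * z b i))" by (rule sum.swap)
      also have "\<dots> = (\<Sum>b<r. W $$ (b, c) * ip d1 x (z b))"
        by (simp add: ip_def sum_distrib_left)
      finally show ?thesis using x(2) by simp
    qed
    moreover have "a j = 0" if "sigma (Suc j) M = 0" for j using that by (simp add: a_def s_def)
    ultimately have head: "(\<Sum>j<m. (a j)\<^sup>2) \<le> F * (\<Sum>j=m..<d2. (a j)\<^sup>2)" by (rule cond)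
    have w1: "(\<Sum>j<d2. (ip d1 x (u j))\<^sup>2) \<le> 1" using besselD[OF bu, of x] x(1) by linarith
    have "(\<Sum>j=m..<d2. (a j)\<^sup>2) \<le> (\<Sum>j=m..<d2. ((s m)\<^sup>2) ^ ?n * (ip d1 x (u j))\<^sup>2)"
      unfolding a_def power_mult_distrib
    proof (intro sum_mono mult_right_mono)
      fix j assume "j \<in> {m..<d2}"
      then have "(s j)\<^sup>2 \<le> (s m)\<^sup>2" by (intro power_mono sm s0) auto
      then have "((s j)\<^sup>2) ^ ?n \<le> ((s m)\<^sup>2) ^ ?n" by (rule power_mono) simp
      then show "(s j ^ ?n)\<^sup>2 \<le> ((s m)\<^sup>2) ^ ?n" by (metis power_mult mult.commute)
    qed simp
    also have "\<dots> = ((s m)\<^sup>2) ^ ?n * (\<Sum>j=m..<d2. (ip d1 x (u j))\<^sup>2)" by (simp add: sum_distrib_left)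
    also have "\<dots> \<le> ((s m)\<^sup>2) ^ ?n * 1"
    proof (intro mult_left_mono)
      have "(\<Sum>j=m..<d2. (ip d1 x (u j))\<^sup>2) \<le> (\<Sum>j<d2. (ip d1 x (u j))\<^sup>2)"
        by (intro sum_mono2) auto
      with w1 show "(\<Sum>j=m..<d2. (ip d1 x (u j))\<^sup>2) \<le> 1" by linarith
    qed simp
    finally have tail: "(\<Sum>j=m..<d2. (a j)\<^sup>2) \<le> ((s m)\<^sup>2) ^ ?n" by simp
    \<comment> \<open>The weights are the squared coordinates of \<open>x\<close> along
      \<open>u\<close>, of total at most 1.\<close>
    have "(\<Sum>j<d2. (ip d1 x (u j))\<^sup>2 * (s j)\<^sup>2) ^ ?n \<le> (\<Sum>j<d2. (ip d1 x (u j))\<^sup>2 * ((s j)\<^sup>2) ^ ?n)"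
      by (rule power_mean_le) (use w1 in auto)
    also have "\<dots> = (\<Sum>j<d2. (a j)\<^sup>2)"
      by (intro sum.cong refl) (simp add: a_def power_mult_distrib mult.commute flip: power_mult)
    also have "\<dots> = (\<Sum>j<m. (a j)\<^sup>2) + (\<Sum>j=m..<d2. (a j)\<^sup>2)"
      using sum.atLeastLessThan_concat[of 0 m d2 "\<lambda>j. (a j)\<^sup>2"] m by (simp add: atLeast0LessThan)
    also have "\<dots> \<le> (1 + F) * (\<Sum>j=m..<d2. (a j)\<^sup>2)" using head by (simp add: algebra_simps)
    also have "\<dots> \<le> (1 + \<epsilon>) ^ (2 * ?n) * ((s m)\<^sup>2) ^ ?n"
      using F tail \<epsilon> by (intro mult_mono) (auto intro: sum_nonneg)
    also have "\<dots> = (((1 + \<epsilon>) * s m)\<^sup>2) ^ ?n"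
      by (simp only: power_mult power_mult_distrib)
    finally have "(\<Sum>j<d2. (ip d1 x (u j))\<^sup>2 * (s j)\<^sup>2) \<le> ((1 + \<epsilon>) * s m)\<^sup>2"
      by (rule power_le_imp_le_base[where n = "2 * q", unfolded Suc_eq_plus1]) simp
    then show ?thesis by (simp add: power_mult_distrib mult.commute)
  qed
  define R where "R = M - Z * Z\<^sup>T * M"
  have R: "R \<in> carrier_mat d1 d2" unfolding R_def by (rule minus_carrier_mat) (use M Z in auto)
  show ?thesis
    unfolding R_def[symmetric]
  proof (rule spectral_norm_le[OF R])
    fix p y assume p: "ip d1 p p \<le> 1" and y: "ip d2 y y \<le> 1"
    define f where "f = mv M y"
    \<comment> \<open>\<open>x\<close> is \<open>p\<close> minus its projection onto the columns of
      \<open>Z\<close>. That projection is symmetric, so pairing the residual with \<open>p\<close>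
      and \<open>y\<close> amounts to pairing \<open>M\<close> with \<open>x\<close> and
      \<open>y\<close>.\<close>
    define x where "x i = p i - (\<Sum>b<r. ip d1 p (z b) * z b i)" for i
    have ipx: "ip d1 x h = ip d1 p h - (\<Sum>b<r. ip d1 p (z b) * ip d1 (z b) h)" for h
      unfolding x_def ip_diff_left ip_sum_left by (simp add: ip_scale_left)
    have xz: "ip d1 x (z b) = 0" if "b < r" for b
    proof -
      have "(\<Sum>a<r. ip d1 p (z a) * ip d1 (z a) (z b)) = (\<Sum>a<r. if a = b then ip d1 p (z b) else 0)"
        using that by (intro sum.cong refl) (auto simp: zz)
      then show ?thesis using that by (simp add: ipx)
    qed
    have "ip d1 x x = ip d1 x p"
      by (subst ipx, subst (3) ip_commute) (simp add: xz ip_commute[of d1 _ x])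
    with ip_le_mean[of d1 x p] p have x1: "ip d1 x x \<le> 1" by simp
    have D: "R $$ (i, l) = M $$ (i, l) - (\<Sum>b<r. z b i * (\<Sum>k<d1. z b k * M $$ (k, l)))"
      if "i < d1" "l < d2" for i l
    proof -
      have "Z * Z\<^sup>T * M = Z * (Z\<^sup>T * M)" using Z M by (simp add: assoc_mult_mat[of _ d1 r _ d1 _ d2])
      then have "(Z * Z\<^sup>T * M) $$ (i, l) = (\<Sum>b<r. z b i * (\<Sum>k<d1. z b k * M $$ (k, l)))"
        using Z M that by (simp only:, subst index_mult_mat_sum[of _ d1 r _ d2])
          (auto simp: z_def index_mult_mat_sum[of _ r d1 _ d2] simp del: index_mult_mat)
      then show ?thesis using M Z that unfolding R_def by (subst index_minus_mat) auto
    qed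
    have "mv R y i = f i - (\<Sum>b<r. ip d1 (z b) f * z b i)" if i: "i < d1" for i
    proof -
      have "mv R y i =
          (\<Sum>l<d2. M $$ (i, l) * y l) - (\<Sum>l<d2. (\<Sum>b<r. z b i * (\<Sum>k<d1. z b k * M $$ (k, l))) * y l)"
        using R i by (simp add: mv_def D left_diff_distrib sum_subtractf)
      also have "(\<Sum>l<d2. (\<Sum>b<r. z b i * (\<Sum>k<d1. z b k * M $$ (k, l))) * y l) =
          (\<Sum>l<d2. \<Sum>b<r. \<Sum>k<d1. z b i * z b k * (M $$ (k, l) * y l))"
        by (simp add: sum_distrib_left sum_distrib_right mult_ac)
      also have "\<dots> = (\<Sum>b<r. \<Sum>l<d2. \<Sum>k<d1. z b i * z b k * (M $$ (k, l) * y l))" by (rule sum.swap)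
      also have "\<dots> = (\<Sum>b<r. \<Sum>k<d1. \<Sum>l<d2. z b i * z b k * (M $$ (k, l) * y l))"
        by (rule sum.cong[OF refl], rule sum.swap)
      also have "\<dots> = (\<Sum>b<r. ip d1 (z b) f * z b i)"
        using M by (simp add: ip_def f_def mv_def sum_distrib_left sum_distrib_right mult_ac)
      finally show ?thesis using M by (simp add: f_def mv_def)
    qed
    then have "ip d1 p (mv R y) = ip d1 p (\<lambda>i. f i - (\<Sum>b<r. ip d1 (z b) f * z b i))"
      by (simp add: ip_def)
    also have "\<dots> = ip d1 f p - (\<Sum>b<r. ip d1 (z b) f * ip d1 (z b) p)"
      by (subst ip_commute) (simp add: ip_diff_left ip_sum_left ip_scale_left)
    also have "\<dots> = ip d1 x f" by (simp add: ipx ip_commute[of d1 _ p] ip_commute[of d1 f p] mult.commute)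
    also have "\<dots> = (\<Sum>j<d2. (s j * ip d1 x (u j)) * ip d2 y (v j))"
      unfolding f_def s_def by (rule bilinear_svd[OF M svd_systemD(4)[OF svd]])
    also have "\<dots> \<le> sqrt (\<Sum>j<d2. (s j * ip d1 x (u j))\<^sup>2) * sqrt (\<Sum>j<d2. (ip d2 y (v j))\<^sup>2)"
      using L2_set_mult_ineq[of "\<lambda>j. s j * ip d1 x (u j)" "\<lambda>j. ip d2 y (v j)" "{..<d2}"]
      unfolding L2_set_def
      by (rule order_trans[rotated]) (intro sum_mono, simp flip: abs_mult)
    also have "\<dots> \<le> ((1 + \<epsilon>) * s m) * 1"
    proof (intro mult_mono)
      show "sqrt (\<Sum>j<d2. (s j * ip d1 x (u j))\<^sup>2) \<le> (1 + \<epsilon>) * s m"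
        using perp[OF x1 xz] \<epsilon> s0[of m] by (intro real_le_lsqrt) (auto simp: sum_nonneg)
      show "sqrt (\<Sum>j<d2. (ip d2 y (v j))\<^sup>2) \<le> 1"
        using besselD[OF bv, of y] y by simp
    qed (use \<epsilon> s0[of m] in \<open>auto simp: sum_nonneg\<close>)
    finally show "ip d1 p (mv R y) \<le> (1 + \<epsilon>) * sigma (Suc m) M"
      by (simp add: s_def)
  qed
qed

section \<open>Conditioning of Gaussian sketches\<close>

abbreviation std_normal :: "real measure" where
  "std_normal \<equiv> density lborel (\<lambda>x. ennreal (std_normal_density x))"

lemma prob_space_std_normal: "prob_space std_normal"
  by (rule prob_space_normal_density) simp

interpretation gauss_prod: product_sigma_finite "\<lambda>_ :: 'i. std_normal"
  by (rule product_sigma_finite.intro) (rule prob_space_imp_sigma_finite[OF prob_space_std_normal])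

text \<open>Coordinates of a product measure are independent, so the scaled coordinates sum to a
  normal variable whose variances add. Indices with \<open>w i = 0\<close> are dropped first, since
  scaling by 0 leaves no density.\<close>

lemma gaussian_combination_distributed:
  fixes w :: "'i \<Rightarrow> real"
  assumes fin: "finite I" and pos: "0 < (\<Sum>i\<in>I. (w i)\<^sup>2)"
  shows "distributed (Pi\<^sub>M I (\<lambda>_. std_normal)) lborel (\<lambda>y. \<Sum>i\<in>I. w i * y i)
    (\<lambda>x. ennreal (normal_density 0 (sqrt (\<Sum>i\<in>I. (w i)\<^sup>2)) x))"
proof -
  let ?P = "Pi\<^sub>M I (\<lambda>_. std_normal)"
  interpret P: prob_space ?P by (rule prob_space_PiM) (rule prob_space_std_normal)
  have I: "I \<noteq> {}" using pos by auto
  have comp: "distr ?P std_normal (\<lambda>y. y i) = std_normal" if "i \<in> I" for i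
    by (rule distr_PiM_component[OF prob_space_std_normal that])
  have "P.indep_vars (\<lambda>_. std_normal) (\<lambda>i y. y i) I"
  proof (subst P.indep_vars_iff_distr_eq_PiM'[OF I])
    show "P.random_variable std_normal (\<lambda>y. y i)" if "i \<in> I" for i
      using that by (rule measurable_component_singleton)
    have "distr ?P ?P (\<lambda>x. \<lambda>i\<in>I. x i) = distr ?P ?P (\<lambda>x. x)"
      by (intro distr_cong refl) (auto simp: space_PiM)
    also have "\<dots> = ?P" by simp
    also have "\<dots> = Pi\<^sub>M I (\<lambda>i. distr ?P std_normal (\<lambda>y. y i))"
      by (intro PiM_cong refl) (simp add: comp)
    finally show "distr ?P ?P (\<lambda>x. \<lambda>i\<in>I. x i) = Pi\<^sub>M I (\<lambda>i. distr ?P std_normal (\<lambda>y. y i))" .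
  qed
  then have ind: "P.indep_vars (\<lambda>_. borel) (\<lambda>i y. w i * y i) I"
    by (rule P.indep_vars_compose2) simp
  define J where "J = {i \<in> I. w i \<noteq> 0}"
  have J: "finite J" "J \<subseteq> I" using fin by (auto simp: J_def)
  have Jne: "J \<noteq> {}"
  proof
    assume "J = {}"
    then have "(\<Sum>i\<in>I. (w i)\<^sup>2) = 0" by (intro sum.neutral) (auto simp: J_def)
    with pos show False by simp
  qed
  have sumJ: "(\<Sum>i\<in>J. w i * y i) = (\<Sum>i\<in>I. w i * y i)" for y :: "'i \<Rightarrow> real"
    using fin by (intro sum.mono_neutral_left) (auto simp: J_def)
  have sqJ: "(\<Sum>i\<in>J. \<bar>w i\<bar>\<^sup>2) = (\<Sum>i\<in>I. (w i)\<^sup>2)"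
    using fin by (simp, intro sum.mono_neutral_left) (auto simp: J_def)
  have "distributed ?P lborel (\<lambda>y. w i * y i) (normal_density 0 \<bar>w i\<bar>)" if i: "i \<in> J" for i
  proof -
    have iI: "i \<in> I" and wi: "w i \<noteq> 0" using i by (auto simp: J_def)
    have "distributed ?P lborel (\<lambda>y. y i) (normal_density 0 1)"
    proof -
      have "distr ?P lborel (\<lambda>y. y i) = distr ?P std_normal (\<lambda>y. y i)"
        by (rule distr_cong) auto
      then have "distr ?P lborel (\<lambda>y. y i) = std_normal" using comp[OF iI] by simp
      moreover have "(\<lambda>y. y i) \<in> ?P \<rightarrow>\<^sub>M lborel"
        using measurable_component_singleton[OF iI, of "\<lambda>_. std_normal"] by simp
      ultimately show ?thesis unfolding distributed_def by simp
    qed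
    from P.normal_density_affine[OF this _ wi, of 0] show ?thesis by simp
  qed
  then have "distributed ?P lborel (\<lambda>y. \<Sum>i\<in>J. w i * y i)
      (normal_density (\<Sum>i\<in>J. 0) (sqrt (\<Sum>i\<in>J. \<bar>w i\<bar>\<^sup>2)))"
    by (intro P.sum_indep_normal[OF J(1) Jne P.indep_vars_subset[OF ind J(2)]]) (auto simp: J_def)
  then show ?thesis unfolding sumJ sqJ by simp
qed

text \<open>The density is at most \<open>1 / (2 * s)\<close>, since \<open>2 \<le> pi\<close>, and
  the interval has length \<open>2 * (\<tau> * s)\<close>.\<close>

lemma gaussian_small_ball:
  fixes w :: "'i \<Rightarrow> real"
  assumes fin: "finite I" and pos: "0 < (\<Sum>i\<in>I. (w i)\<^sup>2)" and \<tau>: "0 \<le> \<tau>"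
  shows "emeasure (Pi\<^sub>M I (\<lambda>_. std_normal))
    {y \<in> space (Pi\<^sub>M I (\<lambda>_. std_normal)).
      \<bar>\<Sum>i\<in>I. w i * y i\<bar> \<le> \<tau> * sqrt (\<Sum>i\<in>I. (w i)\<^sup>2)} \<le> ennreal \<tau>"
proof -
  let ?P = "Pi\<^sub>M I (\<lambda>_. std_normal)"
  let ?X = "\<lambda>y. \<Sum>i\<in>I. w i * y i"
  define s where "s = sqrt (\<Sum>i\<in>I. (w i)\<^sup>2)"
  have s: "0 < s" using pos by (simp add: s_def)
  have D: "distributed ?P lborel ?X (\<lambda>x. ennreal (normal_density 0 s x))"
    unfolding s_def by (rule gaussian_combination_distributed[OF fin pos])
  have "{y \<in> space ?P. \<bar>?X y\<bar> \<le> \<tau> * s} = ?X -` {- (\<tau> * s) .. \<tau> * s} \<inter> space ?P"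
    by (auto simp: abs_le_iff)
  then have "emeasure ?P {y \<in> space ?P. \<bar>?X y\<bar> \<le> \<tau> * s} =
      (\<integral>\<^sup>+x. ennreal (normal_density 0 s x) * indicator {- (\<tau> * s) .. \<tau> * s} x \<partial>lborel)"
    using distributed_emeasure[OF D, of "{- (\<tau> * s) .. \<tau> * s}"] by simp
  also have "\<dots> \<le> (\<integral>\<^sup>+x. ennreal (1 / (2 * s)) * indicator {- (\<tau> * s) .. \<tau> * s} x \<partial>lborel)"
  proof (intro nn_integral_mono mult_right_mono ennreal_leI)
    fix x :: real
    have "2 * s = sqrt (2 * 2 * s\<^sup>2)" using s by (simp add: real_sqrt_mult)
    also have "\<dots> \<le> sqrt (2 * pi * s\<^sup>2)" using pi_ge_two s by simp
    finally have "1 / sqrt (2 * pi * s\<^sup>2) \<le> 1 / (2 * s)" using s by (intro divide_left_mono) auto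
    moreover have "exp (- (x - 0)\<^sup>2 / (2 * s\<^sup>2)) \<le> 1" by simp
    ultimately have "1 / sqrt (2 * pi * s\<^sup>2) * exp (- (x - 0)\<^sup>2 / (2 * s\<^sup>2)) \<le> 1 / (2 * s) * 1"
      using s by (intro mult_mono) auto
    then show "normal_density 0 s x \<le> 1 / (2 * s)" by (simp add: normal_density_def)
  qed simp
  also have "\<dots> = ennreal (1 / (2 * s)) * ennreal (2 * (\<tau> * s))"
    using \<tau> s by (subst nn_integral_cmult_indicator) auto
  also have "\<dots> = ennreal \<tau>" using s \<tau> by (subst ennreal_mult[symmetric]) auto
  finally show ?thesis unfolding s_def .
qed

lemma gaussian_second_moment:
  fixes w :: "'i \<Rightarrow> real"
  assumes fin: "finite I" and one: "(\<Sum>i\<in>I. (w i)\<^sup>2) = 1"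
  shows "(\<integral>\<^sup>+y. ennreal ((\<Sum>i\<in>I. w i * y i)\<^sup>2) \<partial>Pi\<^sub>M I (\<lambda>_. std_normal)) = 1"
proof -
  have D: "distributed (Pi\<^sub>M I (\<lambda>_. std_normal)) lborel (\<lambda>y. \<Sum>i\<in>I. w i * y i)
      (\<lambda>x. ennreal (std_normal_density x))"
    using gaussian_combination_distributed[OF fin, of w] one by simp
  have "(\<integral>\<^sup>+y. ennreal ((\<Sum>i\<in>I. w i * y i)\<^sup>2) \<partial>Pi\<^sub>M I (\<lambda>_. std_normal)) =
      (\<integral>\<^sup>+x. ennreal (std_normal_density x) * ennreal (x\<^sup>2) \<partial>lborel)"
    by (rule distributed_nn_integral[OF D, symmetric]) simp
  also have "\<dots> = (\<integral>\<^sup>+x. ennreal (std_normal_density x * x ^ (2 * 1)) \<partial>lborel)"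
    by (simp add: ennreal_mult normal_density_nonneg)
  also have "\<dots> = ennreal (fact (2 * 1) / (2 ^ 1 * fact 1))"
    using std_normal_moment_even[of 1]
    by (intro nn_integral_eq_integral[THEN trans])
      (auto simp: has_bochner_integral_iff normal_density_nonneg)
  finally show ?thesis by (simp add: numeral_2_eq_2)
qed

text \<open>Column \<open>c\<close> is independent of the other columns, on which alone
  \<open>w\<close> depends. Integrating over column \<open>c\<close> first turns \<open>w\<close>
  into a fixed vector, to which \<open>gaussian_small_ball\<close> applies; the set excludes
  \<open>w = 0\<close>, where the comparison would hold trivially.\<close>

lemma gaussian_entries_small_ball:
  fixes w :: "(nat \<times> nat \<Rightarrow> real) \<Rightarrow> nat \<Rightarrow> real"
  assumes c: "c < m" and \<tau>: "0 \<le> \<tau>"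
    and meas: "\<And>l. l < d \<Longrightarrow> (\<lambda>\<omega>. w \<omega> l) \<in> borel_measurable (gaussian_entries d m)"
    and dep: "\<And>\<omega> \<omega>' l. (\<And>i c'. i < d \<Longrightarrow> c' < m \<Longrightarrow> c' \<noteq> c \<Longrightarrow> \<omega> (i, c') = \<omega>' (i, c')) \<Longrightarrow> w \<omega> l = w \<omega>' l"
  defines "A \<equiv> {\<omega> \<in> space (gaussian_entries d m). 0 < (\<Sum>l<d. (w \<omega> l)\<^sup>2) \<and>
    \<bar>\<Sum>l<d. w \<omega> l * \<omega> (l, c)\<bar> \<le> \<tau> * sqrt (\<Sum>l<d. (w \<omega> l)\<^sup>2)}"
  shows "A \<in> sets (gaussian_entries d m)" "emeasure (gaussian_entries d m) A \<le> ennreal \<tau>"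
proof -
  let ?J = "{..<d} \<times> {c}"
  let ?I = "{..<d} \<times> ({..<m} - {c})"
  let ?D = "{..<d} \<times> {..<m}"
  let ?P = "\<lambda>K. Pi\<^sub>M K (\<lambda>_ :: nat \<times> nat. std_normal)"
  have G: "gaussian_entries d m = ?P ?D" by (simp add: gaussian_entries_def)
  have IJ: "?I \<union> ?J = ?D" "?I \<inter> ?J = {}" using c by auto
  have coord: "(\<lambda>\<omega>. \<omega> (l, c)) \<in> borel_measurable (?P ?D)" if "l < d" for l
    using measurable_component_singleton[of "(l, c)" ?D "\<lambda>_. std_normal"] that c by simp
  have S: "(\<lambda>\<omega>. \<Sum>l<d. (w \<omega> l)\<^sup>2) \<in> borel_measurable (gaussian_entries d m)"
    by (intro borel_measurable_sum borel_measurable_power meas) simp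
  have T: "(\<lambda>\<omega>. \<Sum>l<d. w \<omega> l * \<omega> (l, c)) \<in> borel_measurable (gaussian_entries d m)"
    by (intro borel_measurable_sum borel_measurable_times meas coord[folded G]) simp_all
  have U: "(\<lambda>\<omega>. \<tau> * sqrt (\<Sum>l<d. (w \<omega> l)\<^sup>2)) \<in> borel_measurable (gaussian_entries d m)"
    by (intro borel_measurable_times borel_measurable_const measurable_compose[OF S borel_measurable_sqrt])
  have "A = {\<omega> \<in> space (gaussian_entries d m). 0 < (\<Sum>l<d. (w \<omega> l)\<^sup>2)} \<inter>
      {\<omega> \<in> space (gaussian_entries d m).
        \<bar>\<Sum>l<d. w \<omega> l * \<omega> (l, c)\<bar> \<le> \<tau> * sqrt (\<Sum>l<d. (w \<omega> l)\<^sup>2)}"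
    unfolding A_def by blast
  then show A: "A \<in> sets (gaussian_entries d m)"
    by (simp only:, intro sets.Int borel_measurable_less borel_measurable_le borel_measurable_abs
        borel_measurable_const S T U)
  have Am: "A \<in> sets (?P (?I \<union> ?J))" using A unfolding G IJ .
  have "emeasure (gaussian_entries d m) A = (\<integral>\<^sup>+\<omega>. indicator A \<omega> \<partial>?P (?I \<union> ?J))"
    unfolding G IJ using A G by simp
  also have "\<dots> = (\<integral>\<^sup>+x. (\<integral>\<^sup>+y. indicator A (merge ?I ?J (x, y)) \<partial>?P ?J) \<partial>?P ?I)"
    by (rule gauss_prod.product_nn_integral_fold[OF IJ(2)]) (use Am in auto)
  also have "\<dots> \<le> (\<integral>\<^sup>+x. ennreal \<tau> \<partial>?P ?I)"
  proof (rule nn_integral_mono)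
    fix x assume "x \<in> space (?P ?I)"
    have w: "w (merge ?I ?J (x, y)) l = w x l" for y l
      by (rule dep) (auto simp: merge_def)
    show "(\<integral>\<^sup>+y. indicator A (merge ?I ?J (x, y)) \<partial>?P ?J) \<le> ennreal \<tau>"
    proof (cases "0 < (\<Sum>l<d. (w x l)\<^sup>2)")
      case False
      then have "indicator A (merge ?I ?J (x, y)) = (0 :: ennreal)" for y
        by (simp add: A_def w indicator_def)
      then show ?thesis by simp
    next
      case True
      let ?w = "\<lambda>(l, c'). w x l"
      have J: "(\<Sum>i\<in>?J. f i) = (\<Sum>l<d. f (l, c))" for f :: "nat \<times> nat \<Rightarrow> real"
        by (simp add: sum.cartesian_product[symmetric, of "\<lambda>a b. f (a, b)", simplified])
      let ?B = "{y \<in> space (?P ?J). \<bar>\<Sum>i\<in>?J. ?w i * y i\<bar> \<le> \<tau> * sqrt (\<Sum>i\<in>?J. (?w i)\<^sup>2)}"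
      have B: "?B \<in> sets (?P ?J)"
      proof -
        have "(\<lambda>y. y i) \<in> borel_measurable (?P ?J)" if "i \<in> ?J" for i
          using measurable_component_singleton[OF that, of "\<lambda>_. std_normal"] by simp
        note [measurable] = this
        show ?thesis by measurable
      qed
      have "(\<integral>\<^sup>+y. indicator A (merge ?I ?J (x, y)) \<partial>?P ?J) \<le> (\<integral>\<^sup>+y. indicator ?B y \<partial>?P ?J)"
      proof (rule nn_integral_mono)
        fix y assume y: "y \<in> space (?P ?J)"
        have "merge ?I ?J (x, y) (l, c) = y (l, c)" if "l < d" for l
          using that by (simp add: merge_def)
        then have "(\<Sum>l<d. w x l * merge ?I ?J (x, y) (l, c)) = (\<Sum>l<d. w x l * y (l, c))"
          by simp
        then show "indicator A (merge ?I ?J (x, y)) \<le> (indicator ?B y :: ennreal)"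
          using y by (auto simp: A_def w J indicator_def)
      qed
      also have "\<dots> = emeasure (?P ?J) ?B" using B by simp
      also have "\<dots> \<le> ennreal \<tau>"
        by (rule gaussian_small_ball) (use True \<tau> J[of "\<lambda>i. (?w i)\<^sup>2"] in auto)
      finally show ?thesis .
    qed
  qed
  also have "\<dots> = ennreal \<tau>"
  proof -
    have "prob_space (?P ?I)" by (rule prob_space_PiM) (rule prob_space_std_normal)
    then show ?thesis by (simp add: prob_space.emeasure_space_1)
  qed
  finally show "emeasure (gaussian_entries d m) A \<le> ennreal \<tau>" .
qed


section \<open>Determinant and cofactors of the sketch\<close>

lemma prob_space_gaussian_entries: "prob_space (gaussian_entries d m)"
  unfolding gaussian_entries_def by (rule prob_space_PiM) (rule prob_space_std_normal)

text \<open>The size \<open>k\<close> varies because invertibility of the block of size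
  \<open>m\<close> is shown by induction over leading blocks.\<close>

definition sketch_mat ::
  "nat \<Rightarrow> (nat \<Rightarrow> nat \<Rightarrow> real) \<Rightarrow> (nat \<times> nat \<Rightarrow> real) \<Rightarrow> nat \<Rightarrow> real mat" where
  "sketch_mat d v g k = Matrix.mat k k (\<lambda>(j, c). sketch_coord d v g j c)"

lemma sketch_mat_carrier: "sketch_mat d v g k \<in> carrier_mat k k"
  by (simp add: sketch_mat_def)

lemma measurable_sketch_coord:
  assumes "c < m"
  shows "(\<lambda>g. sketch_coord d v g j c) \<in> borel_measurable (gaussian_entries d m)"
  unfolding sketch_coord_def gaussian_entries_def
proof (intro borel_measurable_sum borel_measurable_times borel_measurable_const)
  fix l assume "l \<in> {..<d}"
  then show "(\<lambda>g. g (l, c)) \<in> borel_measurable (Pi\<^sub>M ({..<d} \<times> {..<m}) (\<lambda>_. std_normal))"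
    using measurable_component_singleton[of "(l, c)" "{..<d} \<times> {..<m}" "\<lambda>_. std_normal"] assms by simp
qed

lemma measurable_det:
  assumes "\<And>i j. i < k \<Longrightarrow> j < k \<Longrightarrow> (\<lambda>x. f x i j :: real) \<in> borel_measurable M"
  shows "(\<lambda>x. Determinant.det (Matrix.mat k k (\<lambda>(i, j). f x i j))) \<in> borel_measurable M"
proof -
  have "Determinant.det (Matrix.mat k k (\<lambda>(i, j). f x i j)) =
      (\<Sum>p\<in>{p. p permutes {0..<k}}. signof p * (\<Prod>i = 0..<k. f x i (p i)))" for x
  proof -
    have "(\<Prod>i = 0..<k. Matrix.mat k k (\<lambda>(i, j). f x i j) $$ (i, p i)) = (\<Prod>i = 0..<k. f x i (p i))"
      if "p permutes {0..<k}" for p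
      using permutes_in_image[OF that] by (intro prod.cong refl) auto
    then show ?thesis by (subst det_def'[of _ k]) (auto intro!: sum.cong)
  qed
  moreover have "(\<lambda>x. \<Sum>p\<in>{p. p permutes {0..<k}}. signof p * (\<Prod>i = 0..<k. f x i (p i))) \<in> borel_measurable M"
  proof (intro borel_measurable_sum borel_measurable_times borel_measurable_const borel_measurable_prod)
    fix p i assume "p \<in> {p. p permutes {0..<k}}" and i: "i \<in> {0..<k}"
    then have "p i < k" using permutes_in_image[of p "{0..<k}" i] by auto
    with i show "(\<lambda>x. f x i (p i)) \<in> borel_measurable M" using assms by auto
  qed
  ultimately show ?thesis by simp
qed

lemma measurable_sketch_cofactor:
  assumes "k \<le> m"
  shows "(\<lambda>g. cofactor (sketch_mat d v g k) i c) \<in> borel_measurable (gaussian_entries d m)"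
proof -
  have "(\<lambda>g. Determinant.det (Matrix.mat (k - 1) (k - 1) (\<lambda>(i', j').
      sketch_coord d v g (if i' < i then i' else Suc i') (if j' < c then j' else Suc j'))))
    \<in> borel_measurable (gaussian_entries d m)"
    by (rule measurable_det) (use assms in \<open>auto intro!: measurable_sketch_coord\<close>)
  moreover have "mat_delete (sketch_mat d v g k) i c = Matrix.mat (k - 1) (k - 1) (\<lambda>(i', j').
      sketch_coord d v g (if i' < i then i' else Suc i') (if j' < c then j' else Suc j'))" for g
    by (rule eq_matI) (auto simp: mat_delete_def sketch_mat_def)
  ultimately show ?thesis unfolding cofactor_def by simp
qed

lemma sketch_cofactor_cong:
  assumes "\<And>l c'. l < d \<Longrightarrow> c' < k \<Longrightarrow> c' \<noteq> c \<Longrightarrow> g (l, c') = g' (l, c')"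
  shows "cofactor (sketch_mat d v g k) i c = cofactor (sketch_mat d v g' k) i c"
proof -
  have "mat_delete (sketch_mat d v g k) i c = mat_delete (sketch_mat d v g' k) i c"
    by (rule eq_matI) (auto simp: mat_delete_def sketch_mat_def sketch_coord_def intro!: sum.cong assms)
  then show ?thesis unfolding cofactor_def by simp
qed

text \<open>A normal, in the original coordinates, to the span of all columns but column \<open>c\<close>.\<close>

definition cofactor_normal ::
  "nat \<Rightarrow> (nat \<Rightarrow> nat \<Rightarrow> real) \<Rightarrow> nat \<Rightarrow> nat \<Rightarrow> (nat \<times> nat \<Rightarrow> real) \<Rightarrow> nat \<Rightarrow> real" where
  "cofactor_normal d v k c g l = (\<Sum>j<k. v j l * cofactor (sketch_mat d v g k) j c)"

text \<open>Laplace expansion along column \<open>c\<close>, rewritten as a linear form in the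
  original Gaussian entries of that column.\<close>

lemma det_eq_cofactor_normal:
  assumes "c < k"
  shows "Determinant.det (sketch_mat d v g k) = (\<Sum>l<d. cofactor_normal d v k c g l * g (l, c))"
proof -
  have "Determinant.det (sketch_mat d v g k) =
      (\<Sum>j<k. sketch_mat d v g k $$ (j, c) * cofactor (sketch_mat d v g k) j c)"
    by (rule laplace_expansion_column[OF sketch_mat_carrier assms])
  also have "\<dots> = (\<Sum>j<k. \<Sum>l<d. v j l * cofactor (sketch_mat d v g k) j c * g (l, c))"
    using assms by (intro sum.cong refl)
      (simp add: sketch_mat_def sketch_coord_def sum_distrib_right mult_ac)
  also have "\<dots> = (\<Sum>l<d. \<Sum>j<k. v j l * cofactor (sketch_mat d v g k) j c * g (l, c))"
    by (rule sum.swap)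
  finally show ?thesis by (simp add: cofactor_normal_def sum_distrib_right)
qed

lemma cofactor_normal_norm:
  assumes v: "\<And>i j. i < k \<Longrightarrow> j < k \<Longrightarrow> ip d (v i) (v j) = (if i = j then 1 else 0)"
  shows "(\<Sum>l<d. (cofactor_normal d v k c g l)\<^sup>2) = (\<Sum>j<k. (cofactor (sketch_mat d v g k) j c)\<^sup>2)"
proof -
  let ?c = "\<lambda>j. cofactor (sketch_mat d v g k) j c"
  have "(\<Sum>l<d. (cofactor_normal d v k c g l)\<^sup>2) = (\<Sum>l<d. \<Sum>i<k. \<Sum>j<k. ?c i * ?c j * (v i l * v j l))"
    unfolding cofactor_normal_def power2_eq_square sum_product
    by (intro sum.cong refl) (simp add: mult_ac)
  also have "\<dots> = (\<Sum>i<k. \<Sum>l<d. \<Sum>j<k. ?c i * ?c j * (v i l * v j l))" by (rule sum.swap)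
  also have "\<dots> = (\<Sum>i<k. \<Sum>j<k. ?c i * ?c j * ip d (v i) (v j))"
    by (rule sum.cong[OF refl], subst sum.swap) (simp add: ip_def sum_distrib_left)
  also have "\<dots> = (\<Sum>i<k. \<Sum>j<k. if j = i then (?c i)\<^sup>2 else 0)"
    by (intro sum.cong refl) (auto simp: v power2_eq_square)
  finally show ?thesis by simp
qed

text \<open>The determinant is a linear form in column \<open>c\<close> whose coefficient vector
  \<open>cofactor_normal\<close> depends only on the other columns and, by orthonormality of
  \<open>v\<close>, has the length of the cofactor vector. So
  \<open>gaussian_entries_small_ball\<close> applies.\<close>

lemma det_small_ball:
  assumes v: "\<And>i j. i < k \<Longrightarrow> j < k \<Longrightarrow> ip d (v i) (v j) = (if i = j then 1 else 0)"
    and c: "c < k" and k: "k \<le> m" and \<tau>: "0 \<le> \<tau>"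
  defines "A \<equiv> {g \<in> space (gaussian_entries d m).
    0 < (\<Sum>j<k. (cofactor (sketch_mat d v g k) j c)\<^sup>2) \<and>
    \<bar>Determinant.det (sketch_mat d v g k)\<bar> \<le> \<tau> * sqrt (\<Sum>j<k. (cofactor (sketch_mat d v g k) j c)\<^sup>2)}"
  shows "A \<in> sets (gaussian_entries d m)" "emeasure (gaussian_entries d m) A \<le> ennreal \<tau>"
proof -
  have meas: "(\<lambda>g. cofactor_normal d v k c g l) \<in> borel_measurable (gaussian_entries d m)" for l
    unfolding cofactor_normal_def
    by (intro borel_measurable_sum borel_measurable_times measurable_sketch_cofactor k
        borel_measurable_const)
  have dep: "cofactor_normal d v k c g l = cofactor_normal d v k c g' l"
    if "\<And>i c'. i < d \<Longrightarrow> c' < m \<Longrightarrow> c' \<noteq> c \<Longrightarrow> g (i, c') = g' (i, c')" for g g' l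
    unfolding cofactor_normal_def using k
    by (intro sum.cong refl arg_cong2[where f = "(*)"] sketch_cofactor_cong that) auto
  have cm: "c < m" using c k by simp
  have e: "A = {g \<in> space (gaussian_entries d m). 0 < (\<Sum>l<d. (cofactor_normal d v k c g l)\<^sup>2) \<and>
      \<bar>\<Sum>l<d. cofactor_normal d v k c g l * g (l, c)\<bar>
        \<le> \<tau> * sqrt (\<Sum>l<d. (cofactor_normal d v k c g l)\<^sup>2)}"
    unfolding A_def by (simp add: cofactor_normal_norm[OF v] det_eq_cofactor_normal[OF c])
  show "A \<in> sets (gaussian_entries d m)"
    unfolding e by (rule gaussian_entries_small_ball(1)[where w = "cofactor_normal d v k c", OF cm \<tau> meas], rule dep, blast)
  show "emeasure (gaussian_entries d m) A \<le> ennreal \<tau>"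
    unfolding e by (rule gaussian_entries_small_ball(2)[where w = "cofactor_normal d v k c", OF cm \<tau> meas], rule dep, blast)
qed

lemma measurable_sketch_det:
  assumes "k \<le> m"
  shows "(\<lambda>g. Determinant.det (sketch_mat d v g k)) \<in> borel_measurable (gaussian_entries d m)"
  unfolding sketch_mat_def
  by (rule measurable_det) (use assms in \<open>auto intro!: measurable_sketch_coord\<close>)

lemma cofactor_last:
  "cofactor (sketch_mat d v g (Suc k)) k k = Determinant.det (sketch_mat d v g k)"
proof -
  have "mat_delete (sketch_mat d v g (Suc k)) k k = sketch_mat d v g k"
    by (rule eq_matI) (auto simp: mat_delete_def sketch_mat_def)
  then show ?thesis by (simp add: cofactor_def flip: mult_2)
qed

text \<open>Induction on the block size. The cofactor at the last corner is the previous
  determinant, nonzero outside a null set; there the last column has a nonzero cofactor vector, and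
  \<open>det_small_ball\<close> with \<tau> = 0 adds only another null set.\<close>

lemma sketch_det_nonzero:
  assumes v: "\<And>i j. i < m \<Longrightarrow> j < m \<Longrightarrow> ip d (v i) (v j) = (if i = j then 1 else 0)"
    and k: "k \<le> m"
  shows "{g \<in> space (gaussian_entries d m). Determinant.det (sketch_mat d v g k) = 0}
    \<in> null_sets (gaussian_entries d m)"
  using k
proof (induct k)
  case 0
  have "Determinant.det (sketch_mat d v g 0) = 1" for g
    by (rule det_dim_zero) (rule sketch_mat_carrier)
  then show ?case by simp
next
  case (Suc k)
  let ?N = "\<lambda>k. {g \<in> space (gaussian_entries d m). Determinant.det (sketch_mat d v g k) = 0}"
  let ?A = "{g \<in> space (gaussian_entries d m).
    0 < (\<Sum>j<Suc k. (cofactor (sketch_mat d v g (Suc k)) j k)\<^sup>2) \<and>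
    \<bar>Determinant.det (sketch_mat d v g (Suc k))\<bar>
      \<le> 0 * sqrt (\<Sum>j<Suc k. (cofactor (sketch_mat d v g (Suc k)) j k)\<^sup>2)}"
  have v': "\<And>i j. i < Suc k \<Longrightarrow> j < Suc k \<Longrightarrow> ip d (v i) (v j) = (if i = j then 1 else 0)"
    using v Suc(2) by simp
  have "?A \<in> null_sets (gaussian_entries d m)"
    using det_small_ball[OF v' lessI Suc(2) order_refl] by (auto intro!: null_setsI)
  moreover have "?N k \<in> null_sets (gaussian_entries d m)" using Suc by simp
  ultimately have N1: "?N k \<union> ?A \<in> null_sets (gaussian_entries d m)" by blast
  have N2: "?N (Suc k) \<subseteq> ?N k \<union> ?A"
  proof
    fix g assume g: "g \<in> ?N (Suc k)"
    show "g \<in> ?N k \<union> ?A"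
    proof (cases "Determinant.det (sketch_mat d v g k) = 0")
      case True
      with g show ?thesis by simp
    next
      case False
      have "0 \<le> (\<Sum>j<k. (cofactor (sketch_mat d v g (Suc k)) j k)\<^sup>2)" by (simp add: sum_nonneg)
      moreover have "0 < (cofactor (sketch_mat d v g (Suc k)) k k)\<^sup>2"
        using False by (simp add: cofactor_last)
      ultimately have "0 < (\<Sum>j<Suc k. (cofactor (sketch_mat d v g (Suc k)) j k)\<^sup>2)"
        by (simp add: add_nonneg_pos)
      with g show ?thesis by simp
    qed
  qed
  have N3: "?N (Suc k) \<in> sets (gaussian_entries d m)"
  proof -
    note [measurable] = measurable_sketch_det[OF Suc(2), of d v]
    show ?thesis by measurable
  qed
  show ?case by (rule null_sets_subset[OF N1 N3 N2])
qed


section \<open>Size of the rows of the sketch and of its inverse block\<close>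

lemma sketch_coord_second_moment:
  assumes one: "ip d (v j) (v j) = 1" and c: "c < m"
  shows "(\<integral>\<^sup>+g. ennreal ((sketch_coord d v g j c)\<^sup>2) \<partial>gaussian_entries d m) = 1"
proof -
  let ?D = "{..<d} \<times> {..<m}"
  \<comment> \<open>Extending the coefficients by 0 to all columns makes \<open>sketch_coord\<close>
    a combination over the full index set, as in \<open>gaussian_second_moment\<close>.\<close>
  let ?w = "\<lambda>(l, c'). if c' = c then v j l else 0"
  have s: "(\<Sum>i\<in>?D. if snd i = c then f i else 0) = (\<Sum>l<d. f (l, c))" for f :: "nat \<times> nat \<Rightarrow> real"
  proof -
    have "(\<Sum>i\<in>?D. if snd i = c then f i else 0) = (\<Sum>l<d. \<Sum>c'<m. if c' = c then f (l, c') else 0)"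
      by (subst sum.cartesian_product) (auto intro!: sum.cong)
    then show ?thesis using c by simp
  qed
  have "(\<Sum>i\<in>?D. (?w i)\<^sup>2) = (\<Sum>i\<in>?D. if snd i = c then (v j (fst i))\<^sup>2 else 0)"
    by (intro sum.cong) auto
  also have "\<dots> = 1" unfolding s using one by (simp add: ip_self)
  finally have w1: "(\<Sum>i\<in>?D. (?w i)\<^sup>2) = 1" .
  have "(\<Sum>i\<in>?D. ?w i * g i) = sketch_coord d v g j c" for g
  proof -
    have "(\<Sum>i\<in>?D. ?w i * g i) = (\<Sum>i\<in>?D. if snd i = c then v j (fst i) * g i else 0)"
      by (intro sum.cong) auto
    then show ?thesis unfolding s sketch_coord_def by simp
  qed
  then show ?thesis unfolding gaussian_entries_def
    using gaussian_second_moment[OF _ w1] by simp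
qed

text \<open>The total squared length of the left vectors is a sum of Bessel sums, each at most 1,
  over the \<open>d1\<close> coordinate vectors. This is why the tail bound, and with it the
  iteration count, involves \<open>d1\<close> rather than \<open>d2\<close>.\<close>

lemma card_nonzero_sigma:
  assumes svd: "svd_system d1 d2 M u v"
  shows "card {j. j < d2 \<and> sigma (Suc j) M \<noteq> 0} \<le> d1"
proof -
  let ?J = "{j. j < d2 \<and> sigma (Suc j) M \<noteq> 0}"
  have bu: "bessel d1 d2 u" by (rule bessel_orthogonal) (rule svd_systemD(3)[OF svd])
  have "real (card ?J) = (\<Sum>j\<in>?J. ip d1 (u j) (u j))"
    by (simp add: svd_systemD(3)[OF svd])
  also have "\<dots> \<le> (\<Sum>j<d2. ip d1 (u j) (u j))"
    by (intro sum_mono2) (auto simp: ip_nonneg)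
  also have "\<dots> = (\<Sum>i<d1. \<Sum>j<d2. (ip d1 (\<lambda>k. if k = i then 1 else 0) (u j))\<^sup>2)"
    unfolding ip_self by (subst sum.swap) (simp add: ip_def if_distrib[of "\<lambda>x. x * _"] cong: if_cong)
  also have "\<dots> \<le> (\<Sum>i<d1. 1)"
  proof (intro sum_mono)
    fix i assume "i \<in> {..<d1}"
    then have "ip d1 (\<lambda>k. if k = i then 1 else 0) (\<lambda>k. if k = i then 1 else 0) = 1"
      by (simp add: ip_def if_distrib[of "\<lambda>x. x * _"] cong: if_cong)
    then show "(\<Sum>j<d2. (ip d1 (\<lambda>k. if k = i then 1 else 0) (u j))\<^sup>2) \<le> 1"
      using besselD[OF bu, of "\<lambda>k. if k = i then 1 else 0"] by simp
  qed
  finally show ?thesis by simp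
qed

text \<open>The head of \<open>a\<close> is the row vector \<open>b\<close> times the inverse of the
  leading block, and \<open>b\<close> is minus the contribution of the tail. Cauchy-Schwarz in both
  places gives the factors \<open>S\<close> and \<open>real m / \<tau>\<^sup>2\<close>, the latter
  bounding the squared Frobenius norm of the inverse.\<close>

lemma head_tail_bound:
  fixes a s :: "nat \<Rightarrow> real"
  assumes m: "m \<le> d2"
    and det: "Determinant.det (sketch_mat d v g m) \<noteq> 0"
    and cof: "\<And>c. c < m \<Longrightarrow> \<tau>\<^sup>2 * (\<Sum>j<m. (cofactor (sketch_mat d v g m) j c)\<^sup>2)
      \<le> (Determinant.det (sketch_mat d v g m))\<^sup>2"
    and \<tau>: "0 < \<tau>"
    and tail: "(\<Sum>j\<in>{j. j < d2 \<and> s j \<noteq> 0}. \<Sum>c<m. (sketch_coord d v g j c)\<^sup>2) \<le> S"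
    and a: "\<And>c. c < m \<Longrightarrow> (\<Sum>j<d2. a j * sketch_coord d v g j c) = 0" "\<And>j. s j = 0 \<Longrightarrow> a j = 0"
  shows "(\<Sum>j<m. (a j)\<^sup>2) \<le> S * real m / \<tau>\<^sup>2 * (\<Sum>j=m..<d2. (a j)\<^sup>2)"
proof -
  let ?O = "sketch_coord d v g"
  let ?S = "sketch_mat d v g m"
  let ?J = "{j. j < d2 \<and> s j \<noteq> 0}"
  define D where "D = Determinant.det ?S"
  \<comment> \<open>By Cramer's rule this is the inverse of \<open>?S\<close>; its row
    \<open>c\<close> consists of the cofactors of column \<open>c\<close> over the
    determinant.\<close>
  define I where "I c j = cofactor ?S j c / D" for c j
  define b where "b c = (\<Sum>j<m. a j * ?O j c)" for c
  define T where "T = (\<Sum>j=m..<d2. (a j)\<^sup>2)"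
  have D0: "D \<noteq> 0" using det by (simp add: D_def)
  have split: "(\<Sum>j<d2. f j) = (\<Sum>j<m. f j) + (\<Sum>j=m..<d2. f j)" for f :: "nat \<Rightarrow> real"
    using sum.atLeastLessThan_concat[of 0 m d2 f] m by (simp add: atLeast0LessThan)
  have "(\<Sum>c<m. (b c)\<^sup>2) \<le> (\<Sum>c<m. T * (\<Sum>j\<in>?J. (?O j c)\<^sup>2))"
  proof (rule sum_mono)
    fix c assume "c \<in> {..<m}"
    then have "b c = - (\<Sum>j=m..<d2. a j * ?O j c)"
      using a(1)[of c] split[of "\<lambda>j. a j * ?O j c"] by (simp add: b_def)
    also have "(\<Sum>j=m..<d2. a j * ?O j c) = (\<Sum>j\<in>{m..<d2} \<inter> ?J. a j * ?O j c)"
      using a(2) by (intro sum.mono_neutral_right) auto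
    finally have "(b c)\<^sup>2 = (\<Sum>j\<in>{m..<d2} \<inter> ?J. a j * ?O j c)\<^sup>2" by simp
    also have "\<dots> \<le> (\<Sum>j\<in>{m..<d2} \<inter> ?J. (a j)\<^sup>2) * (\<Sum>j\<in>{m..<d2} \<inter> ?J. (?O j c)\<^sup>2)"
      by (rule Cauchy_Schwarz_ineq_sum)
    also have "\<dots> \<le> T * (\<Sum>j\<in>?J. (?O j c)\<^sup>2)"
      unfolding T_def by (intro mult_mono sum_mono2 sum_nonneg) auto
    finally show "(b c)\<^sup>2 \<le> T * (\<Sum>j\<in>?J. (?O j c)\<^sup>2)" .
  qed
  also have "\<dots> = T * (\<Sum>j\<in>?J. \<Sum>c<m. (?O j c)\<^sup>2)"
    unfolding sum.swap[of _ "{..<m}" ?J] by (simp add: sum_distrib_left)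
  also have "\<dots> \<le> T * S"
    by (rule mult_left_mono[OF tail]) (simp add: T_def sum_nonneg)
  finally have bS: "(\<Sum>c<m. (b c)\<^sup>2) \<le> T * S" .
  have col: "(\<Sum>j<m. (I c j)\<^sup>2) \<le> 1 / \<tau>\<^sup>2" if "c < m" for c
  proof -
    have "(\<Sum>j<m. (I c j)\<^sup>2) = (\<Sum>j<m. (cofactor ?S j c)\<^sup>2) / D\<^sup>2"
      by (simp add: I_def power_divide sum_divide_distrib)
    also have "\<dots> \<le> 1 / \<tau>\<^sup>2"
      using cof[OF that] D0 \<tau> by (simp add: D_def field_simps)
    finally show ?thesis .
  qed
  have inv: "a i = (\<Sum>c<m. b c * I c i)" if i: "i < m" for i
  proof -
    have e: "(\<Sum>c<m. ?O j c * I c i) = (if j = i then 1 else 0)" if j: "j < m" for j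
    proof -
      have "(?S * adj_mat ?S) $$ (j, i) = (\<Sum>c<m. ?S $$ (j, c) * adj_mat ?S $$ (c, i))"
        by (rule index_mult_mat_sum[OF sketch_mat_carrier adj_mat(1)[OF sketch_mat_carrier] j i])
      also have "\<dots> = (\<Sum>c<m. ?O j c * cofactor ?S i c)"
        using i j by (intro sum.cong refl) (simp add: adj_mat_def sketch_mat_def)
      finally have "(\<Sum>c<m. ?O j c * cofactor ?S i c) = (if j = i then D else 0)"
        using i j by (cases "j = i") (simp_all add: adj_mat(2)[OF sketch_mat_carrier] D_def)
      then show ?thesis using D0
        by (simp add: I_def sum_divide_distrib[symmetric])
    qed
    have "(\<Sum>c<m. b c * I c i) = (\<Sum>c<m. \<Sum>j<m. a j * (?O j c * I c i))"
      by (simp add: b_def sum_distrib_left sum_distrib_right mult_ac)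
    also have "\<dots> = (\<Sum>j<m. \<Sum>c<m. a j * (?O j c * I c i))" by (rule sum.swap)
    also have "\<dots> = (\<Sum>j<m. if j = i then a i else 0)"
      by (intro sum.cong refl) (auto simp: e simp flip: sum_distrib_left)
    finally show ?thesis using i by simp
  qed
  have "(\<Sum>j<m. (a j)\<^sup>2) \<le> (\<Sum>j<m. (\<Sum>c<m. (b c)\<^sup>2) * (\<Sum>c<m. (I c j)\<^sup>2))"
    by (intro sum_mono) (simp add: inv Cauchy_Schwarz_ineq_sum)
  also have "\<dots> = (\<Sum>c<m. (b c)\<^sup>2) * (\<Sum>c<m. \<Sum>j<m. (I c j)\<^sup>2)"
    unfolding sum_distrib_left[symmetric] by (rule arg_cong[OF sum.swap])
  also have "\<dots> \<le> (T * S) * (\<Sum>c<m. 1 / \<tau>\<^sup>2)"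
    by (intro mult_mono bS sum_mono col) (auto intro!: sum_nonneg order_trans[OF _ bS])
  finally show ?thesis by (simp add: T_def mult_ac)
qed


text \<open>Three kinds of bad events share the budget \<open>p\<close>: a singular block has
  probability 0, the \<open>m\<close> small-ball events cost \<open>p / (2 * m)\<close> each, and a
  large \<open>F\<close> costs \<open>p / 2\<close> by Markov's inequality, its mean being at most
  \<open>d1 * m\<close>. The constant is \<open>K * m / \<tau>\<^sup>2\<close>.\<close>

lemma gaussian_conditioning:
  assumes M: "M \<in> carrier_mat d1 d2" and svd: "svd_system d1 d2 M u v"
    and m: "0 < m" "m \<le> d2" and d1: "0 < d1" and p: "0 < p"
  shows "\<exists>E\<in>sets (gaussian_entries d2 m). 1 - p \<le> measure (gaussian_entries d2 m) E \<and>
    (\<forall>g\<in>E. \<forall>a. (\<forall>c<m. (\<Sum>j<d2. a j * sketch_coord d2 v g j c) = 0) \<longrightarrow>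
      (\<forall>j. sigma (Suc j) M = 0 \<longrightarrow> a j = 0) \<longrightarrow>
      (\<Sum>j<m. (a j)\<^sup>2) \<le> 8 * real m ^ 4 * real d1 / p ^ 3 * (\<Sum>j=m..<d2. (a j)\<^sup>2))"
proof -
  let ?G = "gaussian_entries d2 m"
  let ?S = "\<lambda>g. sketch_mat d2 v g m"
  let ?J = "{j. j < d2 \<and> sigma (Suc j) M \<noteq> 0}"
  interpret prob_space ?G by (rule prob_space_gaussian_entries)
  define \<tau> where "\<tau> = p / (2 * real m)"
  have \<tau>: "0 < \<tau>" using p m by (simp add: \<tau>_def)
  have v: "\<And>i j. i < m \<Longrightarrow> j < m \<Longrightarrow> ip d2 (v i) (v j) = (if i = j then 1 else 0)"
    using svd_systemD(1)[OF svd] m by simp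
  define N where "N = {g \<in> space ?G. Determinant.det (?S g) = 0}"
  define B where "B c = {g \<in> space ?G. 0 < (\<Sum>j<m. (cofactor (?S g) j c)\<^sup>2) \<and>
    \<bar>Determinant.det (?S g)\<bar> \<le> \<tau> * sqrt (\<Sum>j<m. (cofactor (?S g) j c)\<^sup>2)}" for c
  define F where "F g = (\<Sum>j\<in>?J. \<Sum>c<m. (sketch_coord d2 v g j c)\<^sup>2)" for g
  define K where "K = 2 * real m * real d1 / p"
  define H where "H = {g \<in> space ?G. K \<le> F g}"
  have K: "0 < K" using m d1 p by (simp add: K_def)
  have N: "N \<in> null_sets ?G" unfolding N_def by (rule sketch_det_nonzero[OF v order_refl])
  have B: "B c \<in> sets ?G" "measure ?G (B c) \<le> \<tau>" if "c < m" for c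
  proof -
    show 1: "B c \<in> sets ?G" unfolding B_def
      by (rule det_small_ball(1)) (use v that \<tau> in auto)
    have "emeasure ?G (B c) \<le> ennreal \<tau>" unfolding B_def
      by (rule det_small_ball(2)) (use v that \<tau> in auto)
    then show "measure ?G (B c) \<le> \<tau>" using \<tau> by (simp add: emeasure_eq_measure)
  qed
  have Fm [measurable]: "F \<in> borel_measurable ?G"
    unfolding F_def
    by (intro borel_measurable_sum borel_measurable_power measurable_sketch_coord) simp
  have H: "H \<in> sets ?G" unfolding H_def by measurable
  have "(\<integral>\<^sup>+g. ennreal (F g) \<partial>?G) =
      (\<Sum>j\<in>?J. \<Sum>c<m. \<integral>\<^sup>+g. ennreal ((sketch_coord d2 v g j c)\<^sup>2) \<partial>?G)"
  proof -
    have meas: "(\<lambda>g. ennreal ((sketch_coord d2 v g j c)\<^sup>2)) \<in> borel_measurable ?G" if "c < m" for j c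
      using measurable_sketch_coord[OF that, of d2 v j] by measurable
    have meas': "(\<lambda>g. ennreal (\<Sum>c<m. (sketch_coord d2 v g j c)\<^sup>2)) \<in> borel_measurable ?G" for j
      by (intro measurable_compose[OF _ measurable_ennreal] borel_measurable_sum borel_measurable_power
          measurable_sketch_coord) simp
    have "(\<integral>\<^sup>+g. ennreal (F g) \<partial>?G) =
        (\<integral>\<^sup>+g. (\<Sum>j\<in>?J. ennreal (\<Sum>c<m. (sketch_coord d2 v g j c)\<^sup>2)) \<partial>?G)"
      unfolding F_def by (subst sum_ennreal) (auto intro: sum_nonneg)
    also have "\<dots> = (\<Sum>j\<in>?J. \<integral>\<^sup>+g. ennreal (\<Sum>c<m. (sketch_coord d2 v g j c)\<^sup>2) \<partial>?G)"
      by (rule nn_integral_sum) (rule meas')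
    also have "\<dots> = (\<Sum>j\<in>?J. \<integral>\<^sup>+g. (\<Sum>c<m. ennreal ((sketch_coord d2 v g j c)\<^sup>2)) \<partial>?G)"
      by (intro sum.cong refl nn_integral_cong) (subst sum_ennreal, auto)
    also have "\<dots> = (\<Sum>j\<in>?J. \<Sum>c<m. \<integral>\<^sup>+g. ennreal ((sketch_coord d2 v g j c)\<^sup>2) \<partial>?G)"
      by (intro sum.cong refl nn_integral_sum meas) simp
    finally show ?thesis .
  qed
  also have "\<dots> = (\<Sum>j\<in>?J. \<Sum>c<m. 1)"
    by (intro sum.cong refl sketch_coord_second_moment) (auto simp: svd_systemD(1)[OF svd])
  also have "\<dots> = ennreal (real (card ?J) * real m)"
    by (simp add: ennreal_of_nat_eq_real_of_nat ennreal_mult)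
  also have "\<dots> \<le> ennreal (real d1 * real m)"
    using card_nonzero_sigma[OF svd] by (intro ennreal_leI mult_right_mono) auto
  finally have EF: "(\<integral>\<^sup>+g. ennreal (F g) \<partial>?G) \<le> ennreal (real d1 * real m)" .
  have "emeasure ?G H = emeasure ?G {g \<in> space ?G. 1 \<le> ennreal (1 / K) * ennreal (F g)}"
  proof (rule arg_cong[where f = "emeasure ?G"])
    have "K \<le> F g \<longleftrightarrow> 1 \<le> ennreal (1 / K) * ennreal (F g)" for g
    proof -
      have "0 \<le> F g" unfolding F_def by (intro sum_nonneg) simp
      then have "ennreal (1 / K) * ennreal (F g) = ennreal (F g / K)"
        using K by (subst ennreal_mult[symmetric]) auto
      then show ?thesis using K by (simp add: field_simps)
    qed
    then show "H = {g \<in> space ?G. 1 \<le> ennreal (1 / K) * ennreal (F g)}" unfolding H_def by simp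
  qed
  also have "\<dots> \<le> ennreal (1 / K) * (\<integral>\<^sup>+g. ennreal (F g) * indicator (space ?G) g \<partial>?G)"
    by (rule nn_integral_Markov_inequality) auto
  also have "(\<integral>\<^sup>+g. ennreal (F g) * indicator (space ?G) g \<partial>?G) = (\<integral>\<^sup>+g. ennreal (F g) \<partial>?G)"
    by (intro nn_integral_cong) simp
  also have "ennreal (1 / K) * \<dots> \<le> ennreal (1 / K) * ennreal (real d1 * real m)"
    by (intro mult_left_mono EF) simp
  also have "\<dots> = ennreal (p / 2)"
    using K m d1 p by (subst ennreal_mult[symmetric]) (auto simp: K_def)
  finally have PH: "measure ?G H \<le> p / 2" using p by (simp add: emeasure_eq_measure)
  define Bad where "Bad = N \<union> (\<Union>c<m. B c) \<union> H"
  have Bs: "(\<Union>c<m. B c) \<in> sets ?G" using B by auto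
  have Ns: "N \<in> sets ?G" using N by auto
  have Bad: "Bad \<in> sets ?G" unfolding Bad_def using Bs Ns H by auto
  have "measure ?G Bad \<le> measure ?G N + measure ?G (\<Union>c<m. B c) + measure ?G H"
    unfolding Bad_def
    using measure_Un_le[OF sets.Un[OF Ns Bs] H] measure_Un_le[OF Ns Bs]
    by linarith
  also have "measure ?G N = 0" using N by (simp add: measure_eq_0_null_sets)
  also have "measure ?G (\<Union>c<m. B c) \<le> (\<Sum>c<m. measure ?G (B c))"
    by (rule measure_UNION_le) (use B in auto)
  also have "\<dots> \<le> (\<Sum>c<m. \<tau>)" by (intro sum_mono) (use B in auto)
  also have "\<dots> = p / 2" using m by (simp add: \<tau>_def)
  finally have PBad: "measure ?G Bad \<le> p" using PH by simp
  show ?thesis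
  proof (intro bexI[of _ "space ?G - Bad"] conjI ballI allI impI)
    show "space ?G - Bad \<in> sets ?G" using Bad by auto
    show "1 - p \<le> measure ?G (space ?G - Bad)" using PBad by (simp add: prob_compl[OF Bad])
    fix g a
    assume g: "g \<in> space ?G - Bad"
      and a: "\<forall>c<m. (\<Sum>j<d2. a j * sketch_coord d2 v g j c) = 0"
        "\<forall>j. sigma (Suc j) M = 0 \<longrightarrow> a j = 0"
    have det: "Determinant.det (?S g) \<noteq> 0" using g by (auto simp: Bad_def N_def)
    have cof: "\<tau>\<^sup>2 * (\<Sum>j<m. (cofactor (?S g) j c)\<^sup>2) \<le> (Determinant.det (?S g))\<^sup>2" if c: "c < m" for c
    \<comment> \<open>The small-ball events speak only of nonzero cofactor vectors; for a zero one
      the bound is trivial.\<close>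
    proof (cases "0 < (\<Sum>j<m. (cofactor (?S g) j c)\<^sup>2)")
      case True
      then have "\<tau> * sqrt (\<Sum>j<m. (cofactor (?S g) j c)\<^sup>2) \<le> \<bar>Determinant.det (?S g)\<bar>"
        using g c by (auto simp: Bad_def B_def)
      then have "(\<tau> * sqrt (\<Sum>j<m. (cofactor (?S g) j c)\<^sup>2))\<^sup>2 \<le> \<bar>Determinant.det (?S g)\<bar>\<^sup>2"
        using \<tau> by (intro power_mono mult_nonneg_nonneg real_sqrt_ge_zero sum_nonneg) auto
      then show ?thesis using True by (simp add: power_mult_distrib)
    next
      case False
      then have "(\<Sum>j<m. (cofactor (?S g) j c)\<^sup>2) = 0"
        by (simp add: sum_nonneg order_antisym not_less)
      then show ?thesis by simp
    qed
    have tail: "(\<Sum>j\<in>?J. \<Sum>c<m. (sketch_coord d2 v g j c)\<^sup>2) \<le> K"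
      using g by (auto simp: Bad_def H_def F_def)
    have "(\<Sum>j<m. (a j)\<^sup>2) \<le> K * real m / \<tau>\<^sup>2 * (\<Sum>j=m..<d2. (a j)\<^sup>2)"
      by (rule head_tail_bound[OF m(2) det cof \<tau> tail]) (use a in auto)
    also have "K * real m / \<tau>\<^sup>2 = 8 * real m ^ 4 * real d1 / p ^ 3"
      using m p by (simp add: K_def \<tau>_def field_simps power2_eq_square power3_eq_cube power4_eq_xxxx)
    finally show "(\<Sum>j<m. (a j)\<^sup>2) \<le> 8 * real m ^ 4 * real d1 / p ^ 3 * (\<Sum>j=m..<d2. (a j)\<^sup>2)" .
  qed
qed

section \<open>Compression and merging\<close>

text \<open>Since \<open>\<epsilon> / (1 + \<epsilon>\<^sub>0) \<le> ln (1 + \<epsilon>)\<close>,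
  the logarithm of the right side is at least \<open>4 * q * ln (1 + \<epsilon>)\<close>, hence at
  least \<open>8 * ln L\<close>, which exceeds the required \<open>6 * ln L\<close>.\<close>

lemma iteration_count_suffices:
  fixes \<epsilon> \<epsilon>\<^sub>0 L :: real
  assumes \<epsilon>: "0 < \<epsilon>" "\<epsilon> \<le> \<epsilon>\<^sub>0" and L: "4 \<le> L"
    and q: "2 * (1 + \<epsilon>\<^sub>0) * (ln L / \<epsilon>) \<le> real q"
  shows "L ^ 6 \<le> (1 + \<epsilon>) ^ (2 * (2 * q + 1))"
proof -
  have lnL: "0 \<le> ln L" using L by simp
  have "ln (1 / (1 + \<epsilon>)) \<le> 1 / (1 + \<epsilon>) - 1" by (rule ln_le_minus_one) (use \<epsilon> in simp)
  then have "\<epsilon> / (1 + \<epsilon>) \<le> ln (1 + \<epsilon>)" using \<epsilon> by (simp add: ln_div field_simps)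
  moreover have "\<epsilon> / (1 + \<epsilon>\<^sub>0) \<le> \<epsilon> / (1 + \<epsilon>)" using \<epsilon> by (intro divide_left_mono) auto
  ultimately have l: "\<epsilon> / (1 + \<epsilon>\<^sub>0) \<le> ln (1 + \<epsilon>)" by linarith
  have "6 * ln L \<le> 4 * (2 * (1 + \<epsilon>\<^sub>0) * (ln L / \<epsilon>)) * (\<epsilon> / (1 + \<epsilon>\<^sub>0))"
  proof -
    have "4 * (2 * x * (l / e)) * (e / x) = 8 * l" if "x \<noteq> 0" "e \<noteq> 0" for x l e :: real
      using that by simp
    from this[of "1 + \<epsilon>\<^sub>0" \<epsilon> "ln L"]
    have "4 * (2 * (1 + \<epsilon>\<^sub>0) * (ln L / \<epsilon>)) * (\<epsilon> / (1 + \<epsilon>\<^sub>0)) = 8 * ln L"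
      using \<epsilon> by simp
    then show ?thesis using lnL by simp
  qed
  also have "\<dots> \<le> 4 * real q * ln (1 + \<epsilon>)"
    using q l \<epsilon> lnL by (intro mult_mono) auto
  also have "\<dots> \<le> real (2 * (2 * q + 1)) * ln (1 + \<epsilon>)"
    using \<epsilon> by (intro mult_right_mono) auto
  finally have "exp (6 * ln L) \<le> exp (real (2 * (2 * q + 1)) * ln (1 + \<epsilon>))" by simp
  moreover have "exp (6 * ln L) = L ^ 6"
    using exp_of_nat_mult[of 6 "ln L"] L by simp
  moreover have "exp (real (2 * (2 * q + 1)) * ln (1 + \<epsilon>)) = (1 + \<epsilon>) ^ (2 * (2 * q + 1))"
    using exp_of_nat_mult[of "2 * (2 * q + 1)" "ln (1 + \<epsilon>)"] \<epsilon> by simp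
  ultimately show ?thesis by linarith
qed

text \<open>With \<open>L = m * d1 / p\<close> the conditioning constant is at most
  \<open>8 * L ^ 4\<close>. The bounds on \<open>m\<close>, \<open>d1\<close> and \<open>p\<close>
  give \<open>4 \<le> L\<close>, so \<open>1 + 8 * L ^ 4 \<le> L ^ 6\<close>, and the iteration
  count dominates \<open>L ^ 6\<close>.\<close>

lemma spm_success:
  fixes \<epsilon> \<epsilon>\<^sub>0 p :: real
  assumes M: "M \<in> carrier_mat d1 d2" and m: "0 < m" "m \<le> d2" and d1: "2 \<le> d1"
    and p: "0 < p" "p \<le> 1 / 2" and \<epsilon>: "0 < \<epsilon>" "\<epsilon> \<le> \<epsilon>\<^sub>0"
    and q: "2 * (1 + \<epsilon>\<^sub>0) * (ln (real m * real d1 / p) / \<epsilon>) \<le> real q"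
  shows "\<exists>E\<in>sets (gaussian_entries d2 m). 1 - p \<le> measure (gaussian_entries d2 m) E \<and>
    (\<forall>g\<in>E. \<forall>Z. spm M q (Matrix.mat d2 m g) Z \<longrightarrow>
      spectral_norm (M - Z * Z\<^sup>T * M) \<le> (1 + \<epsilon>) * sigma (Suc m) M)"
proof -
  obtain u v where svd: "svd_system d1 d2 M u v" using svd_exists[OF M] .
  define F where "F = 8 * real m ^ 4 * real d1 / p ^ 3"
  define L where "L = real m * real d1 / p"
  have d1': "0 < d1" using d1 by simp
  obtain E where E: "E \<in> sets (gaussian_entries d2 m)" "1 - p \<le> measure (gaussian_entries d2 m) E"
    and cond: "\<forall>g\<in>E. \<forall>a. (\<forall>c<m. (\<Sum>j<d2. a j * sketch_coord d2 v g j c) = 0) \<longrightarrow>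
      (\<forall>j. sigma (Suc j) M = 0 \<longrightarrow> a j = 0) \<longrightarrow>
      (\<Sum>j<m. (a j)\<^sup>2) \<le> F * (\<Sum>j=m..<d2. (a j)\<^sup>2)"
    using gaussian_conditioning[OF M svd m d1' p(1), folded F_def] by blast
  have "1 * 2 \<le> real m * real d1" using m d1 by (intro mult_mono) auto
  then have "2 \<le> real m * real d1" by simp
  then have "2 / (1 / 2) \<le> L" unfolding L_def using p by (intro frac_le) auto
  then have L: "4 \<le> L" by simp
  have "F \<le> 8 * L ^ 4"
  proof -
    have "real d1 / p ^ 3 \<le> real d1 ^ 4 / p ^ 4"
      using p d1 by (intro frac_le power_decreasing) (auto simp: self_le_power)
    then have "8 * real m ^ 4 * (real d1 / p ^ 3) \<le> 8 * real m ^ 4 * (real d1 ^ 4 / p ^ 4)"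
      by (intro mult_left_mono) auto
    then show ?thesis by (simp add: F_def L_def power_mult_distrib power_divide)
  qed
  moreover have "1 + 8 * L ^ 4 \<le> L ^ 6"
  proof -
    have "4 ^ 4 \<le> L ^ 4" and "4 ^ 2 \<le> L ^ 2" using L by (intro power_mono; simp)+
    then have "1 \<le> L ^ 4" "16 * L ^ 4 \<le> L ^ 2 * L ^ 4"
      using mult_right_mono[of 16 "L ^ 2" "L ^ 4"] by auto
    moreover have "L ^ 2 * L ^ 4 = L ^ 6" by (simp flip: power_add)
    ultimately show ?thesis by linarith
  qed
  moreover have "L ^ 6 \<le> (1 + \<epsilon>) ^ (2 * (2 * q + 1))"
    by (rule iteration_count_suffices[OF \<epsilon> L]) (use q in \<open>simp add: L_def\<close>)
  ultimately have F1: "1 + F \<le> (1 + \<epsilon>) ^ (2 * (2 * q + 1))" by linarith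
  have F0: "0 \<le> F" using p by (simp add: F_def)
  show ?thesis
  proof (intro bexI[OF _ E(1)] conjI E(2) ballI allI impI)
    fix g Z assume g: "g \<in> E" and spm: "spm M q (Matrix.mat d2 m g) Z"
    show "spectral_norm (M - Z * Z\<^sup>T * M) \<le> (1 + \<epsilon>) * sigma (Suc m) M"
      by (rule power_method_error[OF M svd m(2) spm _ F0 F1]) (use cond g \<epsilon> in auto)
  qed
qed

section \<open>Stacked rows and diagonal scalings\<close>

lemma sum_lessThan_add:
  fixes f :: "nat \<Rightarrow> real"
  shows "(\<Sum>a<r + s. f a) = (\<Sum>a<r. f a) + (\<Sum>a<s. f (r + a))"
  by (induct s) auto

lemma append_rows_index:
  assumes "A \<in> carrier_mat r n" "B \<in> carrier_mat s n" "i < r + s" "j < n"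
  shows "(A @\<^sub>r B) $$ (i, j) = (if i < r then A $$ (i, j) else B $$ (i - r, j))"
  using assms by (auto simp: append_rows_def)

lemma frobenius_append_rows:
  assumes A: "A \<in> carrier_mat r n" and B: "B \<in> carrier_mat s n"
  shows "(frobenius_norm (A @\<^sub>r B))\<^sup>2 = (frobenius_norm A)\<^sup>2 + (frobenius_norm B)\<^sup>2"
proof -
  have "A @\<^sub>r B \<in> carrier_mat (r + s) n" by (rule carrier_append_rows[OF A B])
  then have "(frobenius_norm (A @\<^sub>r B))\<^sup>2 = (\<Sum>i<r + s. \<Sum>j<n. ((A @\<^sub>r B) $$ (i, j))\<^sup>2)"
    by (simp add: frobenius_norm_sq)
  also have "\<dots> = (\<Sum>i<r. \<Sum>j<n. (A $$ (i, j))\<^sup>2) + (\<Sum>i<s. \<Sum>j<n. (B $$ (i, j))\<^sup>2)"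
    unfolding sum_lessThan_add
    by (intro arg_cong2[where f = "(+)"] sum.cong refl) (simp_all add: append_rows_index[OF A B])
  finally show ?thesis using A B by (simp add: frobenius_norm_sq)
qed

lemma append_rows_transpose_mult:
  fixes A B C D :: "real mat"
  assumes A: "A \<in> carrier_mat r n" and B: "B \<in> carrier_mat s n"
    and C: "C \<in> carrier_mat r k" and D: "D \<in> carrier_mat s k"
  shows "(A @\<^sub>r B)\<^sup>T * (C @\<^sub>r D) = A\<^sup>T * C + B\<^sup>T * D"
proof (rule eq_matI)
  have AB: "A @\<^sub>r B \<in> carrier_mat (r + s) n" by (rule carrier_append_rows[OF A B])
  have CD: "C @\<^sub>r D \<in> carrier_mat (r + s) k" by (rule carrier_append_rows[OF C D])
  show "dim_row ((A @\<^sub>r B)\<^sup>T * (C @\<^sub>r D)) = dim_row (A\<^sup>T * C + B\<^sup>T * D)"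
    "dim_col ((A @\<^sub>r B)\<^sup>T * (C @\<^sub>r D)) = dim_col (A\<^sup>T * C + B\<^sup>T * D)"
    using AB CD B D by auto
  fix i j assume "i < dim_row (A\<^sup>T * C + B\<^sup>T * D)" "j < dim_col (A\<^sup>T * C + B\<^sup>T * D)"
  then have ij: "i < n" "j < k" using B D by auto
  have T: "P\<^sup>T $$ (i, a) = P $$ (a, i)" if "P \<in> carrier_mat l n" "a < l" for P :: "real mat" and l a
    using that ij by auto
  have "((A @\<^sub>r B)\<^sup>T * (C @\<^sub>r D)) $$ (i, j) = (\<Sum>a<r + s. (A @\<^sub>r B)\<^sup>T $$ (i, a) * (C @\<^sub>r D) $$ (a, j))"
    by (rule index_mult_mat_sum) (use AB CD ij in auto)
  also have "\<dots> = (\<Sum>a<r + s. (A @\<^sub>r B) $$ (a, i) * (C @\<^sub>r D) $$ (a, j))"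
    by (intro sum.cong refl) (simp add: T[OF AB])
  also have "\<dots> = (\<Sum>a<r. A $$ (a, i) * C $$ (a, j)) + (\<Sum>a<s. B $$ (a, i) * D $$ (a, j))"
    unfolding sum_lessThan_add using ij
    by (intro arg_cong2[where f = "(+)"] sum.cong refl)
      (simp_all add: append_rows_index[OF A B] append_rows_index[OF C D])
  also have "(\<Sum>a<r. A $$ (a, i) * C $$ (a, j)) = (A\<^sup>T * C) $$ (i, j)"
    by (subst index_mult_mat_sum[of _ n r _ k]) (use A C ij T[OF A] in auto)
  also have "(\<Sum>a<s. B $$ (a, i) * D $$ (a, j)) = (B\<^sup>T * D) $$ (i, j)"
    by (subst index_mult_mat_sum[of _ n s _ k]) (use B D ij T[OF B] in auto)
  finally show "((A @\<^sub>r B)\<^sup>T * (C @\<^sub>r D)) $$ (i, j) = (A\<^sup>T * C + B\<^sup>T * D) $$ (i, j)"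
    using A B C D ij by simp
qed

lemma diagonal_mult_index:
  fixes S T :: "real mat"
  assumes S: "S \<in> carrier_mat p p" "diagonal_mat S" and T: "T \<in> carrier_mat p d" and "a < p" "i < d"
  shows "(S * T) $$ (a, i) = S $$ (a, a) * T $$ (a, i)"
proof -
  have "(S * T) $$ (a, i) = (\<Sum>b<p. S $$ (a, b) * T $$ (b, i))"
    by (rule index_mult_mat_sum[OF S(1) T assms(4,5)])
  also have "\<dots> = (\<Sum>b<p. if b = a then S $$ (a, a) * T $$ (a, i) else 0)"
    using S assms(4) by (intro sum.cong refl) (auto simp: diagonal_mat_def)
  finally show ?thesis using assms(4) by simp
qed

lemma orthonormal_cols_bessel:
  assumes "orthonormal_cols Z" "Z \<in> carrier_mat d r"
  shows "bessel d r (\<lambda>a i. Z $$ (i, a))"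
  by (rule bessel_orthogonal[where b = "\<lambda>_. True"]) (simp add: orthonormal_cols_ip[OF assms])

lemma orthonormal_cols_mult:
  assumes Z: "orthonormal_cols Z" "Z \<in> carrier_mat d r" and U: "orthonormal_cols U" "U \<in> carrier_mat r s"
  shows "orthonormal_cols (Z * U)"
proof -
  have "(Z * U)\<^sup>T * (Z * U) = U\<^sup>T * (Z\<^sup>T * Z) * U"
    using Z(2) U(2) by (simp add: transpose_mult[of Z d r] assoc_mult_mat[of _ s r _ d _ s]
        assoc_mult_mat[of _ s r _ r _ s] assoc_mult_mat[of _ r d _ r _ s])
  also have "\<dots> = 1\<^sub>m s" using Z U by (simp add: orthonormal_cols_def)
  finally show ?thesis using U(2) by (simp add: orthonormal_cols_def)
qed

lemma usv_index:
  fixes W S H :: "real mat"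
  assumes W: "W \<in> carrier_mat d1 p" and S: "S \<in> carrier_mat p p" "diagonal_mat S"
    and H: "H \<in> carrier_mat d2 p" and il: "i < d1" "l < d2"
  shows "(W * S * H\<^sup>T) $$ (i, l) = (\<Sum>a<p. S $$ (a, a) * W $$ (i, a) * H $$ (l, a))"
proof -
  have HT: "H\<^sup>T \<in> carrier_mat p d2" using H by simp
  have SH: "S * H\<^sup>T \<in> carrier_mat p d2" using S H by simp
  have "W * S * H\<^sup>T = W * (S * H\<^sup>T)" by (rule assoc_mult_mat[OF W S(1) HT])
  then have "(W * S * H\<^sup>T) $$ (i, l) = (\<Sum>a<p. W $$ (i, a) * (S * H\<^sup>T) $$ (a, l))"
    by (simp only: index_mult_mat_sum[OF W SH il])
  also have "\<dots> = (\<Sum>a<p. S $$ (a, a) * W $$ (i, a) * H $$ (l, a))"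
    using H il by (intro sum.cong refl) (simp add: diagonal_mult_index[OF S HT] del: index_mult_mat)
  finally show ?thesis .
qed

text \<open>Orthonormality isolates \<open>s a\<close> as the pairing of \<open>A\<close> and
  \<open>B\<close> on the \<open>a\<close>-th vectors, and \<open>bessel_trace_le\<close> bounds the
  sum. This bounds the trace of a given factorization without identifying its entries with
  \<open>sigma\<close>.\<close>

lemma sum_singular_le_frobenius:
  assumes W: "orthonormal_cols W" "W \<in> carrier_mat d1 p" and H: "orthonormal_cols H" "H \<in> carrier_mat d2 p"
    and A: "A \<in> carrier_mat r d1" and B: "B \<in> carrier_mat r d2"
    and e: "\<And>i l. i < d1 \<Longrightarrow> l < d2 \<Longrightarrow> (A\<^sup>T * B) $$ (i, l) = (\<Sum>a<p. s a * W $$ (i, a) * H $$ (l, a))"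
  shows "(\<Sum>a<p. s a) \<le> frobenius_norm A * frobenius_norm B"
proof -
  let ?w = "\<lambda>a i. W $$ (i, a)" and ?h = "\<lambda>a i. H $$ (i, a)"
  have AB: "A\<^sup>T * B \<in> carrier_mat d1 d2" using A B by simp
  have "s a = ip r (mv A (?w a)) (mv B (?h a))" if a: "a < p" for a
  proof -
    have "ip d1 (?w a) (mv (A\<^sup>T * B) (?h a)) = (\<Sum>b<p. s b * ip d1 (?w a) (?w b) * ip d2 (?h a) (?h b))"
      by (rule bilinear_svd[OF AB e])
    also have "\<dots> = (\<Sum>b<p. if b = a then s a else 0)"
      using a by (intro sum.cong refl) (auto simp: orthonormal_cols_ip[OF W] orthonormal_cols_ip[OF H])
    also have "\<dots> = s a" using a by simp
    finally show ?thesis unfolding ip_mv_transpose_mult[OF A B] by simp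
  qed
  then have "(\<Sum>a<p. s a) = (\<Sum>a<p. ip r (mv A (?w a)) (mv B (?h a)))" by simp
  also have "\<dots> \<le> frobenius_norm A * frobenius_norm B"
    by (rule bessel_trace_le[OF A B orthonormal_cols_bessel[OF W] orthonormal_cols_bessel[OF H]])
  finally show ?thesis .
qed

lemma frobenius_scaled_orthonormal:
  assumes W: "orthonormal_cols W" "W \<in> carrier_mat d p" and s: "\<And>a. a < p \<Longrightarrow> 0 \<le> s a"
    and X: "X \<in> carrier_mat p d" "\<And>a i. a < p \<Longrightarrow> i < d \<Longrightarrow> X $$ (a, i) = sqrt (s a) * W $$ (i, a)"
  shows "(frobenius_norm X)\<^sup>2 = (\<Sum>a<p. s a)"
proof -
  have "(frobenius_norm X)\<^sup>2 = (\<Sum>a<p. \<Sum>i<d. s a * (W $$ (i, a))\<^sup>2)"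
    using X s by (simp add: frobenius_norm_sq power_mult_distrib)
  also have "\<dots> = (\<Sum>a<p. s a * ip d (\<lambda>i. W $$ (i, a)) (\<lambda>i. W $$ (i, a)))"
    by (simp add: ip_self sum_distrib_left)
  finally show ?thesis by (simp add: orthonormal_cols_ip[OF W])
qed

lemma transpose_mult_scaled:
  assumes s: "\<And>a. a < p \<Longrightarrow> 0 \<le> s a"
    and X: "X \<in> carrier_mat p d1" "\<And>a i. a < p \<Longrightarrow> i < d1 \<Longrightarrow> X $$ (a, i) = sqrt (s a) * W $$ (i, a)"
    and Y: "Y \<in> carrier_mat p d2" "\<And>a i. a < p \<Longrightarrow> i < d2 \<Longrightarrow> Y $$ (a, i) = sqrt (s a) * H $$ (i, a)"
    and il: "i < d1" "l < d2"
  shows "(X\<^sup>T * Y) $$ (i, l) = (\<Sum>a<p. s a * W $$ (i, a) * H $$ (l, a))"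
proof -
  have "(X\<^sup>T * Y) $$ (i, l) = (\<Sum>a<p. X $$ (a, i) * Y $$ (a, l))"
    by (subst index_mult_mat_sum[of _ d1 p _ d2]) (use X Y il in auto)
  also have "\<dots> = (\<Sum>a<p. s a * W $$ (i, a) * H $$ (l, a))"
  proof (intro sum.cong refl)
    fix a assume "a \<in> {..<p}"
    then have "X $$ (a, i) * Y $$ (a, l) = (sqrt (s a) * sqrt (s a)) * (W $$ (i, a) * H $$ (l, a))"
      using X Y il by simp
    then show "X $$ (a, i) * Y $$ (a, l) = s a * W $$ (i, a) * H $$ (l, a)"
      using s \<open>a \<in> {..<p}\<close> by simp
  qed
  finally show ?thesis .
qed


section \<open>Thin decompositions and the two phases of an update\<close>

lemma thin_svdD:
  assumes "thin_svd M U S V" "M \<in> carrier_mat r d" "r \<le> d"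
  shows "U \<in> carrier_mat r r" "S \<in> carrier_mat r r" "V \<in> carrier_mat d r"
    "orthonormal_cols U" "orthonormal_cols V" "diagonal_mat S" "M = U * S * V\<^sup>T"
    "\<And>i. i < r \<Longrightarrow> 0 \<le> S $$ (i, i)"
    "\<And>i j. i \<le> j \<Longrightarrow> j < r \<Longrightarrow> S $$ (j, j) \<le> S $$ (i, i)"
  using assms unfolding thin_svd_def Let_def by auto

lemma diagonal_mat_transpose:
  fixes S :: "real mat"
  assumes "S \<in> carrier_mat n n" "diagonal_mat S"
  shows "S\<^sup>T = S"
  using assms by (intro eq_matI) (auto simp: diagonal_mat_def, metis)

text \<open>\<open>M\<^sup>T * M\<close> is similar to the diagonal matrix \<open>S * S\<close>, so
  its eigenvalues can be read off. The merge shrinks by \<open>sigma m\<close>, which this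
  identifies with a diagonal entry of \<open>S\<close>.\<close>

lemma sigma_thin_svd:
  assumes svd: "thin_svd M U S V" and M: "M \<in> carrier_mat n n" and j: "j < n"
  shows "sigma (Suc j) M = S $$ (j, j)"
proof -
  note D = thin_svdD[OF svd M order_refl]
  note U = D(1) and S = D(2) and V = D(3)
  have UU: "U\<^sup>T * U = 1\<^sub>m n" and VV: "V\<^sup>T * V = 1\<^sub>m n"
    using D(4,5) U V by (auto simp: orthonormal_cols_def)
  have VV': "V * V\<^sup>T = 1\<^sub>m n" using mat_mult_left_right_inverse[OF _ V VV] V by simp
  have ST: "S\<^sup>T = S" by (rule diagonal_mat_transpose[OF S D(6)])
  have UT: "U\<^sup>T \<in> carrier_mat n n" and VT: "V\<^sup>T \<in> carrier_mat n n" using U V by auto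
  have SS: "S * S \<in> carrier_mat n n" using S by simp
  have "M\<^sup>T = V * (S * U\<^sup>T)"
    unfolding D(7) using U S V ST by (simp add: transpose_mult[of _ n n _ n])
  then have "M\<^sup>T * M = V * (S * U\<^sup>T) * (U * S * V\<^sup>T)" using D(7) by simp
  also have "\<dots> = V * (S * (U\<^sup>T * U) * S) * V\<^sup>T"
    using U S V UT VT by (simp add: assoc_mult_mat[of _ n n _ n _ n])
  finally have MM: "M\<^sup>T * M = V * (S * S) * V\<^sup>T" using S UU by simp
  have "similar_mat_wit (M\<^sup>T * M) (S * S) V (V\<^sup>T)"
    by (rule similar_mat_witI[of _ _ n]) (use M V VT SS VV VV' MM in auto)
  then have cp: "char_poly (M\<^sup>T * M) = char_poly (S * S)"
    by (intro char_poly_similar) (auto simp: similar_mat_def)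
  have SSi: "(S * S) $$ (a, b) = (if a = b then (S $$ (a, a))\<^sup>2 else 0)" if "a < n" "b < n" for a b
    using diagonal_mult_index[OF S D(6) S that] that D(6) S
    by (auto simp: power2_eq_square diagonal_mat_def)
  have "upper_triangular (S * S)" unfolding upper_triangular_def using SS SSi by auto
  from char_poly_upper_triangular[OF SS this]
  have "char_poly (M\<^sup>T * M) = (\<Prod>a\<leftarrow>diag_mat (S * S). [:- a, 1:])" unfolding cp .
  moreover have "diag_mat (S * S) = map (\<lambda>a. (S $$ (a, a))\<^sup>2) [0..<n]"
    using SS by (auto simp: diag_mat_def SSi intro!: nth_equalityI simp del: index_mult_mat)
  ultimately have c: "char_poly (M\<^sup>T * M) = (\<Prod>a\<leftarrow>map (\<lambda>a. (S $$ (a, a))\<^sup>2) [0..<n]. [:- a, 1:])"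
    by simp
  have srt: "sorted (rev (map (\<lambda>a. (S $$ (a, a))\<^sup>2) [0..<n]))"
    unfolding sorted_rev_iff_nth_mono using D(8,9) by (auto intro!: power_mono)
  have "singular_values M = map sqrt (map (\<lambda>a. (S $$ (a, a))\<^sup>2) [0..<n])"
    by (rule singular_values_eqI[OF c srt])
  then show ?thesis using j D(8)[OF j] by (simp add: sigma_Suc[OF M])
qed

lemma frobenius_mult_orthonormal_le:
  assumes X: "X \<in> carrier_mat r d" and Z: "orthonormal_cols Z" "Z \<in> carrier_mat d k"
  shows "frobenius_norm (X * Z) \<le> frobenius_norm X"
proof -
  have "(frobenius_norm (X * Z))\<^sup>2 = (\<Sum>i<r. \<Sum>a<k. (mv X (\<lambda>l. Z $$ (l, a)) i)\<^sup>2)"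
    using X mult_carrier_mat[OF X Z(2)]
    by (simp add: frobenius_norm_sq mv_def index_mult_mat_sum[OF X Z(2)] del: index_mult_mat)
  also have "\<dots> = (\<Sum>a<k. ip r (mv X (\<lambda>l. Z $$ (l, a))) (mv X (\<lambda>l. Z $$ (l, a))))"
    unfolding ip_self by (rule sum.swap)
  also have "\<dots> \<le> (frobenius_norm X)\<^sup>2"
    by (rule bessel_frobenius[OF X orthonormal_cols_bessel[OF Z]])
  finally show ?thesis by (rule power2_le_imp_le) (rule frobenius_norm_nonneg)
qed

text \<open>With \<open>W = Z * U\<close> the projected product is \<open>W * S * V\<^sup>T\<close>,
  and each sketch carries one square root of \<open>S\<close>. Both therefore have squared Frobenius
  norm equal to the trace of \<open>S\<close>, which is at most the product of the norms of
  \<open>X' * Z\<close> and \<open>Y'\<close>.\<close>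

lemma scod_compress_props:
  assumes X: "X' \<in> carrier_mat r d1" and Y: "Y' \<in> carrier_mat r d2"
    and G: "G \<in> carrier_mat d2 m" and m: "m \<le> d2"
    and comp: "scod_compress m q G X' Y' Xt Yt"
  obtains Z where "spm (X'\<^sup>T * Y') q G Z"
    "Xt \<in> carrier_mat m d1" "Yt \<in> carrier_mat m d2"
    "Xt\<^sup>T * Yt = Z * Z\<^sup>T * (X'\<^sup>T * Y')"
    "frobenius_norm Xt = frobenius_norm Yt"
    "(frobenius_norm Xt)\<^sup>2 \<le> frobenius_norm X' * frobenius_norm Y'"
proof -
  define M where "M = X'\<^sup>T * Y'"
  have M: "M \<in> carrier_mat d1 d2" unfolding M_def using X Y by simp
  obtain Z U S V where spm: "spm M q G Z" and svd: "thin_svd (Z\<^sup>T * X'\<^sup>T * Y') U S V"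
    and Xt: "Xt = (map_mat sqrt S * U\<^sup>T * Z\<^sup>T) @\<^sub>r 0\<^sub>m (m - dim_col Z) (dim_col X')"
    and Yt: "Yt = (map_mat sqrt S * V\<^sup>T) @\<^sub>r 0\<^sub>m (m - dim_col Z) (dim_col Y')"
    using comp unfolding scod_compress_def M_def by blast
  obtain k where k: "dim_col Z = k" by blast
  have km: "k \<le> m" using spm_dim_col_le[OF spm M G] k by simp
  have Z: "Z \<in> carrier_mat d1 k" and oZ: "orthonormal_cols Z"
    using spm M k unfolding spm_def Let_def by auto
  have ZT: "Z\<^sup>T \<in> carrier_mat k d1" and XT: "X'\<^sup>T \<in> carrier_mat d1 r" using Z X by auto
  have N: "Z\<^sup>T * X'\<^sup>T * Y' \<in> carrier_mat k d2" using ZT XT Y by auto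
  have kd: "k \<le> d2" using km m by simp
  note D = thin_svdD[OF svd N kd]
  note U = D(1) and S = D(2) and V = D(3)
  define W where "W = Z * U"
  have W: "W \<in> carrier_mat d1 k" unfolding W_def using Z U by simp
  have oW: "orthonormal_cols W" unfolding W_def by (rule orthonormal_cols_mult[OF oZ Z D(4) U])
  define s where "s a = S $$ (a, a)" for a
  have s: "0 \<le> s a" if "a < k" for a unfolding s_def by (rule D(8)[OF that])
  define s' where "s' a = (if a < k then s a else 0)" for a
  have s': "0 \<le> s' a" for a using s by (simp add: s'_def)
  have sq: "map_mat sqrt S \<in> carrier_mat k k" "diagonal_mat (map_mat sqrt S)"
    using S D(6) by (auto simp: diagonal_mat_def)
  have WT: "W\<^sup>T \<in> carrier_mat k d1" and VT: "V\<^sup>T \<in> carrier_mat k d2"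
    and UT: "U\<^sup>T \<in> carrier_mat k k" using W V U by auto
  have Xe: "map_mat sqrt S * U\<^sup>T * Z\<^sup>T = map_mat sqrt S * W\<^sup>T"
    unfolding W_def transpose_mult[OF Z U] by (rule assoc_mult_mat[OF sq(1) UT ZT])
  have X0: "map_mat sqrt S * W\<^sup>T \<in> carrier_mat k d1" using sq WT by auto
  have Y0: "map_mat sqrt S * V\<^sup>T \<in> carrier_mat k d2" using sq VT by auto
  have Xt': "Xt = (map_mat sqrt S * W\<^sup>T) @\<^sub>r 0\<^sub>m (m - k) d1" unfolding Xt Xe k using X by simp
  have Yt': "Yt = (map_mat sqrt S * V\<^sup>T) @\<^sub>r 0\<^sub>m (m - k) d2" unfolding Yt k using Y by simp
  have kk: "k + (m - k) = m" using km by simp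
  have Xc: "Xt \<in> carrier_mat m d1" and Yc: "Yt \<in> carrier_mat m d2"
    using carrier_append_rows[OF X0, of "0\<^sub>m (m - k) d1" "m - k"]
      carrier_append_rows[OF Y0, of "0\<^sub>m (m - k) d2" "m - k"] unfolding Xt' Yt' kk by auto
  have X0i: "(map_mat sqrt S * W\<^sup>T) $$ (a, i) = sqrt (s a) * W $$ (i, a)" if "a < k" "i < d1" for a i
    using diagonal_mult_index[OF sq WT that] that W S by (simp add: s_def del: index_mult_mat)
  have Y0i: "(map_mat sqrt S * V\<^sup>T) $$ (a, i) = sqrt (s a) * V $$ (i, a)" if "a < k" "i < d2" for a i
    using diagonal_mult_index[OF sq VT that] that V S by (simp add: s_def del: index_mult_mat)
  have fX: "(frobenius_norm Xt)\<^sup>2 = (\<Sum>a<k. s a)"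
    unfolding Xt' frobenius_append_rows[OF X0 zero_carrier_mat]
    using frobenius_scaled_orthonormal[OF oW W s X0 X0i] by (simp add: frobenius_norm_sq)
  have fY: "(frobenius_norm Yt)\<^sup>2 = (\<Sum>a<k. s a)"
    unfolding Yt' frobenius_append_rows[OF Y0 zero_carrier_mat]
    using frobenius_scaled_orthonormal[OF D(5) V s Y0 Y0i] by (simp add: frobenius_norm_sq)
  have ZZM: "Z * Z\<^sup>T * M = W * S * V\<^sup>T"
  proof -
    have "Z * Z\<^sup>T * M = Z * (Z\<^sup>T * X'\<^sup>T * Y')"
      unfolding M_def using Z ZT XT Y
      by (simp add: assoc_mult_mat[of _ d1 k _ d1 _ d2] assoc_mult_mat[of _ k d1 _ r _ d2])
    also have "\<dots> = Z * (U * S * V\<^sup>T)" using D(7) by simp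
    also have "\<dots> = W * S * V\<^sup>T" unfolding W_def using Z U S VT
      by (simp add: assoc_mult_mat[of _ d1 k _ k _ k] assoc_mult_mat[of _ d1 k _ k _ d2]
          assoc_mult_mat[of _ k k _ k _ d2])
    finally show ?thesis .
  qed
  have XY: "Xt\<^sup>T * Yt = Z * Z\<^sup>T * M"
  proof (rule eq_matI)
    fix i l assume "i < dim_row (Z * Z\<^sup>T * M)" "l < dim_col (Z * Z\<^sup>T * M)"
    then have il: "i < d1" "l < d2" using Z M by auto
    have "Xt\<^sup>T * Yt = (map_mat sqrt S * W\<^sup>T)\<^sup>T * (map_mat sqrt S * V\<^sup>T) +
        (0\<^sub>m (m - k) d1)\<^sup>T * 0\<^sub>m (m - k) d2"
      unfolding Xt' Yt' by (rule append_rows_transpose_mult[OF X0 zero_carrier_mat Y0 zero_carrier_mat])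
    also have "\<dots> = (map_mat sqrt S * W\<^sup>T)\<^sup>T * (map_mat sqrt S * V\<^sup>T)"
      by (rule eq_matI) (use X0 Y0 W V in \<open>auto simp: scalar_prod_def\<close>)
    finally have "(Xt\<^sup>T * Yt) $$ (i, l) = (\<Sum>a<k. s a * W $$ (i, a) * V $$ (l, a))"
      by (simp only: transpose_mult_scaled[OF s X0 X0i Y0 Y0i il])
    also have "\<dots> = (Z * Z\<^sup>T * M) $$ (i, l)"
      unfolding ZZM usv_index[OF W S D(6) V il] s_def ..
    finally show "(Xt\<^sup>T * Yt) $$ (i, l) = (Z * Z\<^sup>T * M) $$ (i, l)" .
  qed (use Xc Yc Z M in auto)
  have "(\<Sum>a<k. s a) \<le> frobenius_norm (X' * Z) * frobenius_norm Y'"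
  proof (rule sum_singular_le_frobenius[OF D(4) U D(5) V])
    show "X' * Z \<in> carrier_mat r k" using X Z by simp
    show "Y' \<in> carrier_mat r d2" by (rule Y)
    fix i l assume "i < k" "l < d2"
    then show "((X' * Z)\<^sup>T * Y') $$ (i, l) = (\<Sum>a<k. s a * U $$ (i, a) * V $$ (l, a))"
      unfolding transpose_mult[OF X Z] D(7) s_def by (rule usv_index[OF U S D(6) V])
  qed
  also have "\<dots> \<le> frobenius_norm X' * frobenius_norm Y'"
    by (intro mult_right_mono frobenius_mult_orthonormal_le[OF X oZ Z] frobenius_norm_nonneg)
  finally have le: "(frobenius_norm Xt)\<^sup>2 \<le> frobenius_norm X' * frobenius_norm Y'" using fX by simp
  have eq: "frobenius_norm Xt = frobenius_norm Yt"
    using fX fY frobenius_norm_nonneg by (metis power2_eq_imp_eq)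
  show ?thesis using that[of Z] spm Xc Yc XY eq le unfolding M_def by blast
qed

text \<open>The stacked product is \<open>W * S * H\<^sup>T\<close> with \<open>2 * m\<close>
  diagonal values. Merging keeps the first \<open>m\<close> lowered by \<gamma>; the part removed
  has coefficients at most \<gamma>, which bounds the error, and the lowering takes
  \<open>m * \<gamma>\<close> off a trace that is at most the sum of the squared norms.\<close>

lemma scod_merge_props:
  assumes m: "0 < m" "2 * m \<le> d1" "2 * m \<le> d2"
    and A: "A \<in> carrier_mat m d1" and B: "B \<in> carrier_mat m d2"
    and Xt: "Xt \<in> carrier_mat m d1" and Yt: "Yt \<in> carrier_mat m d2"
    and fAB: "frobenius_norm A = frobenius_norm B" and fXY: "frobenius_norm Xt = frobenius_norm Yt"
    and merge: "scod_merge m A B Xt Yt A' B'"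
  obtains \<gamma> where "0 \<le> \<gamma>" "A' \<in> carrier_mat m d1" "B' \<in> carrier_mat m d2"
    "frobenius_norm A' = frobenius_norm B'"
    "(frobenius_norm A')\<^sup>2 + real m * \<gamma> \<le> (frobenius_norm A)\<^sup>2 + (frobenius_norm Xt)\<^sup>2"
    "spectral_norm (A\<^sup>T * B + Xt\<^sup>T * Yt - A'\<^sup>T * B') \<le> \<gamma>"
proof -
  let ?n = "2 * m"
  define P where "P = A @\<^sub>r Xt"
  define Q where "Q = B @\<^sub>r Yt"
  have P: "P \<in> carrier_mat ?n d1" and Q: "Q \<in> carrier_mat ?n d2"
    unfolding P_def Q_def using carrier_append_rows[OF A Xt] carrier_append_rows[OF B Yt]
    by (simp_all add: mult_2)
  have PQ: "P\<^sup>T * Q = A\<^sup>T * B + Xt\<^sup>T * Yt"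
    unfolding P_def Q_def by (rule append_rows_transpose_mult[OF A Xt B Yt])
  obtain Qx Rx Qy Ry U S V where qx: "reduced_qr (P\<^sup>T) Qx Rx" and qy: "reduced_qr (Q\<^sup>T) Qy Ry"
    and svd: "thin_svd (Rx * Ry\<^sup>T) U S V"
    and A'0: "A' = map_mat sqrt (map_mat (\<lambda>x. max x 0)
        (Matrix.mat m m (\<lambda>(i, j). S $$ (i, j)) - sigma m (Rx * Ry\<^sup>T) \<cdot>\<^sub>m 1\<^sub>m m)) *
        (Matrix.mat ?n m (\<lambda>(i, j). U $$ (i, j)))\<^sup>T * Qx\<^sup>T"
    and B'0: "B' = map_mat sqrt (map_mat (\<lambda>x. max x 0)
        (Matrix.mat m m (\<lambda>(i, j). S $$ (i, j)) - sigma m (Rx * Ry\<^sup>T) \<cdot>\<^sub>m 1\<^sub>m m)) *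
        (Matrix.mat ?n m (\<lambda>(i, j). V $$ (i, j)))\<^sup>T * Qy\<^sup>T"
    using merge unfolding scod_merge_def P_def Q_def Let_def by blast
  have Qx: "Qx \<in> carrier_mat d1 ?n" and Rx: "Rx \<in> carrier_mat ?n ?n" and oQx: "orthonormal_cols Qx"
    and Pe: "P\<^sup>T = Qx * Rx"
    using qx P unfolding reduced_qr_def by auto
  have Qy: "Qy \<in> carrier_mat d2 ?n" and Ry: "Ry \<in> carrier_mat ?n ?n" and oQy: "orthonormal_cols Qy"
    and Qe: "Q\<^sup>T = Qy * Ry"
    using qy Q unfolding reduced_qr_def by auto
  have RR: "Rx * Ry\<^sup>T \<in> carrier_mat ?n ?n" using Rx Ry by simp
  note D = thin_svdD[OF svd RR order_refl]
  note U = D(1) and S = D(2) and V = D(3)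
  define s where "s a = S $$ (a, a)" for a
  \<comment> \<open>The \<open>m\<close>-th largest value stands at the 0-based diagonal index
    \<open>m - 1\<close>.\<close>
  define \<gamma> where "\<gamma> = s (m - 1)"
  have sig: "sigma m (Rx * Ry\<^sup>T) = \<gamma>"
    using sigma_thin_svd[OF svd RR, of "m - 1"] m by (simp add: \<gamma>_def s_def)
  have \<gamma>0: "0 \<le> \<gamma>" unfolding \<gamma>_def s_def by (rule D(8)) (use m in auto)
  have s_ge: "\<gamma> \<le> s a" if "a < m" for a unfolding \<gamma>_def s_def by (rule D(9)) (use that m in auto)
  have s_le: "s a \<le> \<gamma>" if "m \<le> a" "a < ?n" for a
    unfolding \<gamma>_def s_def by (rule D(9)) (use that m in auto)
  have s0: "0 \<le> s a" if "a < ?n" for a unfolding s_def by (rule D(8)[OF that])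
  define W where "W = Qx * U"
  define H where "H = Qy * V"
  have W: "W \<in> carrier_mat d1 ?n" and H: "H \<in> carrier_mat d2 ?n"
    unfolding W_def H_def using Qx Qy U V by auto
  have oW: "orthonormal_cols W" unfolding W_def by (rule orthonormal_cols_mult[OF oQx Qx D(4) U])
  have oH: "orthonormal_cols H" unfolding H_def by (rule orthonormal_cols_mult[OF oQy Qy D(5) V])
  have C: "(P\<^sup>T * Q) $$ (i, l) = (\<Sum>a<?n. s a * W $$ (i, a) * H $$ (l, a))" if "i < d1" "l < d2" for i l
  proof -
    have QT: "Qy\<^sup>T \<in> carrier_mat ?n d2" and VT: "V\<^sup>T \<in> carrier_mat ?n ?n"
      and RT: "Ry\<^sup>T \<in> carrier_mat ?n ?n" using Qy V Ry by auto
    have "Q = (Qy * Ry)\<^sup>T" using Qe by (metis transpose_transpose)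
    then have Q': "Q = Ry\<^sup>T * Qy\<^sup>T" by (simp only: transpose_mult[OF Qy Ry])
    have "P\<^sup>T * Q = Qx * (Rx * Ry\<^sup>T) * Qy\<^sup>T"
      unfolding Pe unfolding Q' using Qx Rx RT QT
      by (simp add: assoc_mult_mat[of _ d1 ?n _ ?n _ ?n] assoc_mult_mat[of _ d1 ?n _ ?n _ d2]
          assoc_mult_mat[of _ ?n ?n _ ?n _ d2])
    also have "\<dots> = Qx * (U * S * V\<^sup>T) * Qy\<^sup>T" using D(7) by simp
    also have "\<dots> = W * S * (V\<^sup>T * Qy\<^sup>T)"
      unfolding W_def using Qx U S VT QT
      by (simp add: assoc_mult_mat[of _ d1 ?n _ ?n _ ?n] assoc_mult_mat[of _ d1 ?n _ ?n _ d2]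
          assoc_mult_mat[of _ ?n ?n _ ?n _ d2] assoc_mult_mat[of _ ?n ?n _ ?n _ ?n])
    also have "V\<^sup>T * Qy\<^sup>T = H\<^sup>T" unfolding H_def by (rule transpose_mult[OF Qy V, symmetric])
    finally show ?thesis unfolding s_def by (simp only: usv_index[OF W S D(6) H that])
  qed
  define t where "t a = s a - \<gamma>" for a
  have t0: "0 \<le> t a" if "a < m" for a using s_ge[OF that] by (simp add: t_def)
  define Sh where "Sh = map_mat sqrt (map_mat (\<lambda>x. max x 0)
        (Matrix.mat m m (\<lambda>(i, j). S $$ (i, j)) - sigma m (Rx * Ry\<^sup>T) \<cdot>\<^sub>m 1\<^sub>m m))"
  have Sh: "Sh \<in> carrier_mat m m" unfolding Sh_def by (simp add: minus_carrier_mat)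
  have Shi: "Sh $$ (a, b) = (if a = b then sqrt (t a) else 0)" if "a < m" "b < m" for a b
    using that t0[OF that(1)] D(6) S unfolding Sh_def sig
    by (auto simp: t_def s_def diagonal_mat_def)
  have Shd: "diagonal_mat Sh" unfolding diagonal_mat_def using Sh Shi by auto
  \<comment> \<open>Shared by \<open>A'\<close> and \<open>B'\<close>: cutting \<open>T\<close> to
    its first \<open>m\<close> columns cuts \<open>Qz * T\<close> to its first \<open>m\<close>
    columns, so the new rows are scaled columns of \<open>W\<close> or \<open>H\<close>.\<close>
  have scaled: "R \<in> carrier_mat m d \<and> (\<forall>a<m. \<forall>i<d. R $$ (a, i) = sqrt (t a) * (Qz * T) $$ (i, a))"
    if Qz: "Qz \<in> carrier_mat d ?n" and T: "T \<in> carrier_mat ?n ?n"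
      and R: "R = Sh * (Matrix.mat ?n m (\<lambda>(i, j). T $$ (i, j)))\<^sup>T * Qz\<^sup>T" for R Qz T d
  proof -
    let ?T = "Matrix.mat ?n m (\<lambda>(i, j). T $$ (i, j))"
    have T': "?T \<in> carrier_mat ?n m" "?T\<^sup>T \<in> carrier_mat m ?n" by auto
    have QT: "Qz\<^sup>T \<in> carrier_mat ?n d" using Qz by simp
    have QT': "(Qz * ?T)\<^sup>T \<in> carrier_mat m d" using Qz T' by simp
    have e: "R = Sh * (Qz * ?T)\<^sup>T"
      unfolding R transpose_mult[OF Qz T'(1)] by (rule assoc_mult_mat[OF Sh T'(2) QT])
    have "R $$ (a, i) = sqrt (t a) * (Qz * T) $$ (i, a)" if ai: "a < m" "i < d" for a i
    proof -
      have "R $$ (a, i) = sqrt (t a) * (Qz * ?T)\<^sup>T $$ (a, i)"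
        unfolding e using diagonal_mult_index[OF Sh Shd QT' ai] Shi ai by simp
      also have "(Qz * ?T)\<^sup>T $$ (a, i) = (Qz * ?T) $$ (i, a)" using QT' ai Qz by simp
      also have "\<dots> = (\<Sum>b<?n. Qz $$ (i, b) * ?T $$ (b, a))"
        by (rule index_mult_mat_sum[OF Qz T'(1) ai(2,1)])
      also have "\<dots> = (\<Sum>b<?n. Qz $$ (i, b) * T $$ (b, a))" using ai by simp
      also have "\<dots> = (Qz * T) $$ (i, a)"
        using ai by (intro index_mult_mat_sum[OF Qz T, symmetric]) auto
      finally show ?thesis .
    qed
    moreover have "R \<in> carrier_mat m d" unfolding e using Sh QT' by simp
    ultimately show ?thesis by blast
  qed
  have A': "A' \<in> carrier_mat m d1" and A'i: "\<And>a i. a < m \<Longrightarrow> i < d1 \<Longrightarrow> A' $$ (a, i) = sqrt (t a) * W $$ (i, a)"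
    using scaled[OF Qx U A'0[folded Sh_def]] unfolding W_def by auto
  have B': "B' \<in> carrier_mat m d2" and B'i: "\<And>a i. a < m \<Longrightarrow> i < d2 \<Longrightarrow> B' $$ (a, i) = sqrt (t a) * H $$ (i, a)"
    using scaled[OF Qy V B'0[folded Sh_def]] unfolding H_def by auto
  have ipW: "ip d1 (\<lambda>i. W $$ (i, a)) (\<lambda>i. W $$ (i, a)) = 1" if "a < m" for a
    using orthonormal_cols_ip[OF oW W, of a a] that by simp
  have ipH: "ip d2 (\<lambda>i. H $$ (i, a)) (\<lambda>i. H $$ (i, a)) = 1" if "a < m" for a
    using orthonormal_cols_ip[OF oH H, of a a] that by simp
  have fro: "(frobenius_norm R)\<^sup>2 = (\<Sum>a<m. t a)"
    if R: "R \<in> carrier_mat m d" and Ri: "\<And>a i. a < m \<Longrightarrow> i < d \<Longrightarrow> R $$ (a, i) = sqrt (t a) * K $$ (i, a)"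
      and K: "\<And>a. a < m \<Longrightarrow> ip d (\<lambda>i. K $$ (i, a)) (\<lambda>i. K $$ (i, a)) = 1" for R K d
  proof -
    have "(frobenius_norm R)\<^sup>2 = (\<Sum>a<m. \<Sum>i<d. t a * (K $$ (i, a))\<^sup>2)"
      using R Ri t0 by (simp add: frobenius_norm_sq power_mult_distrib)
    also have "\<dots> = (\<Sum>a<m. t a * ip d (\<lambda>i. K $$ (i, a)) (\<lambda>i. K $$ (i, a)))"
      by (simp add: ip_self sum_distrib_left)
    finally show ?thesis by (simp add: K)
  qed
  have fA': "(frobenius_norm A')\<^sup>2 = (\<Sum>a<m. t a)" by (rule fro[OF A' A'i ipW])
  have fB': "(frobenius_norm B')\<^sup>2 = (\<Sum>a<m. t a)" by (rule fro[OF B' B'i ipH])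
  have eq: "frobenius_norm A' = frobenius_norm B'"
    using fA' fB' frobenius_norm_nonneg by (metis power2_eq_imp_eq)
  have split: "(\<Sum>a<?n. f a) = (\<Sum>a<m. f a) + (\<Sum>a<m. f (m + a))" for f :: "nat \<Rightarrow> real"
    using sum_lessThan_add[of f m m] by (simp add: mult_2)
  \<comment> \<open>Equal norms on both sides turn the product of the stacked norms into a sum of
    squares, which makes the potential additive.\<close>
  have fP: "frobenius_norm P = frobenius_norm Q"
  proof -
    have "(frobenius_norm P)\<^sup>2 = (frobenius_norm Q)\<^sup>2"
      unfolding P_def Q_def frobenius_append_rows[OF A Xt] frobenius_append_rows[OF B Yt] fAB fXY ..
    then show ?thesis using frobenius_norm_nonneg by (metis power2_eq_imp_eq)
  qed
  have "(\<Sum>a<?n. s a) \<le> frobenius_norm P * frobenius_norm Q"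
    by (rule sum_singular_le_frobenius[OF oW W oH H P Q C])
  also have "\<dots> = (frobenius_norm A)\<^sup>2 + (frobenius_norm Xt)\<^sup>2"
    unfolding fP[symmetric] power2_eq_square[symmetric]
    unfolding P_def by (rule frobenius_append_rows[OF A Xt])
  finally have "(\<Sum>a<m. s a) \<le> (frobenius_norm A)\<^sup>2 + (frobenius_norm Xt)\<^sup>2"
    unfolding split using sum_nonneg[of "{..<m}" "\<lambda>a. s (m + a)"] s0 by force
  moreover have "(frobenius_norm A')\<^sup>2 + real m * \<gamma> = (\<Sum>a<m. s a)"
    unfolding fA' t_def by (simp add: sum_subtractf)
  ultimately have pot: "(frobenius_norm A')\<^sup>2 + real m * \<gamma> \<le> (frobenius_norm A)\<^sup>2 + (frobenius_norm Xt)\<^sup>2"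
    by simp
  \<comment> \<open>Coefficients of the residual: \<gamma> was taken from the first \<open>m\<close>
    values and the others were dropped, so none exceeds \<gamma>.\<close>
  define d where "d a = (if a < m then \<gamma> else s a)" for a
  define E where "E = P\<^sup>T * Q - A'\<^sup>T * B'"
  have E: "E \<in> carrier_mat d1 d2" unfolding E_def by (rule minus_carrier_mat) (use A' B' in auto)
  have Ei: "E $$ (i, l) = (\<Sum>a<?n. d a * W $$ (i, a) * H $$ (l, a))" if il: "i < d1" "l < d2" for i l
  proof -
    have "E $$ (i, l) = (P\<^sup>T * Q) $$ (i, l) - (A'\<^sup>T * B') $$ (i, l)"
      unfolding E_def using A' B' il by (subst index_minus_mat) auto
    also have "(A'\<^sup>T * B') $$ (i, l) = (\<Sum>a<m. t a * W $$ (i, a) * H $$ (l, a))"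
      by (rule transpose_mult_scaled[OF t0 A' A'i B' B'i il])
    finally show ?thesis unfolding C[OF il] split d_def
      by (simp add: t_def algebra_simps sum_subtractf)
  qed
  have d: "0 \<le> d a \<and> d a \<le> \<gamma>" if "a < ?n" for a
    using that \<gamma>0 s0[OF that] s_le[of a] by (auto simp: d_def)
  have "spectral_norm E \<le> \<gamma>"
  proof (rule spectral_norm_le[OF E])
    fix p q assume p: "ip d1 p p \<le> 1" and q: "ip d2 q q \<le> 1"
    let ?x = "\<lambda>a. ip d1 p (\<lambda>i. W $$ (i, a))" and ?y = "\<lambda>a. ip d2 q (\<lambda>i. H $$ (i, a))"
    have "ip d1 p (mv E q) = (\<Sum>a<?n. d a * ?x a * ?y a)"
      by (rule bilinear_svd[OF E Ei])
    also have "\<dots> \<le> (\<Sum>a<?n. \<gamma> * (((?x a)\<^sup>2 + (?y a)\<^sup>2) / 2))"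
    proof (rule sum_mono)
      fix a assume a: "a \<in> {..<?n}"
      have "0 \<le> (?x a - ?y a)\<^sup>2" by simp
      then have "?x a * ?y a \<le> ((?x a)\<^sup>2 + (?y a)\<^sup>2) / 2" by (simp add: power2_diff)
      then have "d a * (?x a * ?y a) \<le> d a * (((?x a)\<^sup>2 + (?y a)\<^sup>2) / 2)"
        using d a by (intro mult_left_mono) auto
      also have "\<dots> \<le> \<gamma> * (((?x a)\<^sup>2 + (?y a)\<^sup>2) / 2)"
        using d a by (intro mult_right_mono) auto
      finally show "d a * ?x a * ?y a \<le> \<gamma> * (((?x a)\<^sup>2 + (?y a)\<^sup>2) / 2)" by (simp add: mult_ac)
    qed
    also have "\<dots> = \<gamma> * (((\<Sum>a<?n. (?x a)\<^sup>2) + (\<Sum>a<?n. (?y a)\<^sup>2)) / 2)"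
      by (simp add: sum.distrib flip: sum_distrib_left sum_divide_distrib)
    also have "\<dots> \<le> \<gamma> * 1"
    proof (intro mult_left_mono \<gamma>0)
      have "(\<Sum>a<?n. (?x a)\<^sup>2) \<le> 1" "(\<Sum>a<?n. (?y a)\<^sup>2) \<le> 1"
        using order_trans[OF besselD[OF orthonormal_cols_bessel[OF oW W]] p]
          order_trans[OF besselD[OF orthonormal_cols_bessel[OF oH H]] q] by auto
      then show "((\<Sum>a<?n. (?x a)\<^sup>2) + (\<Sum>a<?n. (?y a)\<^sup>2)) / 2 \<le> 1" by simp
    qed
    finally show "ip d1 p (mv E q) \<le> \<gamma>" by simp
  qed
  then have "spectral_norm (A\<^sup>T * B + Xt\<^sup>T * Yt - A'\<^sup>T * B') \<le> \<gamma>" unfolding E_def PQ .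
  with \<gamma>0 A' B' eq pot show ?thesis by (rule that)
qed

section \<open>Runs of the algorithm\<close>

text \<open>The components of \<open>scod_state\<close> that do not depend on the random draws.\<close>

primrec scod_buffers ::
  "real mat \<Rightarrow> real mat \<Rightarrow> nat \<Rightarrow> nat \<Rightarrow> real mat \<times> real mat \<times> nat" where
  "scod_buffers X Y m 0 = (0\<^sub>m 0 (dim_col X), 0\<^sub>m 0 (dim_col Y), 0)"
| "scod_buffers X Y m (Suc t) =
    (case scod_buffers X Y m t of (X', Y', i) \<Rightarrow>
      let X'' = X' @\<^sub>r mat_of_row (Matrix.row X t); Y'' = Y' @\<^sub>r mat_of_row (Matrix.row Y t)
      in if scod_full m (dim_row X) (Suc t) X'' Y''
         then (0\<^sub>m 0 (dim_col X), 0\<^sub>m 0 (dim_col Y), Suc i) else (X'', Y'', i))"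

text \<open>Row \<open>t\<close>, counted from 0, is already appended: this is the buffer that the
  fullness test and the compression see, before it is emptied.\<close>

definition scod_buffer_x where
  "scod_buffer_x X Y m t = fst (scod_buffers X Y m t) @\<^sub>r mat_of_row (Matrix.row X t)"

definition scod_buffer_y where
  "scod_buffer_y X Y m t = fst (snd (scod_buffers X Y m t)) @\<^sub>r mat_of_row (Matrix.row Y t)"

definition scod_count where
  "scod_count X Y m t = snd (snd (scod_buffers X Y m t))"

definition scod_full_at where
  "scod_full_at X Y m t \<longleftrightarrow>
    scod_full m (dim_row X) (Suc t) (scod_buffer_x X Y m t) (scod_buffer_y X Y m t)"

lemma scod_buffers_Suc:
  "scod_buffers X Y m (Suc t) = (if scod_full_at X Y m t
     then (0\<^sub>m 0 (dim_col X), 0\<^sub>m 0 (dim_col Y), Suc (scod_count X Y m t))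
     else (scod_buffer_x X Y m t, scod_buffer_y X Y m t, scod_count X Y m t))"
  by (cases "scod_buffers X Y m t")
    (simp add: scod_full_at_def scod_buffer_x_def scod_buffer_y_def scod_count_def Let_def)

text \<open>Filling and emptying depend on \<open>X\<close>, \<open>Y\<close> and \<open>m\<close>
  only, never on \<open>q\<close>, \<open>G\<close>, \<open>A\<close> or \<open>B\<close>. Hence the
  products to be compressed are fixed matrices, as a bound for a Gaussian sketch of a given matrix
  requires.\<close>

lemma scod_state_buffers:
  assumes "scod_state X Y m q G t A B X' Y' i"
  shows "scod_buffers X Y m t = (X', Y', i)"
  using assms
  by induct (simp_all add: scod_buffers_Suc scod_full_at_def scod_buffer_x_def scod_buffer_y_def scod_count_def)

lemma scod_count_Suc:
  "scod_count X Y m (Suc t) = (if scod_full_at X Y m t then Suc (scod_count X Y m t) else scod_count X Y m t)"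
  by (simp only: scod_count_def[of X Y m "Suc t"] scod_buffers_Suc) simp

lemma scod_count_mono: "s \<le> t \<Longrightarrow> scod_count X Y m s \<le> scod_count X Y m t"
  by (induct t rule: dec_induct) (auto simp: scod_count_Suc)

lemma scod_count_le: "scod_count X Y m t \<le> t"
proof (induct t)
  case 0
  show ?case by (simp add: scod_count_def)
next
  case (Suc t)
  then show ?case by (auto simp: scod_count_Suc)
qed

text \<open>The counter increases at every compression, so distinct compressions use draws and
  failure probabilities of distinct index.\<close>

lemma scod_count_inj: "inj_on (scod_count X Y m) {t. scod_full_at X Y m t}"
proof (rule linorder_inj_onI)
  fix s t assume "s < t" "s \<in> {t. scod_full_at X Y m t}" "t \<in> {t. scod_full_at X Y m t}"
  then have "scod_count X Y m (Suc s) = Suc (scod_count X Y m s)" by (simp add: scod_count_Suc)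
  with scod_count_mono[of "Suc s" t X Y m] \<open>s < t\<close>
  show "scod_count X Y m s \<noteq> scod_count X Y m t" by simp
qed auto

text \<open>The last row always triggers a compression, and an input without rows leaves the buffers
  as initialized.\<close>

lemma scod_state_final_buffers:
  assumes "scod_state X Y m q G t A B X' Y' i" "t = dim_row X"
  shows "X' = 0\<^sub>m 0 (dim_col X) \<and> Y' = 0\<^sub>m 0 (dim_col Y)"
  using assms by cases (auto simp: scod_full_def)

text \<open>Cauchy-Schwarz in the plane; it joins the bound for the earlier buffers with the norms
  of the current ones.\<close>

lemma sqrt_product_add_le:
  fixes a b c d :: real
  assumes "0 \<le> a" "0 \<le> b"
  shows "sqrt a * sqrt b + c * d \<le> sqrt (a + c\<^sup>2) * sqrt (b + d\<^sup>2)"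
proof -
  have "sqrt a * sqrt b + c * d \<le> sqrt ((sqrt a)\<^sup>2 + c\<^sup>2) * sqrt ((sqrt b)\<^sup>2 + d\<^sup>2)"
    using norm_cauchy_schwarz[of "(sqrt a, c)" "(sqrt b, d)"] by (simp add: norm_prod_def)
  then show ?thesis using assms by simp
qed

text \<open>\<open>N\<close> sums the buffer products compressed so far and \<open>P\<close> the products of their Frobenius norms;
  \<open>\<alpha>\<close>, \<open>\<beta>\<close> are the squared Frobenius norms of the rows already compressed; \<open>e\<close> sums the singular
  values \<open>\<sigma>\<^sub>m\<^sub>+\<^sub>1\<close> of the compressed products and \<open>\<Gamma>\<close> the shrinkages of the merges.\<close>

definition scod_invariant ::
  "real mat \<Rightarrow> real mat \<Rightarrow> nat \<Rightarrow> nat \<Rightarrow> real \<Rightarrow> nat \<Rightarrow> real mat \<Rightarrow> real mat \<Rightarrow> real mat \<Rightarrow> real mat \<Rightarrow> bool"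
where
  "scod_invariant X Y m k \<epsilon> t A B X' Y' \<longleftrightarrow>
    (\<exists>r N P \<alpha> \<beta> e \<Gamma>.
      A \<in> carrier_mat m (dim_col X) \<and> B \<in> carrier_mat m (dim_col Y) \<and>
      X' \<in> carrier_mat r (dim_col X) \<and> Y' \<in> carrier_mat r (dim_col Y) \<and>
      N \<in> carrier_mat (dim_col X) (dim_col Y) \<and> frobenius_norm A = frobenius_norm B \<and>
      (\<forall>i<dim_col X. \<forall>l<dim_col Y.
        N $$ (i, l) + (X'\<^sup>T * Y') $$ (i, l) = (\<Sum>s<t. X $$ (s, i) * Y $$ (s, l))) \<and>
      0 \<le> \<alpha> \<and> 0 \<le> \<beta> \<and> P \<le> sqrt \<alpha> * sqrt \<beta> \<and>
      \<alpha> + (frobenius_norm X')\<^sup>2 = (\<Sum>s<t. \<Sum>j<dim_col X. (X $$ (s, j))\<^sup>2) \<and>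
      \<beta> + (frobenius_norm Y')\<^sup>2 = (\<Sum>s<t. \<Sum>j<dim_col Y. (Y $$ (s, j))\<^sup>2) \<and>
      (real m - real k) * e + ky_fan_norm k N \<le> P \<and>
      real m * \<Gamma> + (frobenius_norm A)\<^sup>2 \<le> P \<and>
      spectral_norm (N - A\<^sup>T * B) \<le> \<Gamma> + (1 + \<epsilon>) * e)"

section \<open>Preservation of the invariant and the deterministic error bound\<close>

lemma ip_mv_zero:
  assumes "M \<in> carrier_mat d1 d2" "\<And>i l. i < d1 \<Longrightarrow> l < d2 \<Longrightarrow> M $$ (i, l) = 0"
  shows "ip d1 p (mv M x) = 0"
  using assms by (simp add: ip_def mv_def)

lemma ky_fan_zero:
  assumes M: "M \<in> carrier_mat d1 d2" "\<And>i l. i < d1 \<Longrightarrow> l < d2 \<Longrightarrow> M $$ (i, l) = 0"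
  shows "ky_fan_norm k M = 0"
proof -
  obtain p q where "ky_fan_norm k M = (\<Sum>i<k. ip d1 (p i) (mv M (q i)))"
    using ky_fan_attained[OF M(1)] by metis
  then show ?thesis by (simp add: ip_mv_zero[OF M])
qed

lemma scod_invariant_init:
  "scod_invariant X Y m k \<epsilon> 0 (0\<^sub>m m (dim_col X)) (0\<^sub>m m (dim_col Y))
    (0\<^sub>m 0 (dim_col X)) (0\<^sub>m 0 (dim_col Y))"
proof -
  let ?N = "0\<^sub>m (dim_col X) (dim_col Y) :: real mat"
  let ?D = "?N - (0\<^sub>m m (dim_col X))\<^sup>T * 0\<^sub>m m (dim_col Y)"
  have f0: "frobenius_norm (0\<^sub>m a b) = 0" for a b by (simp add: frobenius_norm_def)
  have D: "?D \<in> carrier_mat (dim_col X) (dim_col Y)" by (rule minus_carrier_mat) simp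
  have D0: "?D $$ (i, l) = 0" if "i < dim_col X" "l < dim_col Y" for i l
    using that by (simp add: scalar_prod_def)
  have "ky_fan_norm k ?N = 0" by (rule ky_fan_zero[of _ "dim_col X" "dim_col Y"]) auto
  moreover have "spectral_norm ?D = 0"
    unfolding spectral_norm_eq_ky_fan by (rule ky_fan_zero[OF D D0])
  ultimately show ?thesis
    unfolding scod_invariant_def
    by (intro exI[of _ 0] exI[of _ ?N])
      (auto simp: f0 scalar_prod_def intro!: exI[of _ "0 :: real"])
qed

lemma mat_of_row_frobenius:
  assumes X: "X \<in> carrier_mat n d" and t: "t < n"
  shows "(frobenius_norm (mat_of_row (Matrix.row X t)))\<^sup>2 = (\<Sum>j<d. (X $$ (t, j))\<^sup>2)"
  using X t by (simp add: frobenius_norm_sq mat_of_row_def)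

lemma scod_invariant_append:
  assumes inv: "scod_invariant X Y m k \<epsilon> t A B X' Y'" and t: "t < dim_row X" "t < dim_row Y"
  shows "scod_invariant X Y m k \<epsilon> (Suc t) A B
    (X' @\<^sub>r mat_of_row (Matrix.row X t)) (Y' @\<^sub>r mat_of_row (Matrix.row Y t))"
proof -
  let ?dx = "dim_col X" and ?dy = "dim_col Y"
  let ?x = "mat_of_row (Matrix.row X t)" and ?y = "mat_of_row (Matrix.row Y t)"
  obtain r N P \<alpha> \<beta> e \<Gamma> where
    A: "A \<in> carrier_mat m ?dx" "B \<in> carrier_mat m ?dy" and
    X': "X' \<in> carrier_mat r ?dx" and Y': "Y' \<in> carrier_mat r ?dy" and
    N: "N \<in> carrier_mat ?dx ?dy" "frobenius_norm A = frobenius_norm B" and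
    e: "\<forall>i<?dx. \<forall>l<?dy.
        N $$ (i, l) + (X'\<^sup>T * Y') $$ (i, l) = (\<Sum>s<t. X $$ (s, i) * Y $$ (s, l))" and
    ab: "0 \<le> \<alpha>" "0 \<le> \<beta>" "P \<le> sqrt \<alpha> * sqrt \<beta>" and
    a: "\<alpha> + (frobenius_norm X')\<^sup>2 = (\<Sum>s<t. \<Sum>j<?dx. (X $$ (s, j))\<^sup>2)" and
    b: "\<beta> + (frobenius_norm Y')\<^sup>2 = (\<Sum>s<t. \<Sum>j<?dy. (Y $$ (s, j))\<^sup>2)" and
    rest: "(real m - real k) * e + ky_fan_norm k N \<le> P"
      "real m * \<Gamma> + (frobenius_norm A)\<^sup>2 \<le> P"
      "spectral_norm (N - A\<^sup>T * B) \<le> \<Gamma> + (1 + \<epsilon>) * e"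
    using inv unfolding scod_invariant_def by blast
  have x: "?x \<in> carrier_mat 1 ?dx" and y: "?y \<in> carrier_mat 1 ?dy" by auto
  have X: "X \<in> carrier_mat (dim_row X) ?dx" and Y: "Y \<in> carrier_mat (dim_row Y) ?dy" by auto
  have X'': "X' @\<^sub>r ?x \<in> carrier_mat (r + 1) ?dx" by (rule carrier_append_rows[OF X' x])
  have Y'': "Y' @\<^sub>r ?y \<in> carrier_mat (r + 1) ?dy" by (rule carrier_append_rows[OF Y' y])
  have "N $$ (i, l) + ((X' @\<^sub>r ?x)\<^sup>T * (Y' @\<^sub>r ?y)) $$ (i, l) = (\<Sum>s<Suc t. X $$ (s, i) * Y $$ (s, l))"
    if il: "i < ?dx" "l < ?dy" for i l
  proof -
    have "((X' @\<^sub>r ?x)\<^sup>T * (Y' @\<^sub>r ?y)) $$ (i, l) = (X'\<^sup>T * Y') $$ (i, l) + (?x\<^sup>T * ?y) $$ (i, l)"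
      unfolding append_rows_transpose_mult[OF X' x Y' y] using x y il by simp
    also have "(?x\<^sup>T * ?y) $$ (i, l) = X $$ (t, i) * Y $$ (t, l)"
    proof -
      have "(?x\<^sup>T * ?y) $$ (i, l) = (\<Sum>k<1. ?x\<^sup>T $$ (i, k) * ?y $$ (k, l))"
        by (intro index_mult_mat_sum[of _ ?dx 1 _ ?dy]) (use il in auto)
      then show ?thesis using il t by (simp add: mat_of_row_def)
    qed
    finally show ?thesis using e il by simp
  qed
  moreover have "\<alpha> + (frobenius_norm (X' @\<^sub>r ?x))\<^sup>2 = (\<Sum>s<Suc t. \<Sum>j<?dx. (X $$ (s, j))\<^sup>2)"
    unfolding frobenius_append_rows[OF X' x] mat_of_row_frobenius[OF X t(1)] using a by simp
  moreover have "\<beta> + (frobenius_norm (Y' @\<^sub>r ?y))\<^sup>2 = (\<Sum>s<Suc t. \<Sum>j<?dy. (Y $$ (s, j))\<^sup>2)"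
    unfolding frobenius_append_rows[OF Y' y] mat_of_row_frobenius[OF Y t(2)] using b by simp
  ultimately show ?thesis
    unfolding scod_invariant_def using A X'' Y'' N ab rest by blast
qed

text \<open>The witnesses become \<open>N + M\<close>, \<open>P + F\<close>,
  \<open>e + \<sigma>\<close> and \<open>\<Gamma> + \<gamma>\<close>, and the squared norms of the
  buffers move into \<alpha> and \<beta>. \<open>F\<close> pays for what the compression adds to the
  potential, while the merge lowers the potential by \<open>m\<close> times what it adds to
  \<Gamma>.\<close>

lemma scod_invariant_compress:
  assumes inv: "scod_invariant X Y m k \<epsilon> t A B X' Y'"
    and m: "0 < m" "2 * m \<le> dim_col X" "2 * m \<le> dim_col Y" and k: "k < m"
    and G: "G \<in> carrier_mat (dim_col Y) m"
    and good: "\<And>Z. spm (X'\<^sup>T * Y') q G Z \<Longrightarrow>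
      spectral_norm (X'\<^sup>T * Y' - Z * Z\<^sup>T * (X'\<^sup>T * Y')) \<le> (1 + \<epsilon>) * sigma (Suc m) (X'\<^sup>T * Y')"
    and comp: "scod_compress m q G X' Y' Xt Yt" and merge: "scod_merge m A B Xt Yt A' B'"
  shows "scod_invariant X Y m k \<epsilon> t A' B' (0\<^sub>m 0 (dim_col X)) (0\<^sub>m 0 (dim_col Y))"
proof -
  let ?dx = "dim_col X" and ?dy = "dim_col Y"
  obtain r N P \<alpha> \<beta> e \<Gamma> where
    A: "A \<in> carrier_mat m ?dx" and B: "B \<in> carrier_mat m ?dy" and
    X': "X' \<in> carrier_mat r ?dx" and Y': "Y' \<in> carrier_mat r ?dy" and
    N: "N \<in> carrier_mat ?dx ?dy" and fAB: "frobenius_norm A = frobenius_norm B" and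
    eN: "\<forall>i<?dx. \<forall>l<?dy.
        N $$ (i, l) + (X'\<^sup>T * Y') $$ (i, l) = (\<Sum>s<t. X $$ (s, i) * Y $$ (s, l))" and
    ab: "0 \<le> \<alpha>" "0 \<le> \<beta>" and P: "P \<le> sqrt \<alpha> * sqrt \<beta>" and
    a: "\<alpha> + (frobenius_norm X')\<^sup>2 = (\<Sum>s<t. \<Sum>j<?dx. (X $$ (s, j))\<^sup>2)" and
    b: "\<beta> + (frobenius_norm Y')\<^sup>2 = (\<Sum>s<t. \<Sum>j<?dy. (Y $$ (s, j))\<^sup>2)" and
    eP: "(real m - real k) * e + ky_fan_norm k N \<le> P" and
    gP: "real m * \<Gamma> + (frobenius_norm A)\<^sup>2 \<le> P" and
    sp: "spectral_norm (N - A\<^sup>T * B) \<le> \<Gamma> + (1 + \<epsilon>) * e"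
    using inv unfolding scod_invariant_def by blast
  define M where "M = X'\<^sup>T * Y'"
  have M: "M \<in> carrier_mat ?dx ?dy" unfolding M_def using X' Y' by simp
  have mdy: "m \<le> ?dy" using m by simp
  obtain Z where Z: "spm M q G Z" and
    Xt: "Xt \<in> carrier_mat m ?dx" and Yt: "Yt \<in> carrier_mat m ?dy" and
    XYt: "Xt\<^sup>T * Yt = Z * Z\<^sup>T * M" and fXY: "frobenius_norm Xt = frobenius_norm Yt" and
    fXt: "(frobenius_norm Xt)\<^sup>2 \<le> frobenius_norm X' * frobenius_norm Y'"
    using scod_compress_props[OF X' Y' G mdy comp] unfolding M_def by blast
  obtain \<gamma> where A': "A' \<in> carrier_mat m ?dx" and B': "B' \<in> carrier_mat m ?dy" and
    fA'B': "frobenius_norm A' = frobenius_norm B'" and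
    pot: "(frobenius_norm A')\<^sup>2 + real m * \<gamma> \<le> (frobenius_norm A)\<^sup>2 + (frobenius_norm Xt)\<^sup>2" and
    g: "spectral_norm (A\<^sup>T * B + Xt\<^sup>T * Yt - A'\<^sup>T * B') \<le> \<gamma>"
    using scod_merge_props[OF m A B Xt Yt fAB fXY merge] by blast
  define \<sigma> where "\<sigma> = sigma (Suc m) M"
  define F where "F = frobenius_norm X' * frobenius_norm Y'"
  \<comment> \<open>Each singular value numbered \<open>k + 1\<close> to \<open>m\<close> is at
    least \<sigma>; together with the first \<open>k\<close> they sum to
    \<open>ky_fan_norm m M\<close>.\<close>
  have tail: "(real m - real k) * \<sigma> + ky_fan_norm k M \<le> F"
  proof -
    have "(\<Sum>j=k..<m. \<sigma>) \<le> (\<Sum>j=k..<m. sigma (Suc j) M)"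
      unfolding \<sigma>_def by (intro sum_mono sigma_antimono[OF M]) auto
    then have "(real m - real k) * \<sigma> \<le> (\<Sum>j=k..<m. sigma (Suc j) M)"
      using k by (simp add: of_nat_diff)
    moreover have "ky_fan_norm m M = ky_fan_norm k M + (\<Sum>j=k..<m. sigma (Suc j) M)"
      using sum.atLeastLessThan_concat[of 0 k m "\<lambda>j. sigma (Suc j) M"] k
      by (simp add: ky_fan_norm_lessThan atLeast0LessThan)
    moreover have "ky_fan_norm m M \<le> F"
      unfolding M_def F_def by (rule ky_fan_le_frobenius[OF X' Y'])
    ultimately show ?thesis by linarith
  qed
  have NM: "N + M \<in> carrier_mat ?dx ?dy" using M by simp
  have eP': "(real m - real k) * (e + \<sigma>) + ky_fan_norm k (N + M) \<le> P + F"
    using ky_fan_triangle[OF N M, of k] tail eP by (simp add: algebra_simps)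
  have gP': "real m * (\<Gamma> + \<gamma>) + (frobenius_norm A')\<^sup>2 \<le> P + F"
    using gP pot fXt by (simp add: F_def algebra_simps)
  have P': "P + F \<le> sqrt (\<alpha> + (frobenius_norm X')\<^sup>2) * sqrt (\<beta> + (frobenius_norm Y')\<^sup>2)"
    using P sqrt_product_add_le[OF ab, of "frobenius_norm X'" "frobenius_norm Y'"]
    by (simp add: F_def)
  have sp': "spectral_norm (N + M - A'\<^sup>T * B') \<le> (\<Gamma> + \<gamma>) + (1 + \<epsilon>) * (e + \<sigma>)"
  proof -
    \<comment> \<open>The new error splits into the old error, the compression error and the merge
      error.\<close>
    have telescope: "N + M - R = (N - Q) + (M - S) + (Q + S - R)"
      if "Q \<in> carrier_mat ?dx ?dy" "S \<in> carrier_mat ?dx ?dy" "R \<in> carrier_mat ?dx ?dy" for Q R S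
      by (rule eq_matI) (use N M that in auto)
    define E1 where "E1 = N - A\<^sup>T * B"
    define E2 where "E2 = M - Z * Z\<^sup>T * M"
    define E3 where "E3 = A\<^sup>T * B + Xt\<^sup>T * Yt - A'\<^sup>T * B'"
    have AB: "A\<^sup>T * B \<in> carrier_mat ?dx ?dy" and AB': "A'\<^sup>T * B' \<in> carrier_mat ?dx ?dy"
      and XY: "Xt\<^sup>T * Yt \<in> carrier_mat ?dx ?dy" using A B A' B' Xt Yt by auto
    then have E: "E1 \<in> carrier_mat ?dx ?dy" "E2 \<in> carrier_mat ?dx ?dy" "E3 \<in> carrier_mat ?dx ?dy"
      unfolding E1_def E2_def E3_def XYt[symmetric] by (auto intro: minus_carrier_mat)
    have "N + M - A'\<^sup>T * B' = E1 + E2 + E3"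
      unfolding E1_def E2_def E3_def XYt[symmetric]
      by (rule telescope[OF AB XY AB'])
    moreover have "spectral_norm (E1 + E2 + E3) \<le> spectral_norm E1 + spectral_norm E2 + spectral_norm E3"
      using spectral_norm_triangle[of "E1 + E2" ?dx ?dy E3] spectral_norm_triangle[OF E(1,2)] E by simp
    moreover have "spectral_norm E2 \<le> (1 + \<epsilon>) * \<sigma>"
      unfolding E2_def \<sigma>_def using good[folded M_def, OF Z] .
    ultimately show ?thesis using sp g unfolding E1_def E3_def by (simp add: algebra_simps)
  qed
  have eN': "\<forall>i<?dx. \<forall>l<?dy. (N + M) $$ (i, l) + ((0\<^sub>m 0 ?dx)\<^sup>T * 0\<^sub>m 0 ?dy) $$ (i, l) =
      (\<Sum>s<t. X $$ (s, i) * Y $$ (s, l))"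
    using eN M unfolding M_def[symmetric] by (simp add: scalar_prod_def)
  have f0: "(frobenius_norm (0\<^sub>m 0 d))\<^sup>2 = 0" for d by (simp add: frobenius_norm_sq)
  have ab': "0 \<le> \<alpha> + (frobenius_norm X')\<^sup>2" "0 \<le> \<beta> + (frobenius_norm Y')\<^sup>2" using ab by auto
  have a': "\<alpha> + (frobenius_norm X')\<^sup>2 + (frobenius_norm (0\<^sub>m 0 ?dx))\<^sup>2 =
      (\<Sum>s<t. \<Sum>j<?dx. (X $$ (s, j))\<^sup>2)"
    unfolding f0 a by simp
  have b': "\<beta> + (frobenius_norm Y')\<^sup>2 + (frobenius_norm (0\<^sub>m 0 ?dy))\<^sup>2 =
      (\<Sum>s<t. \<Sum>j<?dy. (Y $$ (s, j))\<^sup>2)"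
    unfolding f0 b by simp
  show ?thesis
    unfolding scod_invariant_def
    by (intro exI conjI, rule A', rule B', rule zero_carrier_mat, rule zero_carrier_mat, rule NM,
        rule fA'B', rule eN', rule ab', rule ab', rule P', rule a', rule b', rule eP', rule gP', rule sp')
qed

lemma scod_state_invariant:
  assumes st: "scod_state X Y m q G t A B X' Y' i"
    and XY: "dim_row X = dim_row Y"
    and m: "0 < m" "2 * m \<le> dim_col X" "2 * m \<le> dim_col Y" and k: "k < m"
    and G: "\<And>i. G i \<in> carrier_mat (dim_col Y) m"
    and good: "\<And>t Z. t < dim_row X \<Longrightarrow> scod_full_at X Y m t \<Longrightarrow>
      spm ((scod_buffer_x X Y m t)\<^sup>T * scod_buffer_y X Y m t) (q (Suc (scod_count X Y m t)))
        (G (Suc (scod_count X Y m t))) Z \<Longrightarrow>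
      spectral_norm ((scod_buffer_x X Y m t)\<^sup>T * scod_buffer_y X Y m t -
          Z * Z\<^sup>T * ((scod_buffer_x X Y m t)\<^sup>T * scod_buffer_y X Y m t))
        \<le> (1 + \<epsilon>) * sigma (Suc m) ((scod_buffer_x X Y m t)\<^sup>T * scod_buffer_y X Y m t)"
  shows "scod_invariant X Y m k \<epsilon> t A B X' Y'"
  using st
proof induct
  case init
  show ?case by (rule scod_invariant_init)
next
  case (buffer t A B X' Y' i X'' Y'')
  then show ?case using XY by (auto intro: scod_invariant_append)
next
  case (compress t A B X' Y' i X'' Y'' Xt Yt A' B')
  have buf: "scod_buffers X Y m t = (X', Y', i)" by (rule scod_state_buffers[OF compress(1)])
  have bx: "scod_buffer_x X Y m t = X''" and buf_y: "scod_buffer_y X Y m t = Y''"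
    and cnt: "scod_count X Y m t = i"
    using buf compress by (simp_all add: scod_buffer_x_def scod_buffer_y_def scod_count_def)
  have full: "scod_full_at X Y m t" using compress bx buf_y by (simp add: scod_full_at_def)
  have inv: "scod_invariant X Y m k \<epsilon> (Suc t) A B X'' Y''"
    using compress XY by (auto intro: scod_invariant_append)
  show ?case
    by (rule scod_invariant_compress[OF inv m k G _ compress(7,8)])
      (use good[OF compress(3) full] in \<open>simp add: bx buf_y cnt\<close>)
qed


lemma scod_output_error:
  assumes out: "scod_output X Y m q G A B" and X: "X \<in> carrier_mat n d1" and Y: "Y \<in> carrier_mat n d2"
    and m: "0 < m" "2 * m \<le> d1" "2 * m \<le> d2" and k: "k < m" and \<epsilon>: "0 \<le> \<epsilon>"
    and G: "\<And>i. G i \<in> carrier_mat d2 m"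
    and good: "\<And>t Z. t < n \<Longrightarrow> scod_full_at X Y m t \<Longrightarrow>
      spm ((scod_buffer_x X Y m t)\<^sup>T * scod_buffer_y X Y m t) (q (Suc (scod_count X Y m t)))
        (G (Suc (scod_count X Y m t))) Z \<Longrightarrow>
      spectral_norm ((scod_buffer_x X Y m t)\<^sup>T * scod_buffer_y X Y m t -
          Z * Z\<^sup>T * ((scod_buffer_x X Y m t)\<^sup>T * scod_buffer_y X Y m t))
        \<le> (1 + \<epsilon>) * sigma (Suc m) ((scod_buffer_x X Y m t)\<^sup>T * scod_buffer_y X Y m t)"
  shows "spectral_norm (X\<^sup>T * Y - A\<^sup>T * B)
    \<le> ((2 + \<epsilon>) / (real m - real k) + (1 + \<epsilon>) * real k / (real m - real k)\<^sup>2) *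
      (frobenius_norm X * frobenius_norm Y - ky_fan_norm k (X\<^sup>T * Y))"
proof -
  have dims: "dim_row X = n" "dim_row Y = n" "dim_col X = d1" "dim_col Y = d2" using X Y by auto
  obtain X' Y' i where st: "scod_state X Y m q G n A B X' Y' i"
    using out unfolding scod_output_def dims by blast
  have XY': "X' = 0\<^sub>m 0 d1" "Y' = 0\<^sub>m 0 d2"
    using scod_state_final_buffers[OF st] by (simp_all add: dims)
  have "scod_invariant X Y m k \<epsilon> n A B X' Y'"
    by (rule scod_state_invariant[OF st]) (use m k G good in \<open>simp_all add: dims\<close>)
  then obtain N P \<alpha> \<beta> e \<Gamma> where
    A: "A \<in> carrier_mat m d1" and B: "B \<in> carrier_mat m d2" and
    N: "N \<in> carrier_mat d1 d2" and fAB: "frobenius_norm A = frobenius_norm B" and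
    eN: "\<forall>i<d1. \<forall>l<d2. N $$ (i, l) + (X'\<^sup>T * Y') $$ (i, l) = (\<Sum>s<n. X $$ (s, i) * Y $$ (s, l))" and
    P: "P \<le> sqrt \<alpha> * sqrt \<beta>" and
    a: "\<alpha> + (frobenius_norm X')\<^sup>2 = (\<Sum>s<n. \<Sum>j<d1. (X $$ (s, j))\<^sup>2)" and
    b: "\<beta> + (frobenius_norm Y')\<^sup>2 = (\<Sum>s<n. \<Sum>j<d2. (Y $$ (s, j))\<^sup>2)" and
    eP: "(real m - real k) * e + ky_fan_norm k N \<le> P" and
    gP: "real m * \<Gamma> + (frobenius_norm A)\<^sup>2 \<le> P" and
    sp: "spectral_norm (N - A\<^sup>T * B) \<le> \<Gamma> + (1 + \<epsilon>) * e"
    unfolding scod_invariant_def dims by blast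
  have NXY: "N = X\<^sup>T * Y"
  proof (rule eq_matI)
    fix i l assume "i < dim_row (X\<^sup>T * Y)" "l < dim_col (X\<^sup>T * Y)"
    then have il: "i < d1" "l < d2" using X Y by auto
    have "N $$ (i, l) = (\<Sum>s<n. X $$ (s, i) * Y $$ (s, l))"
      using eN il unfolding XY' by (simp add: scalar_prod_def)
    also have "\<dots> = (X\<^sup>T * Y) $$ (i, l)"
      by (subst index_mult_mat_sum[of _ d1 n _ d2]) (use X Y il in auto)
    finally show "N $$ (i, l) = (X\<^sup>T * Y) $$ (i, l)" .
  qed (use X Y N in auto)
  have "sqrt \<alpha> = frobenius_norm X" "sqrt \<beta> = frobenius_norm Y"
    using a b X Y unfolding XY' by (simp_all add: frobenius_norm_def)
  then have PF: "P \<le> frobenius_norm X * frobenius_norm Y" using P by simp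
  define T where "T = frobenius_norm X * frobenius_norm Y - ky_fan_norm k N"
  define h where "h = real m - real k"
  have h: "0 < h" using k by (simp add: h_def)
  have AB: "A\<^sup>T * B \<in> carrier_mat d1 d2" using A B by simp
  have D: "N - A\<^sup>T * B \<in> carrier_mat d1 d2" by (rule minus_carrier_mat[OF AB])
  have "h * e \<le> T" using eP PF by (simp add: T_def h_def)
  then have e: "e \<le> T / h" using h by (simp add: field_simps)
  have "N = A\<^sup>T * B + (N - A\<^sup>T * B)" by (rule eq_matI) (use N AB in auto)
  then have "ky_fan_norm k N \<le> ky_fan_norm k (A\<^sup>T * B) + ky_fan_norm k (N - A\<^sup>T * B)"
    using ky_fan_triangle[OF AB D, of k] by simp
  also have "ky_fan_norm k (A\<^sup>T * B) \<le> (frobenius_norm A)\<^sup>2"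
    using ky_fan_le_frobenius[OF A B, of k] by (simp add: fAB power2_eq_square)
  also have "ky_fan_norm k (N - A\<^sup>T * B) \<le> real k * (\<Gamma> + (1 + \<epsilon>) * e)"
    using ky_fan_le_spectral[OF D, of k] mult_left_mono[OF sp, of "real k"] by simp
  \<comment> \<open>\<Gamma> occurs twice: the potential bounds \<open>m * \<Gamma>\<close>, the
    comparison of Ky Fan norms returns \<open>k * \<Gamma>\<close>, and the difference leaves the
    factor \<open>h\<close>.\<close>
  finally have "h * \<Gamma> \<le> T + real k * ((1 + \<epsilon>) * e)"
    using gP PF by (simp add: T_def h_def algebra_simps)
  also have "\<dots> \<le> T + real k * ((1 + \<epsilon>) * (T / h))"
    using e \<epsilon> by (intro add_left_mono mult_left_mono) auto
  finally have "\<Gamma> \<le> (T + real k * ((1 + \<epsilon>) * (T / h))) / h" using h by (simp add: field_simps)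
  moreover have "(1 + \<epsilon>) * e \<le> (1 + \<epsilon>) * (T / h)" using e \<epsilon> by (intro mult_left_mono) auto
  ultimately have "spectral_norm (N - A\<^sup>T * B) \<le>
      (T + real k * ((1 + \<epsilon>) * (T / h))) / h + (1 + \<epsilon>) * (T / h)" using sp by linarith
  also have "\<dots> = ((2 + \<epsilon>) / h + (1 + \<epsilon>) * real k / h\<^sup>2) * T"
    using h by (simp add: field_simps power2_eq_square)
  finally show ?thesis unfolding T_def h_def NXY .
qed

section \<open>Failure probabilities and the union bound\<close>

lemma sum_inverse_squares_le: "(\<Sum>i = 1..n. 1 / (real i)\<^sup>2) \<le> 2"
proof (cases n)
  case (Suc k)
  \<comment> \<open>The sharper bound telescopes, since each new term is at most a difference of
    consecutive reciprocals.\<close>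
  have "(\<Sum>i = 1..Suc k. 1 / (real i)\<^sup>2) \<le> 2 - 1 / real (Suc k)"
  proof (induct k)
    case (Suc k)
    have "1 / (real (Suc (Suc k)))\<^sup>2 \<le> 1 / (real (Suc k) * real (Suc (Suc k)))"
      unfolding power2_eq_square by (intro divide_left_mono mult_right_mono) auto
    also have "\<dots> = 1 / real (Suc k) - 1 / real (Suc (Suc k))" by (simp add: field_simps)
    finally show ?case using Suc by simp
  qed simp
  moreover have "0 \<le> 1 / real (Suc k)" by simp
  ultimately show ?thesis unfolding Suc by linarith
qed simp

lemma sum_fail_prob_le:
  assumes "0 < \<delta>"
  shows "(\<Sum>i = 1..n. fail_prob \<delta> i) \<le> \<delta>"
proof -
  have "(\<Sum>i = 1..n. fail_prob \<delta> i) = \<delta> / 2 * (\<Sum>i = 1..n. 1 / (real i)\<^sup>2)"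
    by (simp add: fail_prob_def sum_distrib_left)
  also have "\<dots> \<le> \<delta> / 2 * 2" using assms by (intro mult_left_mono sum_inverse_squares_le) auto
  finally show ?thesis by simp
qed

lemma fail_prob_bounds:
  assumes "0 < \<delta>" "\<delta> < 1" "1 \<le> i"
  shows "0 < fail_prob \<delta> i" "fail_prob \<delta> i \<le> 1 / 2"
proof -
  show "0 < fail_prob \<delta> i" using assms by (simp add: fail_prob_def)
  have "1 \<le> (real i)\<^sup>2" using assms by simp
  then have "\<delta> / (2 * (real i)\<^sup>2) \<le> 1 / (2 * 1)" using assms by (intro frac_le) auto
  then show "fail_prob \<delta> i \<le> 1 / 2" by (simp add: fail_prob_def)
qed

lemma prob_space_gaussian_draws: "prob_space (gaussian_draws d m)"
  unfolding gaussian_draws_def by (rule prob_space_PiM) (rule prob_space_gaussian_entries)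

lemma gaussian_draws_component:
  assumes i: "1 \<le> i" and E: "E \<in> sets (gaussian_entries d m)"
  shows "{\<omega> \<in> space (gaussian_draws d m). \<omega> i \<notin> E} \<in> sets (gaussian_draws d m)"
    "measure (gaussian_draws d m) {\<omega> \<in> space (gaussian_draws d m). \<omega> i \<notin> E} =
      1 - measure (gaussian_entries d m) E"
proof -
  let ?D = "gaussian_draws d m" and ?G = "gaussian_entries d m"
  interpret G: prob_space ?G by (rule prob_space_gaussian_entries)
  have c [measurable]: "(\<lambda>\<omega>. \<omega> i) \<in> ?D \<rightarrow>\<^sub>M ?G"
    unfolding gaussian_draws_def using i by (intro measurable_component_singleton) simp
  have E': "space ?G - E \<in> sets ?G" using E by auto
  have e: "{\<omega> \<in> space ?D. \<omega> i \<notin> E} = (\<lambda>\<omega>. \<omega> i) -` (space ?G - E) \<inter> space ?D"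
    using measurable_space[OF c] by auto
  show "{\<omega> \<in> space ?D. \<omega> i \<notin> E} \<in> sets ?D" unfolding e by (rule measurable_sets[OF c E'])
  have "measure ?D {\<omega> \<in> space ?D. \<omega> i \<notin> E} = measure (distr ?D ?G (\<lambda>\<omega>. \<omega> i)) (space ?G - E)"
    unfolding e by (rule measure_distr[OF c E', symmetric])
  also have "distr ?D ?G (\<lambda>\<omega>. \<omega> i) = ?G"
    unfolding gaussian_draws_def
    by (rule distr_PiM_component) (use i prob_space_gaussian_entries in auto)
  also have "measure ?G (space ?G - E) = 1 - measure ?G E" by (rule G.prob_compl[OF E])
  finally show "measure ?D {\<omega> \<in> space ?D. \<omega> i \<notin> E} = 1 - measure ?G E" .
qed

text \<open>Each draw has the marginal law \<open>gaussian_entries\<close>, and injectivity of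
  \<open>idx\<close> turns the failure probabilities into part of the sum over \<open>1..n\<close>,
  which is at most \<delta>.\<close>

lemma gaussian_draws_union_bound:
  fixes idx :: "'t \<Rightarrow> nat"
  assumes S: "finite S" "inj_on idx S" "idx ` S \<subseteq> {1..n}" and \<delta>: "0 < \<delta>"
    and E: "\<And>t. t \<in> S \<Longrightarrow> E t \<in> sets (gaussian_entries d m)"
      "\<And>t. t \<in> S \<Longrightarrow> 1 - fail_prob \<delta> (idx t) \<le> measure (gaussian_entries d m) (E t)"
  shows "with_prob_at_least (gaussian_draws d m) (1 - \<delta>) (\<lambda>\<omega>. \<forall>t\<in>S. \<omega> (idx t) \<in> E t)"
proof -
  let ?D = "gaussian_draws d m"
  interpret prob_space ?D by (rule prob_space_gaussian_draws)
  define B where "B t = {\<omega> \<in> space ?D. \<omega> (idx t) \<notin> E t}" for t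
  have idx: "1 \<le> idx t" if "t \<in> S" for t using S(3) that by auto
  have B: "B t \<in> sets ?D" "measure ?D (B t) \<le> fail_prob \<delta> (idx t)" if t: "t \<in> S" for t
    using gaussian_draws_component[OF idx[OF t] E(1)[OF t]] E(2)[OF t] by (simp_all add: B_def)
  have U: "(\<Union>t\<in>S. B t) \<in> sets ?D" using S(1) B(1) by (intro sets.finite_UN) auto
  have "measure ?D (\<Union>t\<in>S. B t) \<le> (\<Sum>t\<in>S. measure ?D (B t))"
    by (rule measure_UNION_le) (use S(1) B(1) in auto)
  also have "\<dots> \<le> (\<Sum>t\<in>S. fail_prob \<delta> (idx t))" by (intro sum_mono B(2))
  also have "\<dots> = (\<Sum>i\<in>idx ` S. fail_prob \<delta> i)" by (simp add: sum.reindex[OF S(2)])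
  also have "\<dots> \<le> (\<Sum>i = 1..n. fail_prob \<delta> i)"
    by (rule sum_mono2) (use S(3) \<delta> in \<open>auto simp: fail_prob_def\<close>)
  also have "\<dots> \<le> \<delta>" by (rule sum_fail_prob_le[OF \<delta>])
  finally have "1 - \<delta> \<le> measure ?D (space ?D - (\<Union>t\<in>S. B t))" using prob_compl[OF U] by simp
  then show ?thesis
    unfolding with_prob_at_least_def
    by (intro bexI[of _ "space ?D - (\<Union>t\<in>S. B t)"]) (use U in \<open>auto simp: B_def\<close>)
qed

section \<open>Dimensions of the buffers and assembly of the probability bound\<close>

lemma append_row_carrier:
  assumes "A \<in> carrier_mat r (dim_col X)"
  shows "A @\<^sub>r mat_of_row (Matrix.row X t) \<in> carrier_mat (r + 1) (dim_col X)"
  by (rule carrier_append_rows[OF assms]) simp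

lemma scod_buffers_carrier:
  assumes "scod_buffers X Y m t = (X', Y', i)"
  shows "\<exists>r. X' \<in> carrier_mat r (dim_col X) \<and> Y' \<in> carrier_mat r (dim_col Y)"
  using assms
proof (induct t arbitrary: X' Y' i)
  case 0
  then show ?case by (auto intro!: exI[of _ 0])
next
  case (Suc t)
  obtain X0 Y0 j where b: "scod_buffers X Y m t = (X0, Y0, j)" by (cases "scod_buffers X Y m t") auto
  obtain r where r: "X0 \<in> carrier_mat r (dim_col X)" "Y0 \<in> carrier_mat r (dim_col Y)"
    using Suc(1)[OF b] by blast
  have "scod_buffer_x X Y m t \<in> carrier_mat (r + 1) (dim_col X)"
    "scod_buffer_y X Y m t \<in> carrier_mat (r + 1) (dim_col Y)"
    unfolding scod_buffer_x_def scod_buffer_y_def b fst_conv snd_conv by (rule append_row_carrier, rule r)+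
  moreover have "0\<^sub>m 0 (dim_col X) \<in> carrier_mat 0 (dim_col X) \<and>
      0\<^sub>m 0 (dim_col Y) \<in> carrier_mat 0 (dim_col Y)" by simp
  ultimately show ?case
    using Suc(2) unfolding scod_buffers_Suc by (metis Pair_inject)
qed

lemma scod_buffer_product_carrier:
  "(scod_buffer_x X Y m t)\<^sup>T * scod_buffer_y X Y m t \<in> carrier_mat (dim_col X) (dim_col Y)"
proof -
  obtain X' Y' i where b: "scod_buffers X Y m t = (X', Y', i)" by (cases "scod_buffers X Y m t") auto
  obtain r where r: "X' \<in> carrier_mat r (dim_col X)" "Y' \<in> carrier_mat r (dim_col Y)"
    using scod_buffers_carrier[OF b] by blast
  have "scod_buffer_x X Y m t \<in> carrier_mat (r + 1) (dim_col X)"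
    "scod_buffer_y X Y m t \<in> carrier_mat (r + 1) (dim_col Y)"
    unfolding scod_buffer_x_def scod_buffer_y_def b fst_conv snd_conv
    by (rule append_row_carrier, rule r)+
  then show ?thesis by simp
qed

text \<open>At a compression time \<open>t\<close> the product \<open>M t\<close> is a fixed matrix,
  so \<open>spm_success\<close> gives an event for the draw with index \<open>idx t\<close>. Where
  all these events occur, \<open>scod_output_error\<close> covers every admissible choice of
  factorizations and every \<open>k\<close> at once.\<close>

lemma scod_bound_with_prob:
  fixes \<epsilon> \<epsilon>\<^sub>0 \<delta> :: real
  assumes m: "0 < m" "2 * m \<le> d1" "2 * m \<le> d2"
    and X: "X \<in> carrier_mat n d1" and Y: "Y \<in> carrier_mat n d2"
    and \<delta>: "0 < \<delta>" "\<delta> < 1" and \<epsilon>: "0 < \<epsilon>" "\<epsilon> \<le> \<epsilon>\<^sub>0"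
    and q: "\<And>i. 1 \<le> i \<Longrightarrow>
      2 * (1 + \<epsilon>\<^sub>0) * (ln (real m * real d1 / fail_prob \<delta> i) / \<epsilon>) \<le> real (q i)"
  shows "with_prob_at_least (gaussian_draws d2 m) (1 - \<delta>)
    (\<lambda>\<omega>. \<forall>A B. scod_output X Y m q (\<lambda>i. Matrix.mat d2 m (\<omega> i)) A B \<longrightarrow>
      (\<forall>k<m. spectral_norm (X\<^sup>T * Y - A\<^sup>T * B)
        \<le> ((2 + \<epsilon>) / (real m - real k) + (1 + \<epsilon>) * real k / (real m - real k)\<^sup>2) *
          (frobenius_norm X * frobenius_norm Y - ky_fan_norm k (X\<^sup>T * Y))))"
proof -
  define S where "S = {t. t < n \<and> scod_full_at X Y m t}"
  define idx where "idx t = Suc (scod_count X Y m t)" for t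
  define M where "M t = (scod_buffer_x X Y m t)\<^sup>T * scod_buffer_y X Y m t" for t
  have S: "finite S" by (simp add: S_def)
  have inj: "inj_on idx S"
    using scod_count_inj[of X Y m] unfolding S_def idx_def by (auto simp: inj_on_def)
  have rng: "idx ` S \<subseteq> {1..n}"
    unfolding S_def idx_def by (auto simp: Suc_le_eq intro: le_less_trans[OF scod_count_le])
  have M: "M t \<in> carrier_mat d1 d2" for t
    using scod_buffer_product_carrier[of X Y m t] X Y by (simp add: M_def)
  have "\<exists>E. E \<in> sets (gaussian_entries d2 m) \<and>
      1 - fail_prob \<delta> (idx t) \<le> measure (gaussian_entries d2 m) E \<and>
      (\<forall>g\<in>E. \<forall>Z. spm (M t) (q (idx t)) (Matrix.mat d2 m g) Z \<longrightarrow>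
        spectral_norm (M t - Z * Z\<^sup>T * M t) \<le> (1 + \<epsilon>) * sigma (Suc m) (M t))" for t
  proof -
    have i: "1 \<le> idx t" by (simp add: idx_def)
    show ?thesis
      using spm_success[OF M[of t] m(1) _ _ fail_prob_bounds[OF \<delta> i] \<epsilon> q[OF i]] m by auto
  qed
  then obtain E where E: "\<And>t. E t \<in> sets (gaussian_entries d2 m)"
    "\<And>t. 1 - fail_prob \<delta> (idx t) \<le> measure (gaussian_entries d2 m) (E t)"
    "\<And>t g Z. g \<in> E t \<Longrightarrow> spm (M t) (q (idx t)) (Matrix.mat d2 m g) Z \<Longrightarrow>
        spectral_norm (M t - Z * Z\<^sup>T * M t) \<le> (1 + \<epsilon>) * sigma (Suc m) (M t)"
    by metis
  obtain W where W: "W \<in> sets (gaussian_draws d2 m)" "1 - \<delta> \<le> measure (gaussian_draws d2 m) W"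
    and good: "\<And>\<omega> t. \<omega> \<in> W \<Longrightarrow> t \<in> S \<Longrightarrow> \<omega> (idx t) \<in> E t"
    using gaussian_draws_union_bound[OF S inj rng \<delta>(1) E(1,2)] unfolding with_prob_at_least_def by blast
  show ?thesis
    unfolding with_prob_at_least_def
  proof (intro bexI[OF _ W(1)] conjI W(2) ballI allI impI)
    fix \<omega> A B k
    assume \<omega>: "\<omega> \<in> W" and k: "k < m"
      and out: "scod_output X Y m q (\<lambda>i. Matrix.mat d2 m (\<omega> i)) A B"
    show "spectral_norm (X\<^sup>T * Y - A\<^sup>T * B)
        \<le> ((2 + \<epsilon>) / (real m - real k) + (1 + \<epsilon>) * real k / (real m - real k)\<^sup>2) *
          (frobenius_norm X * frobenius_norm Y - ky_fan_norm k (X\<^sup>T * Y))"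
    proof (rule scod_output_error[OF out X Y m k])
      fix t Z
      assume t: "t < n" "scod_full_at X Y m t"
        and spm: "spm ((scod_buffer_x X Y m t)\<^sup>T * scod_buffer_y X Y m t) (q (Suc (scod_count X Y m t)))
          (Matrix.mat d2 m (\<omega> (Suc (scod_count X Y m t)))) Z"
      have "\<omega> (idx t) \<in> E t" using good[OF \<omega>] t by (simp add: S_def)
      from E(3)[OF this] spm
      show "spectral_norm ((scod_buffer_x X Y m t)\<^sup>T * scod_buffer_y X Y m t -
          Z * Z\<^sup>T * ((scod_buffer_x X Y m t)\<^sup>T * scod_buffer_y X Y m t))
        \<le> (1 + \<epsilon>) * sigma (Suc m) ((scod_buffer_x X Y m t)\<^sup>T * scod_buffer_y X Y m t)"
        unfolding M_def idx_def by blast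
    qed (use \<epsilon> in auto)
  qed
qed

theorem theorem3:
  fixes \<epsilon>\<^sub>0 :: real
  assumes "0 < \<epsilon>\<^sub>0"
  shows "\<exists>c>0. \<forall>(C::real) (a::nat).
    \<forall>(n::nat) (m::nat) (d\<^sub>x::nat) (d\<^sub>y::nat) (X::real mat) (Y::real mat)
      (\<delta>::real) (\<epsilon>::real) (q::nat \<Rightarrow> nat).
      0 < m \<and> 2 * m \<le> d\<^sub>x \<and> 2 * m \<le> d\<^sub>y \<and>
      X \<in> carrier_mat n d\<^sub>x \<and> Y \<in> carrier_mat n d\<^sub>y \<and>
      0 < \<delta> \<and> \<delta> < 1 \<and> 0 < \<epsilon> \<and> \<epsilon> \<le> \<epsilon>\<^sub>0 \<and>
      (\<forall>i\<ge>1. order_up_to_logs c C a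
         (2 + real n * real m * real d\<^sub>x * real d\<^sub>y / (fail_prob \<delta> i * \<epsilon>))
         (ln (real m * real d\<^sub>x / fail_prob \<delta> i) / \<epsilon>)
         (real (q i)))
      \<longrightarrow>
      with_prob_at_least (gaussian_draws d\<^sub>y m) (1 - \<delta>)
        (\<lambda>\<omega>. \<forall>A B. scod_output X Y m q (\<lambda>i. Matrix.mat d\<^sub>y m (\<omega> i)) A B \<longrightarrow>
           (\<forall>k<m. spectral_norm (X\<^sup>T * Y - A\<^sup>T * B)
              \<le> ((2 + \<epsilon>) / (real m - real k) + (1 + \<epsilon>) * real k / (real m - real k)\<^sup>2) *
                (frobenius_norm X * frobenius_norm Y - ky_fan_norm k (X\<^sup>T * Y))))"
\<comment> \<open>The constant comes from \<open>iteration_count_suffices\<close>. It depends only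
  on the upper limit for \<epsilon>, hence is uniform in the sizes, in \<delta> and in
  \<open>C\<close> and \<open>a\<close>.\<close>
proof (intro exI[of _ "2 * (1 + \<epsilon>\<^sub>0)"] conjI allI impI)
  show "0 < 2 * (1 + \<epsilon>\<^sub>0)" using assms by simp
qed (rule scod_bound_with_prob[where \<epsilon>\<^sub>0 = \<epsilon>\<^sub>0], auto simp: order_up_to_logs_def)

end
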